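(* Let $E\subset\mathbb{R}$ be a Parreau--Widom set of positive Lebesgue measure. Then the equilibrium measure $\mu_E$ of $E$ is absolutely continuous with respect to Lebesgue measure.
   Context: Parreau--Widom sets: Let $E\subset\mathbb{R}$ be compact with positive logarithmic capacity $\operatorname{Cap}(E)>0$, and let $g$ be the Green's function for $\Omega=\overline{\mathbb{C}}\setminus E$ with pole at $\infty$ (positive and harmonic on $\Omega\setminus\{\infty\}$, with $g(x)=\log|x|-\log\operatorname{Cap}(E)+o(1)$ at $\infty$). $E$ is called regular if $\lim_{\Omega\ni x\to t}g(x)=0$ for every $t\in E$; then $E$ has no isolated points and $g$ is extended by $0$ to $E$. Write $E=[\alpha,\beta]\setminus\bigcup_j(\alpha_j,\beta_j)$ with $\alpha=\min E$, $\beta=\max E$ and countably many (possibly finitely many or no) disjoint open gaps $(\alpha_j,\beta_j)$. On each gap $g$ is strictly concave, hence attains its maximum over the gap at a unique point $c_j\in(\alpha_j,\beta_j)$; the $c_j$ are the critical points of $g$. $E$ is a Parreau--Widom set if it is compact, $\operatorname{Cap}(E)>0$, $E$ is regular, and $\sum_j g(c_j)<\infty$. The equilibrium measure $\mu_E$ is the unique probability measure on $E$ minimizing the logarithmic energy $\iint\log\frac{1}{|s-t|}\,d\mu(s)\,d\mu(t)$. *)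

theory Defs
  imports "HOL-Probability.Probability"
begin

definition prob_measures_on :: "real set \<Rightarrow> real measure set" where
  "prob_measures_on E = {\<mu>. prob_space \<mu> \<and> sets \<mu> = sets borel \<and> emeasure \<mu> E = 1}"

definition log_kernel :: "real \<Rightarrow> real \<Rightarrow> ereal" where
  "log_kernel s t = (if s = t then \<infinity> else ereal (ln (1 / \<bar>s - t\<bar>)))"

text \<open>The double integral of the logarithmic kernel, as the integral of its positive part minus
  that of its negative part (\<^const>\<open>e2ennreal\<close> sends negative numbers to \<open>0\<close>). For measures of
  compact support the second integral is finite, so the energy lies in \<open>(-\<infinity>, \<infinity>]\<close>.\<close>

definition log_energy :: "real measure \<Rightarrow> ereal" where
  "log_energy \<mu> =
     enn2ereal (\<integral>\<^sup>+ s. (\<integral>\<^sup>+ t. e2ennreal (log_kernel s t) \<partial>\<mu>) \<partial>\<mu>)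
   - enn2ereal (\<integral>\<^sup>+ s. (\<integral>\<^sup>+ t. e2ennreal (- log_kernel s t) \<partial>\<mu>) \<partial>\<mu>)"

definition robin_constant :: "real set \<Rightarrow> ereal" where
  "robin_constant E = (INF \<mu>\<in>prob_measures_on E. log_energy \<mu>)"

text \<open>Intended for compact sets, where the Robin constant is never \<open>-\<infinity>\<close>.\<close>

definition log_capacity :: "real set \<Rightarrow> real" where
  "log_capacity E =
     (if robin_constant E = \<infinity> then 0 else exp (- real_of_ereal (robin_constant E)))"

definition is_equilibrium_measure :: "real set \<Rightarrow> real measure \<Rightarrow> bool" where
  "is_equilibrium_measure E \<mu> \<longleftrightarrow>
     \<mu> \<in> prob_measures_on E \<and> (\<forall>\<nu>\<in>prob_measures_on E. log_energy \<mu> \<le> log_energy \<nu>)"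

text \<open>Twice continuously differentiable with vanishing Laplacian; \<open>p\<close> and \<open>q\<close> are the first-order
  partial derivatives of \<open>u\<close> and \<open>pxx\<close>, \<open>pxy\<close>, \<open>pyx\<close>, \<open>pyy\<close> those of second order.\<close>

definition harmonic_on :: "(complex \<Rightarrow> real) \<Rightarrow> complex set \<Rightarrow> bool" where
  "harmonic_on u S \<longleftrightarrow>
     open S \<and>
     (\<exists>p q pxx pxy pyx pyy.
        (\<forall>z\<in>S. (u has_derivative (\<lambda>h. p z * Re h + q z * Im h)) (at z)) \<and>
        (\<forall>z\<in>S. (p has_derivative (\<lambda>h. pxx z * Re h + pxy z * Im h)) (at z)) \<and>
        (\<forall>z\<in>S. (q has_derivative (\<lambda>h. pyx z * Re h + pyy z * Im h)) (at z)) \<and>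
        continuous_on S pxx \<and> continuous_on S pxy \<and>
        continuous_on S pyx \<and> continuous_on S pyy \<and>
        (\<forall>z\<in>S. pxx z + pyy z = 0))"

text \<open>Green's function of the complement of \<open>E\<close> in the Riemann sphere with pole at infinity. Only
  the values of \<open>g\<close> off \<open>E\<close> are constrained. For compact \<open>E\<close> of positive capacity these values are
  determined: by minimality of Green's function, the difference of \<open>g\<close> and Green's function is a
  nonnegative harmonic function that vanishes at infinity.\<close>

definition is_green_function :: "real set \<Rightarrow> (complex \<Rightarrow> real) \<Rightarrow> bool" where
  "is_green_function E g \<longleftrightarrow>
     harmonic_on g (- complex_of_real ` E) \<and>
     (\<forall>z. z \<notin> complex_of_real ` E \<longrightarrow> 0 < g z) \<and>
     ((\<lambda>z. g z - (ln (norm z) - ln (log_capacity E))) \<longlongrightarrow> 0) at_infinity"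

definition vanishes_at_boundary :: "real set \<Rightarrow> (complex \<Rightarrow> real) \<Rightarrow> bool" where
  "vanishes_at_boundary E g \<longleftrightarrow>
     (\<forall>t\<in>E. (g \<longlongrightarrow> 0) (at (complex_of_real t) within (- complex_of_real ` E)))"

definition gaps :: "real set \<Rightarrow> real set set" where
  "gaps E = components ({Inf E..Sup E} - E)"

text \<open>For regular \<open>E\<close> the maximum over a gap is attained at exactly one point, by strict concavity
  of Green's function on the gap.\<close>

definition critical_point :: "(complex \<Rightarrow> real) \<Rightarrow> real set \<Rightarrow> real" where
  "critical_point g G = arg_max_on (\<lambda>x. g (complex_of_real x)) G"

definition parreau_widom :: "real set \<Rightarrow> bool" where
  "parreau_widom E \<longleftrightarrow>
     compact E \<and> 0 < log_capacity E \<and>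
     (\<exists>g. is_green_function E g \<and> vanishes_at_boundary E g \<and>
          (\<lambda>G. g (complex_of_real (critical_point g G))) summable_on gaps E)"

end

theory Submission
  imports Defs "HOL-Complex_Analysis.Complex_Analysis"
begin

text \<open>Let \<open>p(z) = \<integral> ln |z - t| d\<mu>(t) + V\<close> with \<open>V\<close> the Robin constant. By Frostman's inequality \<open>p \<ge> 0\<close>,
  so the maximum principle gives \<open>g \<le> p\<close>, and both agree because their difference vanishes at
  infinity. Extended by \<open>0\<close> to \<open>E\<close>, the function \<open>p\<close> increases and then decreases on each gap, so on the
  line its variation between \<open>\<alpha>\<close> and \<open>\<beta>\<close> is at most twice the Parreau--Widom sum. The maximum
  principle in the upper half plane, applied to signed sums of horizontal increments of \<open>p\<close>, carries
  a variation bound to the lines \<open>Im z = d\<close>: the integral of \<open>|\<partial>\<^sub>x p|\<close> over \<open>[-R, R] + id\<close> is bounded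
  uniformly in \<open>d\<close>.

  The function \<open>G = \<partial>\<^sub>y p + i \<partial>\<^sub>x p = i \<integral> d\<mu>(t) / (z - t)\<close> is holomorphic with positive real part in
  the upper half plane. Cauchy's theorem bounds the integral of
  \<open>Re (G Ln G) = \<partial>\<^sub>y p ln |G| - \<partial>\<^sub>x p Arg G\<close> along the same segments, and \<open>|Arg G| < \<pi>/2\<close>; so
  \<open>\<partial>\<^sub>y p ln (\<partial>\<^sub>y p)\<close> has integrals bounded uniformly in \<open>d\<close>. Hence the Poisson smoothings
  \<open>\<partial>\<^sub>y p(x + id) dx / \<pi>\<close> of \<open>\<mu>\<close> are uniformly integrable, and \<open>\<mu>\<close> is absolutely continuous.\<close>

section \<open>Harmonic functions\<close>

text \<open>A bound on the mass of the smoothings \<open>- Im (cau (Complex x d))\<close> yields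
  only weak limits and cannot exclude a singular part. The gain to a bound on \<open>u ln u\<close>
  is a classical fact on conjugate functions: a positive harmonic function with integrable conjugate
  is locally of class L log L. Here the conjugate of the vertical derivative is the horizontal one,
  and its integrability is what the Parreau--Widom sum supplies; the two outer intervals, on which
  Green's function is unbounded, are controlled over windows of fixed length.

  The obstacle is that p has no derivative on E: regularity gives continuity up to the line and
  nothing more. Hence the passage into the half plane uses finite increments, whose logarithmic
  growth at infinity cancels, and derivatives appear only at positive height. The facts on harmonic
  functions all rest on the second-derivative test and on comparison with
  \<open>ln (norm (z - a))\<close>.\<close>

lemma harmonic_on_open: "harmonic_on u S \<Longrightarrow> open S"
  by (simp add: harmonic_on_def)

lemma harmonic_on_continuous:
  assumes "harmonic_on u S"
  shows "continuous_on S u"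
proof (rule continuous_at_imp_continuous_on, rule ballI)
  fix z assume "z \<in> S"
  then obtain D where "(u has_derivative D) (at z)"
    using assms unfolding harmonic_on_def by blast
  then show "isCont u z"
    by (rule has_derivative_continuous)
qed

lemma harmonic_on_subset:
  assumes "harmonic_on u S" "open T" "T \<subseteq> S"
  shows "harmonic_on u T"
proof -
  obtain p q pxx pxy pyx pyy where u:
    "\<forall>z\<in>S. (u has_derivative (\<lambda>h. p z * Re h + q z * Im h)) (at z)"
    "\<forall>z\<in>S. (p has_derivative (\<lambda>h. pxx z * Re h + pxy z * Im h)) (at z)"
    "\<forall>z\<in>S. (q has_derivative (\<lambda>h. pyx z * Re h + pyy z * Im h)) (at z)"
    "continuous_on S pxx" "continuous_on S pxy" "continuous_on S pyx" "continuous_on S pyy"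
    "\<forall>z\<in>S. pxx z + pyy z = 0"
    using assms(1) unfolding harmonic_on_def by blast
  show ?thesis
    unfolding harmonic_on_def
    using u assms(2,3)
    by (intro conjI, simp)
       (rule exI[of _ p], rule exI[of _ q], rule exI[of _ pxx], rule exI[of _ pxy],
        rule exI[of _ pyx], rule exI[of _ pyy], auto intro: continuous_on_subset)
qed

lemma harmonic_on_const: "open S \<Longrightarrow> harmonic_on (\<lambda>_. c) S"
  unfolding harmonic_on_def
  by (auto intro!: exI[of _ "\<lambda>_. 0::real"])

lemma harmonic_on_add:
  assumes "harmonic_on u S" "harmonic_on v S"
  shows "harmonic_on (\<lambda>z. u z + v z) S"
proof -
  obtain p q pxx pxy pyx pyy where u:
    "\<forall>z\<in>S. (u has_derivative (\<lambda>h. p z * Re h + q z * Im h)) (at z)"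
    "\<forall>z\<in>S. (p has_derivative (\<lambda>h. pxx z * Re h + pxy z * Im h)) (at z)"
    "\<forall>z\<in>S. (q has_derivative (\<lambda>h. pyx z * Re h + pyy z * Im h)) (at z)"
    "continuous_on S pxx" "continuous_on S pxy" "continuous_on S pyx" "continuous_on S pyy"
    "\<forall>z\<in>S. pxx z + pyy z = 0"
    using assms(1) unfolding harmonic_on_def by blast
  obtain p' q' pxx' pxy' pyx' pyy' where v:
    "\<forall>z\<in>S. (v has_derivative (\<lambda>h. p' z * Re h + q' z * Im h)) (at z)"
    "\<forall>z\<in>S. (p' has_derivative (\<lambda>h. pxx' z * Re h + pxy' z * Im h)) (at z)"
    "\<forall>z\<in>S. (q' has_derivative (\<lambda>h. pyx' z * Re h + pyy' z * Im h)) (at z)"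
    "continuous_on S pxx'" "continuous_on S pxy'" "continuous_on S pyx'" "continuous_on S pyy'"
    "\<forall>z\<in>S. pxx' z + pyy' z = 0"
    using assms(2) unfolding harmonic_on_def by blast
  have add: "((\<lambda>z. a z + b z) has_derivative (\<lambda>h. (c z + c' z) * Re h + (d z + d' z) * Im h)) (at z)"
    if "(a has_derivative (\<lambda>h. c z * Re h + d z * Im h)) (at z)"
      "(b has_derivative (\<lambda>h. c' z * Re h + d' z * Im h)) (at z)"
    for a b c d c' d' :: "complex \<Rightarrow> real" and z
    by (rule has_derivative_eq_rhs[OF has_derivative_add[OF that]]) (auto simp: algebra_simps)
  show ?thesis
    unfolding harmonic_on_def
  proof (intro conjI exI ballI)
    show "open S" using assms(1) by (rule harmonic_on_open)
    fix z assume "z \<in> S"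
    then show "((\<lambda>z. u z + v z) has_derivative (\<lambda>h. (p z + p' z) * Re h + (q z + q' z) * Im h)) (at z)"
      and "((\<lambda>z. p z + p' z) has_derivative (\<lambda>h. (pxx z + pxx' z) * Re h + (pxy z + pxy' z) * Im h)) (at z)"
      and "((\<lambda>z. q z + q' z) has_derivative (\<lambda>h. (pyx z + pyx' z) * Re h + (pyy z + pyy' z) * Im h)) (at z)"
      using u(1-3) v(1-3) by (auto intro!: add)
    show "(pxx z + pxx' z) + (pyy z + pyy' z) = 0"
      using \<open>z \<in> S\<close> u(8) v(8) by (metis add.assoc add.left_commute add_0)
  qed (use u v in \<open>auto intro: continuous_on_add\<close>)
qed

lemma harmonic_on_cmult:
  assumes "harmonic_on u S"
  shows "harmonic_on (\<lambda>z. c * u z) S"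
proof -
  obtain p q pxx pxy pyx pyy where u:
    "\<forall>z\<in>S. (u has_derivative (\<lambda>h. p z * Re h + q z * Im h)) (at z)"
    "\<forall>z\<in>S. (p has_derivative (\<lambda>h. pxx z * Re h + pxy z * Im h)) (at z)"
    "\<forall>z\<in>S. (q has_derivative (\<lambda>h. pyx z * Re h + pyy z * Im h)) (at z)"
    "continuous_on S pxx" "continuous_on S pxy" "continuous_on S pyx" "continuous_on S pyy"
    "\<forall>z\<in>S. pxx z + pyy z = 0"
    using assms(1) unfolding harmonic_on_def by blast
  have mult: "((\<lambda>z. c * a z) has_derivative (\<lambda>h. (c * b z) * Re h + (c * d z) * Im h)) (at z)"
    if "(a has_derivative (\<lambda>h. b z * Re h + d z * Im h)) (at z)"
    for a b d :: "complex \<Rightarrow> real" and z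
    by (rule has_derivative_eq_rhs[OF has_derivative_mult_right[OF that]]) (auto simp: algebra_simps)
  show ?thesis
    unfolding harmonic_on_def
  proof (intro conjI exI ballI)
    show "open S" using assms(1) by (rule harmonic_on_open)
    fix z assume "z \<in> S"
    then show "((\<lambda>z. c * u z) has_derivative (\<lambda>h. (c * p z) * Re h + (c * q z) * Im h)) (at z)"
      and "((\<lambda>z. c * p z) has_derivative (\<lambda>h. (c * pxx z) * Re h + (c * pxy z) * Im h)) (at z)"
      and "((\<lambda>z. c * q z) has_derivative (\<lambda>h. (c * pyx z) * Re h + (c * pyy z) * Im h)) (at z)"
      using u(1-3) by (auto intro!: mult)
    show "c * pxx z + c * pyy z = 0"
      using \<open>z \<in> S\<close> u(8) by (metis distrib_left mult_zero_right)
  qed (use u in \<open>auto intro: continuous_on_mult_left\<close>)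
qed

lemma harmonic_on_diff:
  assumes "harmonic_on u S" "harmonic_on v S"
  shows "harmonic_on (\<lambda>z. u z - v z) S"
  using harmonic_on_add[OF assms(1) harmonic_on_cmult[OF assms(2), of "-1"]] by simp

lemma harmonic_on_sum:
  assumes "open S" "finite I" "\<And>i. i \<in> I \<Longrightarrow> harmonic_on (u i) S"
  shows "harmonic_on (\<lambda>z. \<Sum>i\<in>I. u i z) S"
  using assms(2,3) by (induction I) (auto intro: harmonic_on_const harmonic_on_add assms(1))

lemma harmonic_on_translate:
  assumes "harmonic_on u S"
  shows "harmonic_on (\<lambda>z. u (z + a)) ((\<lambda>z. z + a) -` S)"
proof -
  let ?t = "\<lambda>z::complex. z + a"
  obtain p q pxx pxy pyx pyy where u:
    "\<forall>z\<in>S. (u has_derivative (\<lambda>h. p z * Re h + q z * Im h)) (at z)"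
    "\<forall>z\<in>S. (p has_derivative (\<lambda>h. pxx z * Re h + pxy z * Im h)) (at z)"
    "\<forall>z\<in>S. (q has_derivative (\<lambda>h. pyx z * Re h + pyy z * Im h)) (at z)"
    "continuous_on S pxx" "continuous_on S pxy" "continuous_on S pyx" "continuous_on S pyy"
    "\<forall>z\<in>S. pxx z + pyy z = 0"
    using assms(1) unfolding harmonic_on_def by blast
  have tr: "((\<lambda>z. b (z + a)) has_derivative D) (at z)"
    if "(b has_derivative D) (at (z + a))" for b :: "complex \<Rightarrow> real" and D z
  proof -
    have "(?t has_derivative (\<lambda>h. h)) (at z)" by (auto intro!: derivative_eq_intros)
    from has_derivative_compose[OF this that] show ?thesis by simp
  qed
  have op: "open (?t -` S)"
    by (intro open_vimage harmonic_on_open[OF assms] continuous_intros)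
  have cont: "continuous_on (?t -` S) (\<lambda>z. b (z + a))" if "continuous_on S b" for b :: "complex \<Rightarrow> real"
    by (rule continuous_on_compose2[OF that]) (auto intro!: continuous_intros)
  show ?thesis
    unfolding harmonic_on_def
  proof (intro conjI exI ballI)
    fix z assume "z \<in> ?t -` S"
    then show "((\<lambda>z. u (z + a)) has_derivative (\<lambda>h. p (z + a) * Re h + q (z + a) * Im h)) (at z)"
      and "((\<lambda>z. p (z + a)) has_derivative (\<lambda>h. pxx (z + a) * Re h + pxy (z + a) * Im h)) (at z)"
      and "((\<lambda>z. q (z + a)) has_derivative (\<lambda>h. pyx (z + a) * Re h + pyy (z + a) * Im h)) (at z)"
      using u(1-3) by (auto intro!: tr)
    show "pxx (z + a) + pyy (z + a) = 0"
      using \<open>z \<in> ?t -` S\<close> u(8) by auto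
  qed (use u op in \<open>auto intro: cont\<close>)
qed

text \<open>Here \<open>f\<close> is the complex gradient \<open>u_x - \<i> u_y\<close>. Its
  Cauchy--Riemann equations make the second partials \<open>Re (?f' z)\<close>,
  \<open>- Im (?f' z)\<close> (twice) and \<open>- Re (?f' z)\<close>, so the Laplacian cancels.
  This suits a logarithmic potential, whose complex gradient is a Cauchy transform.\<close>

lemma harmonic_on_holomorphic_gradient:
  assumes S: "open S" and f: "f holomorphic_on S"
    and u: "\<And>z. z \<in> S \<Longrightarrow> (u has_derivative (\<lambda>h. Re (f z * h))) (at z)"
  shows "harmonic_on u S"
proof -
  let ?f' = "deriv f"
  have f': "(f has_derivative (\<lambda>h. ?f' z * h)) (at z)" if "z \<in> S" for z
    using holomorphic_derivI[OF f S that] by (simp add: has_field_derivative_def)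
  have cont: "continuous_on S ?f'"
    using holomorphic_deriv[OF f S] by (rule holomorphic_on_imp_continuous_on)
  have re: "((\<lambda>z. Re (f z)) has_derivative (\<lambda>h. Re (?f' z) * Re h + - Im (?f' z) * Im h)) (at z)"
    if "z \<in> S" for z
    using has_derivative_Re[OF f'[OF that]] by simp
  have im: "((\<lambda>z. - Im (f z)) has_derivative (\<lambda>h. - Im (?f' z) * Re h + - Re (?f' z) * Im h)) (at z)"
    if "z \<in> S" for z
    by (rule has_derivative_eq_rhs[OF has_derivative_minus[OF has_derivative_Im[OF f'[OF that]]]])
       (auto simp: algebra_simps)
  show ?thesis
    unfolding harmonic_on_def
  proof (intro conjI exI ballI)
    fix z assume z: "z \<in> S"
    show "(u has_derivative (\<lambda>h. Re (f z) * Re h + - Im (f z) * Im h)) (at z)"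
      using u[OF z] by simp
    show "((\<lambda>z. Re (f z)) has_derivative (\<lambda>h. Re (?f' z) * Re h + - Im (?f' z) * Im h)) (at z)"
      using re z by blast
    show "((\<lambda>z. - Im (f z)) has_derivative (\<lambda>h. - Im (?f' z) * Re h + - Re (?f' z) * Im h)) (at z)"
      using im z by blast
  qed (use S cont in \<open>auto intro!: continuous_intros\<close>)
qed

lemma has_derivative_ln_norm:
  fixes z :: complex
  assumes "z \<noteq> 0"
  shows "((\<lambda>w. ln (norm w)) has_derivative (\<lambda>h. Re (inverse z * h))) (at z)"
proof -
  have eq: "Re (inverse z * h) = (z \<bullet> h) / (norm z)\<^sup>2" for h
    by (simp add: inner_complex_def cmod_power2 add_divide_distrib)
  have "((\<lambda>w. ln (norm w)) has_derivative (\<lambda>h. (sgn z \<bullet> h) * inverse (norm z))) (at z)"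
  proof -
    have "(ln has_derivative (\<lambda>h. h * inverse (norm z))) (at (norm z))"
      using DERIV_ln[of "norm z"] assms unfolding has_field_derivative_def
      by (rule_tac has_derivative_eq_rhs) (auto simp: fun_eq_iff)
    from has_derivative_compose[OF has_derivative_norm[OF assms] this] show ?thesis
      by (simp add: inner_commute)
  qed
  then show ?thesis
    by (rule has_derivative_eq_rhs)
       (intro ext, subst eq, simp add: sgn_div_norm divide_inverse power2_eq_square mult_ac)
qed

lemma harmonic_on_ln_norm: "harmonic_on (\<lambda>z. ln (norm (z - a))) (- {a})"
proof (rule harmonic_on_holomorphic_gradient[where f = "\<lambda>z. inverse (z - a)"])
  fix z assume z: "z \<in> - {a}"
  have "((\<lambda>z. z - a) has_derivative (\<lambda>h. h)) (at z)"
    by (auto intro!: derivative_eq_intros)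
  from has_derivative_compose[OF this has_derivative_ln_norm[of "z - a"]] z
  show "((\<lambda>z. ln (norm (z - a))) has_derivative (\<lambda>h. Re (inverse (z - a) * h))) (at z)"
    by simp
qed (auto intro!: holomorphic_intros)

section \<open>Maximum principles and positivity of harmonic functions\<close>

lemma second_derivative_nonpos_at_max:
  fixes f f' :: "real \<Rightarrow> real"
  assumes e: "0 < e"
    and f: "\<And>x. \<bar>x\<bar> < e \<Longrightarrow> (f has_real_derivative f' x) (at x)"
    and f': "(f' has_real_derivative l) (at 0)"
    and max: "\<And>x. \<bar>x\<bar> < e \<Longrightarrow> f x \<le> f 0"
  shows "l \<le> 0"
proof (rule ccontr)
  assume "\<not> l \<le> 0"
  then have "0 < l" by simp
  have "f' 0 = 0"
    using DERIV_local_max[OF f[of 0] e] e max by simp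
  with DERIV_pos_inc_right[OF f' \<open>0 < l\<close>] obtain d where d: "d > 0" "\<And>h. 0 < h \<Longrightarrow> h < d \<Longrightarrow> 0 < f' h"
    by auto
  define x where "x = min d e / 2"
  have x: "0 < x" "x < d" "x < e" using d e by (auto simp: x_def min_def)
  have "f 0 < f x"
  proof (rule DERIV_pos_imp_increasing_open[OF x(1)])
    fix y assume "0 < y" "y < x"
    with d(2)[of y] f[of y] x show "\<exists>z. (f has_real_derivative z) (at y) \<and> 0 < z" by auto
  next
    show "continuous_on {0..x} f"
      using x by (intro continuous_at_imp_continuous_on ballI DERIV_isCont[OF f]) auto
  qed
  with max[of x] x show False by simp
qed

text \<open>A nonconstant harmonic function may have a degenerate Hessian at a maximum; adding
  \<open>\<eta> |z|\<^sup>2\<close> makes the Laplacian strictly positive.\<close>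

lemma harmonic_on_local_max:
  assumes "harmonic_on u S" "z \<in> S" "0 < \<eta>" "0 < e"
    and max: "\<And>w. dist z w < e \<Longrightarrow> u w + \<eta> * (norm w)\<^sup>2 \<le> u z + \<eta> * (norm z)\<^sup>2"
  shows False
proof -
  obtain p q pxx pxy pyx pyy where u:
    "\<forall>z\<in>S. (u has_derivative (\<lambda>h. p z * Re h + q z * Im h)) (at z)"
    "\<forall>z\<in>S. (p has_derivative (\<lambda>h. pxx z * Re h + pxy z * Im h)) (at z)"
    "\<forall>z\<in>S. (q has_derivative (\<lambda>h. pyx z * Re h + pyy z * Im h)) (at z)"
    "\<forall>z\<in>S. pxx z + pyy z = 0"
    using assms(1) unfolding harmonic_on_def by blast
  have "open S" using assms(1) by (rule harmonic_on_open)
  then obtain d where d: "d > 0" "ball z d \<subseteq> S" using \<open>z \<in> S\<close> open_contains_ball by blast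
  define r where "r = min d e"
  have r: "r > 0" "r \<le> d" "r \<le> e" using d assms(4) by (auto simp: r_def)
  have line: "((\<lambda>s::real. b (z + of_real s * c)) has_real_derivative b1 * Re c + b2 * Im c) (at s)"
    if "(b has_derivative (\<lambda>h. b1 * Re h + b2 * Im h)) (at (z + of_real s * c))"
    for b :: "complex \<Rightarrow> real" and b1 b2 c s
  proof -
    have "((\<lambda>s::real. z + of_real s * c) has_derivative (\<lambda>h. of_real h * c)) (at s)"
      by (auto intro!: derivative_eq_intros)
    from has_derivative_compose[OF this that] show ?thesis
      unfolding has_field_derivative_def
      by (rule has_derivative_eq_rhs) (simp add: fun_eq_iff algebra_simps)
  qed
  have inS: "z + of_real s * c \<in> S" if "\<bar>s\<bar> < r" "norm c = 1" for s c
    using that d r by (auto simp: dist_norm norm_mult intro!: subsetD[OF d(2)])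
  have sq: "(norm (z + of_real s * c))\<^sup>2 = (norm z)\<^sup>2 + 2 * s * (Re z * Re c + Im z * Im c) + s\<^sup>2"
    if "norm c = 1" for s c
  proof -
    have "(Re c)\<^sup>2 + (Im c)\<^sup>2 = 1" using that by (simp add: cmod_power2[symmetric])
    then have "s\<^sup>2 * (Re c)\<^sup>2 + s\<^sup>2 * (Im c)\<^sup>2 = s\<^sup>2" by (metis distrib_left mult.right_neutral)
    then show ?thesis by (simp add: cmod_power2 power2_sum power_mult_distrib algebra_simps)
  qed
  \<comment> \<open>The second-derivative test along the unit direction \<open>c\<close>, where
    \<open>b\<close> is the derivative of \<open>u\<close> in that direction. The directions 1 and
    \<i> bound \<open>pxx z\<close> and \<open>pyy z\<close> by \<open>- 2 * \<eta>\<close> each,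
    although their sum is 0.\<close>
  have main: "(b1 * Re c + b2 * Im c) + 2 * \<eta> \<le> 0"
    if c: "norm c = 1"
      and b: "\<And>w. b w = p w * Re c + q w * Im c"
      and b': "(b has_derivative (\<lambda>h. b1 * Re h + b2 * Im h)) (at z)"
    for b b1 b2 and c
  proof (rule second_derivative_nonpos_at_max[OF r(1),
        where f = "\<lambda>s. u (z + of_real s * c) + \<eta> * ((norm z)\<^sup>2 + 2 * s * (Re z * Re c + Im z * Im c) + s\<^sup>2)"
          and f' = "\<lambda>s. b (z + of_real s * c) + \<eta> * (2 * (Re z * Re c + Im z * Im c) + 2 * s)"])
    fix s :: real assume s: "\<bar>s\<bar> < r"
    note l = line[OF u(1)[rule_format, OF inS[OF s c]]]
    show "((\<lambda>s. u (z + of_real s * c) + \<eta> * ((norm z)\<^sup>2 + 2 * s * (Re z * Re c + Im z * Im c) + s\<^sup>2)) has_real_derivative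
            b (z + of_real s * c) + \<eta> * (2 * (Re z * Re c + Im z * Im c) + 2 * s)) (at s)"
      unfolding b by (rule derivative_eq_intros l refl | simp)+
    show "u (z + of_real s * c) + \<eta> * ((norm z)\<^sup>2 + 2 * s * (Re z * Re c + Im z * Im c) + s\<^sup>2)
       \<le> u (z + of_real 0 * c) + \<eta> * ((norm z)\<^sup>2 + 2 * 0 * (Re z * Re c + Im z * Im c) + 0\<^sup>2)"
      using max[of "z + of_real s * c"] s r c by (simp add: dist_norm norm_mult sq)
  next
    have l: "((\<lambda>s. b (z + of_real s * c)) has_real_derivative b1 * Re c + b2 * Im c) (at 0)"
      using b' by (intro line) simp
    show "((\<lambda>s. b (z + of_real s * c) + \<eta> * (2 * (Re z * Re c + Im z * Im c) + 2 * s)) has_real_derivative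
        (b1 * Re c + b2 * Im c) + 2 * \<eta>) (at 0)"
      by (rule derivative_eq_intros l refl | simp)+
  qed
  have "pxx z + 2 * \<eta> \<le> 0"
    using main[of 1 p "pxx z" "pxy z"] u(2) \<open>z \<in> S\<close> by simp
  moreover have "pyy z + 2 * \<eta> \<le> 0"
    using main[of \<i> q "pyx z" "pyy z"] u(3) \<open>z \<in> S\<close> by simp
  ultimately show False using u(4) \<open>z \<in> S\<close> \<open>0 < \<eta>\<close> by fastforce
qed

text \<open>Compactness of the superlevel sets says at once that \<open>u\<close> has no positive
  limit values at the boundary of \<open>S\<close> or at infinity. Thus \<open>S\<close> may be
  unbounded, and no boundary values have to be assigned.\<close>

lemma harmonic_on_max_principle:
  assumes u: "harmonic_on u S"
    and cpt: "\<And>e. 0 < e \<Longrightarrow> compact {z \<in> S. e \<le> u z}"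
    and z: "z \<in> S"
  shows "u z \<le> 0"
proof (rule ccontr)
  assume "\<not> u z \<le> 0"
  define m where "m = u z / 2"
  define K where "K = {z \<in> S. m \<le> u z}"
  have m: "0 < m" "u z = 2 * m" using \<open>\<not> u z \<le> 0\<close> by (auto simp: m_def)
  have K: "compact K" using cpt m(1) by (simp add: K_def)
  have zK: "z \<in> K" using z m by (auto simp: K_def)
  obtain B where B: "\<And>w. w \<in> K \<Longrightarrow> norm w \<le> B" "0 < B"
    using compact_imp_bounded[OF K] bounded_pos by blast
  \<comment> \<open>On \<open>K\<close> the added term is at most \<open>m / 2\<close>, while
    \<open>u z = 2 * m\<close>. So the maximiser \<open>w\<close> satisfies \<open>u w > m\<close>
    and has a neighbourhood inside \<open>K\<close>.\<close>
  define \<eta> where "\<eta> = m / (2 * B\<^sup>2)"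
  have \<eta>: "0 < \<eta>" "\<eta> * B\<^sup>2 = m / 2" using m B by (auto simp: \<eta>_def)
  have cont: "continuous_on S u" using u by (rule harmonic_on_continuous)
  have "continuous_on K (\<lambda>w. u w + \<eta> * (norm w)\<^sup>2)"
    by (intro continuous_intros continuous_on_subset[OF cont]) (auto simp: K_def)
  from continuous_attains_sup[OF K _ this] zK
  obtain w where w: "w \<in> K" "\<And>v. v \<in> K \<Longrightarrow> u v + \<eta> * (norm v)\<^sup>2 \<le> u w + \<eta> * (norm w)\<^sup>2"
    by blast
  have "\<eta> * (norm w)\<^sup>2 \<le> m / 2"
    unfolding \<eta>(2)[symmetric] using B(1)[OF w(1)] \<eta>(1) by (intro mult_left_mono power_mono) auto
  moreover have "0 \<le> \<eta> * (norm z)\<^sup>2" using \<eta> by simp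
  ultimately have "m < u w" using w(2)[OF zK] m by linarith
  have wS: "w \<in> S" using w by (simp add: K_def)
  have "open {v \<in> S. m < u v}"
    using continuous_open_preimage[OF cont harmonic_on_open[OF u] open_greaterThan[of m]]
    by (simp add: vimage_def Int_def)
  then obtain e where e: "0 < e" "ball w e \<subseteq> {v \<in> S. m < u v}"
    using \<open>m < u w\<close> wS unfolding open_contains_ball by blast
  show False
  proof (rule harmonic_on_local_max[OF u wS \<eta>(1) e(1)])
    fix v assume "dist w v < e"
    then have "v \<in> K" using e(2) by (auto simp: K_def)
    then show "u v + \<eta> * (norm v)\<^sup>2 \<le> u w + \<eta> * (norm w)\<^sup>2" by (rule w(2))
  qed
qed

lemma harmonic_on_max_principle_compact:
  assumes u: "harmonic_on u S" and T: "compact T" "S \<subseteq> T" "continuous_on T u"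
    and bd: "\<And>z. z \<in> T - S \<Longrightarrow> u z \<le> 0"
    and z: "z \<in> S"
  shows "u z \<le> 0"
proof (rule harmonic_on_max_principle[OF u _ z])
  fix e :: real assume "0 < e"
  then have "{z \<in> S. e \<le> u z} = T \<inter> u -` {e..}"
    using T(2) bd by (auto simp: subset_eq) (metis DiffI leD order.strict_trans2)
  moreover have "closed (T \<inter> u -` {e..})"
    using T compact_imp_closed by (intro continuous_closed_preimage) auto
  ultimately show "compact {z \<in> S. e \<le> u z}"
    using compact_Int_closed[OF T(1), of "T \<inter> u -` {e..}"] by simp
qed

text \<open>Comparison with the radial harmonic function that equals \<open>m\<close> on the inner
  circle and 0 on the outer one. It plays the part of Harnack's inequality.\<close>

lemma harmonic_on_annulus_bound:
  assumes u: "harmonic_on u S" and S: "cball a R - ball a r \<subseteq> S" and r: "0 < r" "r < R"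
    and nonneg: "\<And>z. z \<in> S \<Longrightarrow> 0 \<le> u z"
    and inner: "\<And>z. dist a z = r \<Longrightarrow> m \<le> u z"
    and w: "r \<le> dist a w" "dist a w < R"
  shows "m * (ln R - ln (dist a w)) / (ln R - ln r) \<le> u w"
proof (cases "dist a w = r")
  case True
  then show ?thesis using r inner[of w] by simp
next
  case False
  have lnr: "ln r < ln R" using r by simp
  define v where "v = (\<lambda>z. m / (ln R - ln r) * (ln R - ln (norm (z - a))) - u z)"
  have "v w \<le> 0"
  proof (rule harmonic_on_max_principle_compact[where T = "cball a R - ball a r" and S = "ball a R - cball a r"])
    have ho: "harmonic_on v (S - {a})" 
      unfolding v_def using harmonic_on_open[OF u]
      by (intro harmonic_on_diff harmonic_on_cmult harmonic_on_const harmonic_on_subset[OF u]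
            harmonic_on_subset[OF harmonic_on_ln_norm]) auto
    have sub: "cball a R - ball a r \<subseteq> S - {a}" using S r by auto
    show "harmonic_on v (ball a R - cball a r)"
      using sub by (intro harmonic_on_subset[OF ho] open_Diff) (auto simp: subset_eq)
    show "continuous_on (cball a R - ball a r) v"
      using harmonic_on_continuous[OF ho] sub by (rule continuous_on_subset)
    show "compact (cball a R - ball a r)" by (intro compact_diff) auto
    show "ball a R - cball a r \<subseteq> cball a R - ball a r" by auto
    show "w \<in> ball a R - cball a r" using w False by auto
    fix z assume z: "z \<in> (cball a R - ball a r) - (ball a R - cball a r)"
    then have "u z \<ge> 0" using S nonneg by auto
    from z consider "dist a z = R" | "dist a z = r" by force
    then show "v z \<le> 0"
    proof cases
      case 1
      then show ?thesis using \<open>u z \<ge> 0\<close> by (simp add: v_def dist_norm norm_minus_commute)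
    next
      case 2
      then show ?thesis using inner[OF 2] lnr by (simp add: v_def dist_norm norm_minus_commute)
    qed
  qed
  then show ?thesis by (simp add: v_def dist_norm norm_minus_commute)
qed

text \<open>The strong minimum principle on a disc: continuity keeps \<open>u\<close> above
  \<open>u a / 2\<close> on a small circle about \<open>a\<close>, and the logarithmic lower bound
  carries positivity outwards.\<close>

lemma harmonic_on_pos_ball:
  assumes u: "harmonic_on u S" and S: "ball a R \<subseteq> S"
    and nonneg: "\<And>z. z \<in> S \<Longrightarrow> 0 \<le> u z"
    and a: "0 < u a" and w: "w \<in> ball a R"
  shows "0 < u w"
proof -
  \<comment> \<open>Only the open ball of radius \<open>R\<close> is known to lie in
    \<open>S\<close>; the closed ball of radius \<open>R'\<close> does too and still has
    \<open>w\<close> in its interior.\<close>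
  define R' where "R' = (dist a w + R) / 2"
  have R': "dist a w < R'" "R' < R" using w by (auto simp: R'_def)
  have "0 < R'" using R'(1) zero_le_dist[of a w] by linarith
  have "0 < R" using w zero_le_dist[of a w] by (simp del: zero_le_dist)
  then have "a \<in> S" using S by auto
  have "open {v \<in> S. u a / 2 < u v}"
    using continuous_open_preimage[OF harmonic_on_continuous[OF u] harmonic_on_open[OF u] open_greaterThan[of "u a / 2"]]
    by (simp add: vimage_def Int_def)
  moreover have "a \<in> {v \<in> S. u a / 2 < u v}" using a \<open>a \<in> S\<close> by simp
  ultimately obtain e where e: "0 < e" "ball a e \<subseteq> {v \<in> S. u a / 2 < u v}"
    unfolding open_contains_ball by blast
  define r where "r = min e R' / 2"
  have r: "0 < r" "r < e" "r < R'" using e \<open>0 < R'\<close> by (auto simp: r_def min_def)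
  show ?thesis
  proof (cases "dist a w \<le> r")
    case True
    then have "w \<in> ball a e" using r by simp
    then show ?thesis using e(2) a by fastforce
  next
    case False
    have "u a / 2 * (ln R' - ln (dist a w)) / (ln R' - ln r) \<le> u w"
    proof (rule harmonic_on_annulus_bound[OF u _ r(1,3) nonneg])
      show "cball a R' - ball a r \<subseteq> S" using S R' by force
      show "u a / 2 \<le> u z" if "dist a z = r" for z
        using e(2) that r by (force simp: subset_eq)
    qed (use False R' in auto)
    moreover have "0 < u a / 2 * (ln R' - ln (dist a w)) / (ln R' - ln r)"
    proof -
      have "0 < dist a w" using False r by linarith
      then have "ln (dist a w) < ln R'" "ln r < ln R'" using R' r by auto
      then show ?thesis using a by simp
    qed
    ultimately show ?thesis by simp
  qed
qed

text \<open>The minimum principle with the minimum at infinity. If \<open>u\<close> had no zero, the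
  logarithmic lower bound would keep it from tending to 0. Hence the zero set is nonempty; it and
  the set where \<open>u\<close> is positive are both open, and connectedness decides.\<close>

lemma harmonic_on_vanishing_at_infinity:
  assumes K: "compact K" "connected (- K)" and u: "harmonic_on u (- K)"
    and nonneg: "\<And>z. z \<notin> K \<Longrightarrow> 0 \<le> u z"
    and lim: "(u \<longlongrightarrow> 0) at_infinity" and z: "z \<notin> K"
  shows "u z = 0"
proof -
  obtain R where R: "0 < R" "\<And>z. z \<in> K \<Longrightarrow> norm z < R"
  proof -
    obtain b where "0 < b" "\<forall>z\<in>K. norm z \<le> b"
      using compact_imp_bounded[OF K(1)] unfolding bounded_pos by blast
    then show ?thesis by (intro that[of "b + 1"]) auto
  qed
  have cont: "continuous_on (- K) u" using u by (rule harmonic_on_continuous)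
  have opos: "open {z \<in> - K. 0 < u z}"
    using continuous_open_preimage[OF cont harmonic_on_open[OF u] open_greaterThan[of 0]]
    by (simp add: vimage_def Int_def)
  have ozero: "open {z \<in> - K. u z = 0}"
    unfolding open_contains_ball
  proof
    fix z assume z: "z \<in> {z \<in> - K. u z = 0}"
    then obtain d where d: "0 < d" "ball z d \<subseteq> - K"
      using harmonic_on_open[OF u] unfolding open_contains_ball by blast
    \<comment> \<open>The disc of radius \<open>d / 2\<close> about \<open>w\<close> contains
      \<open>z\<close> and stays off \<open>K\<close>, so positivity at \<open>w\<close> would
      spread back to \<open>z\<close>.\<close>
    have "u w = 0" if w: "w \<in> ball z (d / 2)" for w
    proof (rule ccontr)
      assume "u w \<noteq> 0"
      have sub: "ball w (d / 2) \<subseteq> ball z d"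
        by (rule ball_subset_ball_iff[THEN iffD2]) (use w d in \<open>auto simp: dist_commute\<close>)
      have "w \<in> ball z d" using w d(1) by simp
      then have "w \<in> - K" using d(2) by blast
      then have "0 < u w" using nonneg \<open>u w \<noteq> 0\<close> by (simp add: order.strict_iff_order)
      then have "0 < u z"
        using harmonic_on_pos_ball[OF u _ _ _, of w "d / 2" z] sub d nonneg w by (auto simp: dist_commute)
      then show False using z by simp
    qed
    then show "\<exists>e>0. ball z e \<subseteq> {z \<in> - K. u z = 0}"
      using d(1) order.trans[OF subset_ball[of "d / 2" d z] d(2)] by (intro exI[of _ "d / 2"]) auto
  qed
  have "\<exists>w. w \<notin> K \<and> u w = 0"
  proof (rule ccontr)
    assume "\<not> ?thesis"
    then have pos: "0 < u w" if "w \<notin> K" for w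
      using nonneg[OF that] that by force
    have out: "sphere 0 R \<subseteq> - K" using R(2) by force
    have "compact (sphere (0::complex) R)" "sphere (0::complex) R \<noteq> {}" using R by auto
    from continuous_attains_inf[OF this continuous_on_subset[OF cont out]]
    obtain w0 where w0: "norm w0 = R" "\<And>w. norm w = R \<Longrightarrow> u w0 \<le> u w" by auto
    define m where "m = u w0"
    have m: "0 < m" using pos[of w0] out w0(1) by (auto simp: m_def)
    have "eventually (\<lambda>z. u z < m / 2) at_infinity"
      using order_tendstoD(2)[OF lim, of "m / 2"] m by simp
    then obtain B where B: "\<And>z. B \<le> norm z \<Longrightarrow> u z < m / 2"
      unfolding eventually_at_infinity by blast
    \<comment> \<open>With outer radius \<open>q\<^sup>2 / R\<close> the number
      \<open>q = norm w\<close> is the geometric mean of the two radii, so the logarithmic lower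
      bound at \<open>w\<close> is exactly \<open>m / 2\<close>, against
      \<open>u w < m / 2\<close>.\<close>
    define w where "w = complex_of_real (max B (2 * R))"
    define q where "q = norm w"
    have q: "R < q" "0 < q" "u w < m / 2"
      using R B[of w] by (auto simp: w_def q_def)
    have "R < q\<^sup>2 / R" using q R by (simp add: field_simps power2_eq_square mult_strict_mono)
    have q2: "q < q\<^sup>2 / R" using q R by (simp add: field_simps power2_eq_square)
    have "m * (ln (q\<^sup>2 / R) - ln (dist 0 w)) / (ln (q\<^sup>2 / R) - ln R) \<le> u w"
    proof (rule harmonic_on_annulus_bound[OF u _ R(1) \<open>R < q\<^sup>2 / R\<close>])
      show "cball 0 (q\<^sup>2 / R) - ball 0 R \<subseteq> - K" using R(2) by force
      show "m \<le> u z" if "dist 0 z = R" for z using w0(2)[of z] that by (simp add: m_def)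
    qed (use nonneg q q2 in \<open>auto simp: q_def\<close>)
    also have "m * (ln (q\<^sup>2 / R) - ln (dist 0 w)) / (ln (q\<^sup>2 / R) - ln R) = m / 2"
    proof -
      have *: "m * x / (2 * x) = m / 2" if "x \<noteq> 0" for x :: real using that by simp
      have "ln (q\<^sup>2 / R) = 2 * ln q - ln R" using q R by (simp add: ln_div ln_realpow)
      then have e: "ln (q\<^sup>2 / R) - ln (dist 0 w) = ln q - ln R" "ln (q\<^sup>2 / R) - ln R = 2 * (ln q - ln R)"
        by (simp_all add: q_def)
      have "ln q - ln R \<noteq> 0" using q R by simp
      then show ?thesis unfolding e by (rule *)
    qed
    finally show False using q by simp
  qed
  then obtain w where w: "w \<in> {z \<in> - K. u z = 0}" by auto
  have cover: "- K \<subseteq> {z \<in> - K. 0 < u z} \<union> {z \<in> - K. u z = 0}"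
  proof
    fix x assume "x \<in> - K"
    then show "x \<in> {z \<in> - K. 0 < u z} \<union> {z \<in> - K. u z = 0}"
      using nonneg[of x] by (cases "u x = 0") auto
  qed
  have disj: "{z \<in> - K. 0 < u z} \<inter> {z \<in> - K. u z = 0} \<inter> - K = {}" by auto
  have "{z \<in> - K. u z = 0} \<inter> - K \<noteq> {}" using w by (intro ex_in_conv[THEN iffD1] exI[of _ w]) simp
  then have "{z \<in> - K. 0 < u z} \<inter> - K = {}"
    using connectedD[OF K(2) opos ozero disj cover] by simp
  then have "z \<notin> {z \<in> - K. 0 < u z}" using z by auto
  then have "\<not> 0 < u z" using z by simp
  then show ?thesis using nonneg[OF z] by linarith
qed

text \<open>Each open half plane together with the real points off \<open>E\<close> lies between the
  half plane and its closure, hence is connected; the two sets share a real point beyond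
  \<open>E\<close>.\<close>

lemma connected_Compl_of_real:
  assumes "compact E"
  shows "connected (- complex_of_real ` E)"
proof -
  obtain B where "\<And>x. x \<in> E \<Longrightarrow> norm x \<le> B"
    using compact_imp_bounded[OF assms] unfolding bounded_iff by blast
  then have x: "B + 1 \<notin> E" by force
  define X where "X = complex_of_real ` (- E)"
  define H where "H = {z. 0 < Im z}"
  define L where "L = {z. Im z < 0}"
  have cl: "closure H = {z. 0 \<le> Im z}" "closure L = {z. Im z \<le> 0}"
    using closure_halfspace_gt[of \<i> 0] closure_halfspace_lt[of \<i> 0]
    by (simp_all add: H_def L_def inner_complex_def)
  have "connected H" "connected L"
    unfolding H_def L_def by (simp_all add: convex_connected convex_halfspace_Im_gt convex_halfspace_Im_lt)
  moreover have "X \<subseteq> closure H" "X \<subseteq> closure L" unfolding cl by (auto simp: X_def)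
  ultimately have "connected (H \<union> X)" and "connected (L \<union> X)"
    by (auto intro!: connected_intermediate_closure[OF _ Un_upper1 Un_least[OF closure_subset]] simp del: Un_upper1)
  moreover have "(H \<union> X) \<inter> (L \<union> X) \<noteq> {}" using x by (auto simp: X_def)
  ultimately have "connected ((H \<union> X) \<union> (L \<union> X))" by (rule connected_Un)
  moreover have "(H \<union> X) \<union> (L \<union> X) = - complex_of_real ` E"
  proof (intro equalityI subsetI)
    fix z assume "z \<in> - complex_of_real ` E"
    moreover have "z = complex_of_real (Re z)" if "Im z = 0" using that by (simp add: complex_eq_iff)
    ultimately show "z \<in> (H \<union> X) \<union> (L \<union> X)"
      by (cases "Im z = 0") (auto simp: H_def L_def X_def)
  qed (auto simp: H_def L_def X_def)
  ultimately show ?thesis by simp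
qed

section \<open>The logarithmic potential and the Cauchy transform\<close>

text \<open>A quadratic remainder bound that is uniform over \<open>E\<close> survives integration
  against \<open>\<mu>\<close>. This is how \<open>pot\<close> and \<open>cau\<close> are
  differentiated under the integral sign.\<close>

lemma has_derivative_quadratic_remainder:
  fixes f :: "'a::real_normed_vector \<Rightarrow> 'b::real_normed_vector"
  assumes D: "bounded_linear D" and d: "0 < d"
    and rem: "\<And>h. norm h < d \<Longrightarrow> norm (f (z + h) - f z - D h) \<le> C * (norm h)\<^sup>2"
  shows "(f has_derivative D) (at z)"
  unfolding has_derivative_at
proof
  have lim: "((\<lambda>h::'a. \<bar>C\<bar> * norm h) \<longlongrightarrow> 0) (at 0)"
    by (auto intro!: tendsto_eq_intros)
  show "(\<lambda>h. norm (f (z + h) - f z - D h) / norm h) \<midarrow>0\<rightarrow> 0"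
  proof (rule tendsto_sandwich[OF _ _ tendsto_const lim])
    show "eventually (\<lambda>h::'a. norm (f (z + h) - f z - D h) / norm h \<le> \<bar>C\<bar> * norm h) (at 0)"
      unfolding eventually_at
    proof (intro exI[of _ d] conjI ballI impI d)
      fix h :: 'a assume h: "h \<noteq> 0 \<and> dist h 0 < d"
      then have "norm (f (z + h) - f z - D h) \<le> C * (norm h)\<^sup>2" by (intro rem) simp
      also have "\<dots> \<le> \<bar>C\<bar> * (norm h)\<^sup>2" by (intro mult_right_mono) auto
      finally show "norm (f (z + h) - f z - D h) / norm h \<le> \<bar>C\<bar> * norm h"
        using h by (simp add: field_simps power2_eq_square)
    qed
  qed auto
qed (rule D)

text \<open>The difference of logarithms is \<open>Re (Ln (1 + h / a))\<close>, so the linear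
  approximation of \<open>Ln\<close> at 1 applies once \<open>norm (h / a)\<close> is at most
  1/2.\<close>

lemma ln_norm_quadratic_remainder:
  fixes a h :: complex
  assumes d: "0 < d" "d \<le> norm a" "norm h \<le> d / 2"
  shows "\<bar>ln (norm (a + h)) - ln (norm a) - Re (inverse a * h)\<bar> \<le> 2 / d\<^sup>2 * (norm h)\<^sup>2"
proof -
  define w where "w = h / a"
  have a: "a \<noteq> 0" using d by auto
  have nw: "norm w \<le> norm h / d"
    unfolding w_def norm_divide using d a by (intro divide_left_mono) auto
  moreover have "norm h / d \<le> 1 / 2" using d by (simp add: field_simps)
  ultimately have w: "norm w \<le> 1 / 2" by (rule order.trans)
  then have w1: "1 + w \<noteq> 0" using norm_diff_ineq[of 1 w] by auto
  have "a + h = a * (1 + w)" using a by (simp add: w_def field_simps)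
  then have "ln (norm (a + h)) - ln (norm a) - Re (inverse a * h) = Re (Ln (1 + w) - w)"
    using a w1 by (simp add: norm_mult ln_mult w_def divide_inverse mult.commute)
  also have "\<bar>\<dots>\<bar> \<le> norm (Ln (1 + w) - w)" by (rule abs_Re_le_cmod)
  also have "\<dots> \<le> (norm w)\<^sup>2 / (1 - norm w)" using w by (intro Ln_approx_linear) simp
  also have "\<dots> \<le> (norm w)\<^sup>2 / (1 / 2)" using w by (intro divide_left_mono) auto
  also have "\<dots> \<le> 2 * (norm h / d)\<^sup>2" using nw by (simp add: power_mono)
  finally show ?thesis by (simp add: power_divide)
qed

lemma inverse_quadratic_remainder:
  fixes a h :: complex
  assumes d: "0 < d" "d \<le> norm a" "norm h \<le> d / 2"
  shows "norm (inverse (a + h) - inverse a - - (inverse a)\<^sup>2 * h) \<le> 2 / d ^ 3 * (norm h)\<^sup>2"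
proof -
  have a: "a \<noteq> 0" using d by auto
  have ah: "d / 2 \<le> norm (a + h)" using d norm_diff_ineq[of a h] by simp
  then have ah0: "a + h \<noteq> 0" using d by auto
  have "inverse (a + h) - inverse a - - (inverse a)\<^sup>2 * h = h\<^sup>2 / (a\<^sup>2 * (a + h))"
    using a ah0 by (simp add: divide_simps power2_eq_square) (simp add: algebra_simps)
  also have "norm \<dots> = (norm h)\<^sup>2 / ((norm a)\<^sup>2 * norm (a + h))"
    by (simp add: norm_divide norm_mult norm_power)
  also have "\<dots> \<le> (norm h)\<^sup>2 / (d\<^sup>2 * (d / 2))"
    using d ah ah0 a by (intro divide_left_mono mult_mono power_mono mult_pos_pos) auto
  also have "\<dots> = 2 / d ^ 3 * (norm h)\<^sup>2" by (simp add: power3_eq_cube power2_eq_square)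
  finally show ?thesis .
qed

locale compact_prob_space = prob_space \<mu> for \<mu> :: "real measure" +
  fixes E :: "real set"
  assumes sets_eq [measurable_cong]: "sets \<mu> = sets borel"
    and compact: "compact E" and AE_support: "AE t in \<mu>. t \<in> E"
begin

definition pot :: "complex \<Rightarrow> real" where
  "pot z = (\<integral>t. ln (norm (z - of_real t)) \<partial>\<mu>)"

text \<open>The complex gradient of \<open>pot\<close> (see \<open>pot_has_derivative\<close>):
  \<open>Re (cau z)\<close> is the horizontal derivative and \<open>- Im (cau z)\<close> the
  vertical one. The function G of the overview is \<open>\<i> * cau z\<close>.\<close>

definition cau :: "complex \<Rightarrow> complex" where
  "cau z = (\<integral>t. inverse (z - of_real t) \<partial>\<mu>)"

abbreviation "Omega \<equiv> - complex_of_real ` E"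

lemma compact_of_real: "compact (complex_of_real ` E)"
  by (intro compact_continuous_image compact continuous_intros)

lemma open_Omega: "open Omega"
  using compact_of_real compact_imp_closed by blast

lemma bounded_E: obtains b where "0 < b" "\<And>t. t \<in> E \<Longrightarrow> \<bar>t\<bar> < b"
proof -
  obtain b where "0 < b" "\<forall>t\<in>E. \<bar>t\<bar> \<le> b"
    using compact_imp_bounded[OF compact] unfolding bounded_pos by auto
  then show ?thesis by (intro that[of "b + 1"]) auto
qed

lemma dist_E:
  assumes "z \<in> Omega"
  obtains d where "0 < d" "\<And>t. t \<in> E \<Longrightarrow> d \<le> norm (z - of_real t)"
  using separate_point_closed[OF compact_imp_closed[OF compact_of_real], of z] assms
  by (auto simp: dist_norm)

lemma integrable_AE_bounded:
  fixes f :: "real \<Rightarrow> 'b::{banach, second_countable_topology}"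
  assumes "f \<in> borel_measurable borel" and "\<And>t. t \<in> E \<Longrightarrow> norm (f t) \<le> B"
  shows "integrable \<mu> f"
proof (rule integrable_const_bound[where B = B])
  show "AE t in \<mu>. norm (f t) \<le> B" using AE_support by eventually_elim (rule assms)
  show "f \<in> borel_measurable \<mu>" using assms(1) measurable_cong_sets[OF sets_eq refl] by auto
qed

lemma norm_integral_le:
  fixes f :: "real \<Rightarrow> 'b::{banach, second_countable_topology}"
  assumes f: "f \<in> borel_measurable borel" and B: "\<And>t. t \<in> E \<Longrightarrow> norm (f t) \<le> B"
  shows "norm (\<integral>t. f t \<partial>\<mu>) \<le> B"
proof -
  have int: "integrable \<mu> f" using assms by (rule integrable_AE_bounded)
  have "norm (\<integral>t. f t \<partial>\<mu>) \<le> (\<integral>t. norm (f t) \<partial>\<mu>)" by (rule integral_norm_bound)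
  also have "\<dots> \<le> (\<integral>t. B \<partial>\<mu>)"
    by (rule integral_mono_AE) (use int AE_support B in \<open>auto elim!: eventually_mono\<close>)
  finally show ?thesis by (simp add: prob_space)
qed

lemma integrable_ln:
  assumes "z \<in> Omega"
  shows "integrable \<mu> (\<lambda>t. ln (norm (z - of_real t)))"
proof -
  obtain d where d: "0 < d" "\<And>t. t \<in> E \<Longrightarrow> d \<le> norm (z - of_real t)"
    using dist_E[OF assms] by blast
  obtain b where b: "0 < b" "\<And>t. t \<in> E \<Longrightarrow> \<bar>t\<bar> < b" using bounded_E by blast
  show ?thesis
  proof (rule integrable_AE_bounded[where B = "\<bar>ln d\<bar> + \<bar>ln (norm z + b)\<bar>"])
    fix t assume t: "t \<in> E"
    have "norm (z - of_real t) \<le> norm z + b"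
      using norm_triangle_ineq4[of z "of_real t"] b(2)[OF t] by simp
    then have "ln d \<le> ln (norm (z - of_real t))" and "ln (norm (z - of_real t)) \<le> ln (norm z + b)"
      using d(1) d(2)[OF t] by (auto intro!: ln_mono)
    then show "norm (ln (norm (z - of_real t))) \<le> \<bar>ln d\<bar> + \<bar>ln (norm z + b)\<bar>" by simp
  qed measurable
qed

lemma integrable_inverse:
  assumes "z \<in> Omega"
  shows "integrable \<mu> (\<lambda>t. inverse (z - of_real t))"
proof -
  obtain d where d: "0 < d" "\<And>t. t \<in> E \<Longrightarrow> d \<le> norm (z - of_real t)"
    using dist_E[OF assms] by blast
  show ?thesis
  proof (rule integrable_AE_bounded[where B = "inverse d"])
    show "norm (inverse (z - of_real t)) \<le> inverse d" if "t \<in> E" for t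
      using d(1) d(2)[OF that] by (simp add: norm_inverse le_imp_inverse_le)
  qed measurable
qed

lemma near_Omega:
  assumes d: "0 < d" "\<And>t. t \<in> E \<Longrightarrow> d \<le> norm (z - of_real t)" and h: "norm h < d / 2"
  shows "z + h \<in> Omega"
proof
  assume "z + h \<in> complex_of_real ` E"
  then obtain t where t: "t \<in> E" "z + h = of_real t" by auto
  then have "z - of_real t = - h" by (simp add: algebra_simps add_eq_0_iff2)
  then show False using d(1) d(2)[OF t(1)] h by simp
qed

lemma pot_has_derivative:
  assumes z: "z \<in> Omega"
  shows "(pot has_derivative (\<lambda>h. Re (cau z * h))) (at z)"
proof -
  obtain d where d: "0 < d" "\<And>t. t \<in> E \<Longrightarrow> d \<le> norm (z - of_real t)"
    using dist_E[OF z] by blast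
  show ?thesis
  proof (rule has_derivative_quadratic_remainder[where d = "d / 2" and C = "2 / d\<^sup>2"])
    show "bounded_linear (\<lambda>h. Re (cau z * h))"
      using bounded_linear_compose[OF bounded_linear_Re bounded_linear_mult_right] .
    show "0 < d / 2" using d by simp
    fix h :: complex assume h: "norm h < d / 2"
    note zh = near_Omega[OF d h]
    have "pot (z + h) - pot z - Re (cau z * h) =
      (\<integral>t. ln (norm (z + h - of_real t)) - ln (norm (z - of_real t)) - Re (inverse (z - of_real t) * h) \<partial>\<mu>)"
    proof -
      have int: "integrable \<mu> (\<lambda>t. inverse (z - of_real t) * h)"
        using integrable_inverse[OF z] by simp
      have "Re (cau z * h) = Re (\<integral>t. inverse (z - of_real t) * h \<partial>\<mu>)"
        unfolding cau_def by (simp only: integral_mult_left_zero)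
      also have "\<dots> = (\<integral>t. Re (inverse (z - of_real t) * h) \<partial>\<mu>)"
        using integral_Re[OF int] by (rule sym)
      finally show ?thesis
        unfolding pot_def using integrable_ln[OF z] integrable_ln[OF zh] integrable_Re[OF int]
        by (simp only: Bochner_Integration.integral_diff Bochner_Integration.integrable_diff)
    qed
    also have "norm \<dots> \<le> 2 / d\<^sup>2 * (norm h)\<^sup>2"
    proof (rule norm_integral_le)
      fix t assume "t \<in> E"
      then show "norm (ln (norm (z + h - of_real t)) - ln (norm (z - of_real t)) - Re (inverse (z - of_real t) * h))
        \<le> 2 / d\<^sup>2 * (norm h)\<^sup>2"
        using ln_norm_quadratic_remainder[OF d(1) d(2)[of t], of h] h by (simp add: algebra_simps)
    qed measurable
    finally show "norm (pot (z + h) - pot z - Re (cau z * h)) \<le> 2 / d\<^sup>2 * (norm h)\<^sup>2" .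
  qed
qed

lemma cau_holomorphic: "cau holomorphic_on Omega"
  unfolding holomorphic_on_def
proof
  fix z assume z: "z \<in> Omega"
  obtain d where d: "0 < d" "\<And>t. t \<in> E \<Longrightarrow> d \<le> norm (z - of_real t)"
    using dist_E[OF z] by blast
  let ?k = "\<lambda>t. - (inverse (z - of_real t))\<^sup>2"
  have int: "integrable \<mu> ?k"
  proof (rule integrable_AE_bounded[where B = "(inverse d)\<^sup>2"])
    show "norm (?k t) \<le> (inverse d)\<^sup>2" if "t \<in> E" for t
      using d(1) d(2)[OF that] by (simp add: norm_inverse norm_power le_imp_inverse_le power_mono)
  qed measurable
  have "(cau has_derivative (\<lambda>h. (\<integral>t. ?k t \<partial>\<mu>) * h)) (at z)"
  proof (rule has_derivative_quadratic_remainder[where d = "d / 2" and C = "2 / d ^ 3"])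
    show "0 < d / 2" using d by simp
    fix h :: complex assume h: "norm h < d / 2"
    note zh = near_Omega[OF d h]
    have "cau (z + h) - cau z - (\<integral>t. ?k t \<partial>\<mu>) * h =
      (\<integral>t. inverse (z + h - of_real t) - inverse (z - of_real t) - ?k t * h \<partial>\<mu>)"
      unfolding cau_def using int integrable_inverse[OF z] integrable_inverse[OF zh]
      by (simp add: integral_diff del: integral_minus integral_mult_left_zero integral_mult_left)
         (simp add: integral_mult_left_zero)
    also have "norm \<dots> \<le> 2 / d ^ 3 * (norm h)\<^sup>2"
    proof (rule norm_integral_le)
      fix t assume "t \<in> E"
      then show "norm (inverse (z + h - of_real t) - inverse (z - of_real t) - ?k t * h) \<le> 2 / d ^ 3 * (norm h)\<^sup>2"
        using inverse_quadratic_remainder[OF d(1) d(2)[of t], of h] h by (simp add: algebra_simps)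
    qed measurable
    finally show "norm (cau (z + h) - cau z - (\<integral>t. ?k t \<partial>\<mu>) * h) \<le> 2 / d ^ 3 * (norm h)\<^sup>2" .
  qed (rule bounded_linear_mult_right)
  then show "cau field_differentiable at z within Omega"
    unfolding field_differentiable_def has_field_derivative_def
    by (intro exI) (rule has_derivative_at_withinI)
qed

lemma pot_harmonic: "harmonic_on pot Omega"
  using harmonic_on_holomorphic_gradient[OF open_Omega cau_holomorphic pot_has_derivative] .

lemma pot_at_infinity: "((\<lambda>z. pot z - ln (norm z)) \<longlongrightarrow> 0) at_infinity"
proof -
  obtain b where b: "0 < b" "\<And>t. t \<in> E \<Longrightarrow> \<bar>t\<bar> < b" using bounded_E by blast
  have lim: "((\<lambda>z::complex. 2 * b / norm z) \<longlongrightarrow> 0) at_infinity"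
    by (intro tendsto_divide_0[OF tendsto_const] filterlim_at_infinity_imp_norm_at_top
         filterlim_mono[OF filterlim_norm_at_top at_top_le_at_infinity order_refl])
  have "eventually (\<lambda>z. norm (pot z - ln (norm z)) \<le> 2 * b / norm z) at_infinity"
    unfolding eventually_at_infinity
  proof (intro exI[of _ "2 * b"] allI impI)
    fix z :: complex assume z: "2 * b \<le> norm z"
    have z0: "0 < norm z" using z b by linarith
    have lo: "norm z / 2 \<le> norm (z - of_real t)" if "t \<in> E" for t
      using norm_triangle_ineq2[of z "of_real t"] b(2)[OF that] z by simp
    have zO: "z \<in> Omega"
    proof
      assume "z \<in> complex_of_real ` E"
      then show False using lo z0 by force
    qed
    have "pot z - ln (norm z) = (\<integral>t. ln (norm (z - of_real t)) - ln (norm z) \<partial>\<mu>)"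
      unfolding pot_def using integrable_ln[OF zO] by (simp add: integral_diff prob_space)
    also have "norm \<dots> \<le> 2 * b / norm z"
    proof (rule norm_integral_le)
      fix t assume t: "t \<in> E"
      let ?w = "norm (z - of_real t)"
      have w: "0 < ?w" "norm z / 2 \<le> ?w" using lo[OF t] z0 by linarith+
      have diff: "\<bar>?w - norm z\<bar> \<le> b"
        using norm_triangle_ineq3[of "z - of_real t" z] b(2)[OF t] by simp
      have "ln ?w - ln (norm z) \<le> (?w - norm z) / norm z"
        using ln_le_minus_one[of "?w / norm z"] w z0 by (simp add: ln_div diff_divide_distrib)
      also have "\<dots> \<le> b / norm z" using diff z0 by (intro divide_right_mono) auto
      also have "\<dots> \<le> 2 * b / norm z" using b z0 by (intro divide_right_mono) auto
      finally have 1: "ln ?w - ln (norm z) \<le> 2 * b / norm z" .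
      have "ln (norm z) - ln ?w \<le> (norm z - ?w) / ?w"
        using ln_le_minus_one[of "norm z / ?w"] w z0 by (simp add: ln_div diff_divide_distrib)
      also have "\<dots> \<le> b / ?w" using diff w by (intro divide_right_mono) auto
      also have "\<dots> \<le> b / (norm z / 2)" using w b z0 by (intro divide_left_mono) auto
      finally have "ln (norm z) - ln ?w \<le> 2 * b / norm z" by (simp add: mult.commute)
      with 1 show "norm (ln ?w - ln (norm z)) \<le> 2 * b / norm z" by (simp add: abs_le_iff)
    qed measurable
    finally show "norm (pot z - ln (norm z)) \<le> 2 * b / norm z" .
  qed
  then show ?thesis by (rule Lim_null_comparison[OF _ lim])
qed

text \<open>\<open>- Im (inverse (z - of_real t))\<close> equals
  \<open>Im z / (norm (z - of_real t))\<^sup>2\<close>, which has a positive lower bound on the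
  bounded set \<open>E\<close>; the uniform bound keeps the inequality strict after
  integration.\<close>

lemma Im_cau_neg:
  assumes z: "0 < Im z"
  shows "Im (cau z) < 0"
proof -
  have zO: "z \<in> Omega" using z by auto
  obtain b where b: "0 < b" "\<And>t. t \<in> E \<Longrightarrow> \<bar>t\<bar> < b" using bounded_E by blast
  let ?c = "Im z / (norm z + b)\<^sup>2"
  have D: "0 < norm z + b" using b by (simp add: add_nonneg_pos)
  have c: "0 < ?c" using z D by simp
  have "(\<integral>t. ?c \<partial>\<mu>) \<le> (\<integral>t. - Im (inverse (z - of_real t)) \<partial>\<mu>)"
  proof (rule integral_mono_AE)
    show "AE t in \<mu>. ?c \<le> - Im (inverse (z - of_real t))"
      using AE_support
    proof eventually_elim
      case (elim t)
      have "norm (z - of_real t) \<le> norm z + b"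
        using norm_triangle_ineq4[of z "of_real t"] b(2)[OF elim] by simp
      moreover have "0 < norm (z - of_real t)" using z by (auto simp: complex_eq_iff)
      ultimately have "?c \<le> Im z / (norm (z - of_real t))\<^sup>2"
        using z D by (intro divide_left_mono power_mono mult_pos_pos) auto
      then show ?case by (simp add: cmod_power2)
    qed
  qed (use integrable_Im[OF integrable_inverse[OF zO]] in \<open>auto simp del: inverse_complex.sel\<close>)
  also have "\<dots> = - Im (cau z)"
    unfolding cau_def using integral_Im[OF integrable_inverse[OF zO]] by (simp del: inverse_complex.sel)
  finally show ?thesis using c by (simp add: prob_space)
qed

lemma norm_cau_le:
  assumes "0 < d" "\<And>t. t \<in> E \<Longrightarrow> d \<le> norm (z - of_real t)"
  shows "norm (cau z) \<le> 1 / d"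
  unfolding cau_def
proof (rule norm_integral_le)
  show "norm (inverse (z - of_real t)) \<le> 1 / d" if "t \<in> E" for t
    using assms(1) assms(2)[OF that] by (simp add: norm_inverse le_imp_inverse_le inverse_eq_divide[symmetric])
qed measurable

end

section \<open>Equilibrium measures and Frostman's inequality\<close>

context compact_prob_space
begin

interpretation P: pair_prob_space \<mu> \<mu> ..

lemma measurable_E [measurable]: "E \<in> sets borel"
  using compact by (simp add: borel_compact)

lemma AE_pair_E: "AE p in \<mu> \<Otimes>\<^sub>M \<mu>. fst p \<in> E \<and> snd p \<in> E"
proof (rule P.AE_pair_measure)
  show "{x \<in> space (\<mu> \<Otimes>\<^sub>M \<mu>). fst x \<in> E \<and> snd x \<in> E} \<in> sets (\<mu> \<Otimes>\<^sub>M \<mu>)" by measurable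
  show "AE x in \<mu>. AE y in \<mu>. fst (x, y) \<in> E \<and> snd (x, y) \<in> E"
    using AE_support by eventually_elim (use AE_support in auto)
qed

lemma diameter_E: obtains D where "1 \<le> D" "\<And>s t. s \<in> E \<Longrightarrow> t \<in> E \<Longrightarrow> \<bar>s - t\<bar> \<le> D"
proof -
  obtain b where b: "0 < b" "\<And>t. t \<in> E \<Longrightarrow> \<bar>t\<bar> < b" using bounded_E by blast
  have "\<bar>s - t\<bar> \<le> 2 * b + 1" if "s \<in> E" "t \<in> E" for s t
    using b(2)[OF that(1)] b(2)[OF that(2)] by linarith
  then show ?thesis using b(1) by (intro that[of "2 * b + 1"]) auto
qed

lemma log_kernel_measurable [measurable]:
  "(\<lambda>p. log_kernel (fst p) (snd p)) \<in> borel_measurable (borel \<Otimes>\<^sub>M borel)"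
  unfolding log_kernel_def by measurable

end

locale finite_energy_measure = compact_prob_space +
  assumes finite_energy: "(\<integral>\<^sup>+ s. (\<integral>\<^sup>+ t. e2ennreal (log_kernel s t) \<partial>\<mu>) \<partial>\<mu>) < \<infinity>"
begin

interpretation P: pair_prob_space \<mu> \<mu> ..

text \<open>The real-valued logarithmic kernel. On the diagonal it is 0, as \<open>ln 0 = 0\<close>,
  whereas \<open>log_kernel\<close> is infinite there; the diagonal turns out to be a null
  set.\<close>

definition kr :: "real \<times> real \<Rightarrow> real" where
  "kr p = - ln \<bar>fst p - snd p\<bar>"

lemma kr_measurable [measurable]: "kr \<in> borel_measurable (borel \<Otimes>\<^sub>M borel)"
  unfolding kr_def by measurable

lemma energy_pair: "(\<integral>\<^sup>+ p. e2ennreal (log_kernel (fst p) (snd p)) \<partial>(\<mu> \<Otimes>\<^sub>M \<mu>)) < \<infinity>"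
  using finite_energy nn_integral_fst[of "\<lambda>p. e2ennreal (log_kernel (fst p) (snd p))" \<mu>] by simp

text \<open>The kernel is infinite on the diagonal, so finite energy forces the diagonal to be null
  for the product measure.\<close>

lemma AE_off_diagonal: "AE p in \<mu> \<Otimes>\<^sub>M \<mu>. fst p \<noteq> snd p"
proof -
  have "AE p in \<mu> \<Otimes>\<^sub>M \<mu>. e2ennreal (log_kernel (fst p) (snd p)) \<noteq> \<infinity>"
    using energy_pair by (intro nn_integral_PInf_AE) auto
  then show ?thesis
    by eventually_elim (auto simp: log_kernel_def)
qed

lemma AE_kernel:
  "AE p in \<mu> \<Otimes>\<^sub>M \<mu>. e2ennreal (log_kernel (fst p) (snd p)) = ennreal (kr p) \<and>
     e2ennreal (- log_kernel (fst p) (snd p)) = ennreal (- kr p)"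
  using AE_off_diagonal by eventually_elim (auto simp: log_kernel_def kr_def ln_div)

lemma neg_kernel_bound:
  obtains C where "0 \<le> C" "AE p in \<mu> \<Otimes>\<^sub>M \<mu>. - kr p \<le> C"
proof -
  obtain D where D: "1 \<le> D" "\<And>s t. s \<in> E \<Longrightarrow> t \<in> E \<Longrightarrow> \<bar>s - t\<bar> \<le> D" using diameter_E by blast
  have "AE p in \<mu> \<Otimes>\<^sub>M \<mu>. - kr p \<le> ln D"
    using AE_pair_E AE_off_diagonal
  proof eventually_elim
    case (elim p)
    then show ?case using D by (simp add: kr_def)
  qed
  then show ?thesis using D by (intro that[of "ln D"]) auto
qed

lemma kr_integrable: "integrable (\<mu> \<Otimes>\<^sub>M \<mu>) kr"
proof -
  obtain C where C: "0 \<le> C" "AE p in \<mu> \<Otimes>\<^sub>M \<mu>. - kr p \<le> C" using neg_kernel_bound by blast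
  have "(\<integral>\<^sup>+ p. ennreal (norm (kr p)) \<partial>(\<mu> \<Otimes>\<^sub>M \<mu>)) \<le>
    (\<integral>\<^sup>+ p. e2ennreal (log_kernel (fst p) (snd p)) + ennreal C \<partial>(\<mu> \<Otimes>\<^sub>M \<mu>))"
  proof (rule nn_integral_mono_AE)
    show "AE p in \<mu> \<Otimes>\<^sub>M \<mu>. ennreal (norm (kr p)) \<le> e2ennreal (log_kernel (fst p) (snd p)) + ennreal C"
      using AE_kernel C(2)
    proof eventually_elim
      case (elim p)
      have "ennreal (norm (kr p)) \<le> ennreal (kr p) + ennreal C"
      proof (cases "0 \<le> kr p")
        case True
        then show ?thesis using C(1) by simp
      next
        case False
        then have "ennreal (norm (kr p)) \<le> ennreal C" using elim by (intro ennreal_leI) simp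
        then show ?thesis using False by (simp add: ennreal_neg)
      qed
      then show ?case using elim by simp
    qed
  qed
  also have "\<dots> = (\<integral>\<^sup>+ p. e2ennreal (log_kernel (fst p) (snd p)) \<partial>(\<mu> \<Otimes>\<^sub>M \<mu>)) + ennreal C"
    by (subst nn_integral_add) (auto simp: P.emeasure_space_1)
  also have "\<dots> < \<infinity>" using energy_pair by (simp add: ennreal_add_less_top)
  finally show ?thesis by (intro integrableI_bounded) auto
qed

text \<open>The competitors in the minimisation are bounded densities times \<open>\<mu>\<close>.
  For them the difference of two extended integrals becomes a single real integral over the product,
  which can be expanded algebraically.\<close>

lemma log_energy_density:
  fixes \<phi> :: "real \<Rightarrow> real"
  assumes m [measurable]: "\<phi> \<in> borel_measurable borel"
    and \<phi>: "\<And>t. 0 \<le> \<phi> t" "\<And>t. \<phi> t \<le> C"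
  shows "integrable (\<mu> \<Otimes>\<^sub>M \<mu>) (\<lambda>p. kr p * (\<phi> (fst p) * \<phi> (snd p)))"
    and "log_energy (density \<mu> (\<lambda>t. ennreal (\<phi> t))) =
      ereal (\<integral>p. kr p * (\<phi> (fst p) * \<phi> (snd p)) \<partial>(\<mu> \<Otimes>\<^sub>M \<mu>))"
proof -
  let ?f = "\<lambda>p. kr p * (\<phi> (fst p) * \<phi> (snd p))"
  let ?M = "\<mu> \<Otimes>\<^sub>M \<mu>"
  have C: "0 \<le> C" using \<phi>[of 0] by linarith
  show int: "integrable ?M ?f"
  proof (rule Bochner_Integration.integrable_bound[of _ "\<lambda>p. C\<^sup>2 * kr p"])
    show "integrable ?M (\<lambda>p. C\<^sup>2 * kr p)" using kr_integrable by simp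
    have "norm (?f p) \<le> norm (C\<^sup>2 * kr p)" for p
    proof -
      have "\<phi> (fst p) * \<phi> (snd p) \<le> C * C" using \<phi> C by (intro mult_mono) auto
      then show ?thesis
        using \<phi> by (simp add: abs_mult power2_eq_square mult.commute[of "\<bar>kr p\<bar>"] mult_right_mono)
    qed
    then show "AE p in ?M. norm (?f p) \<le> norm (C\<^sup>2 * kr p)" by simp
  qed measurable
  have iter: "(\<integral>\<^sup>+ s. (\<integral>\<^sup>+ t. a (s, t) \<partial>density \<mu> (\<lambda>t. ennreal (\<phi> t))) \<partial>density \<mu> (\<lambda>t. ennreal (\<phi> t))) =
      (\<integral>\<^sup>+ p. ennreal (r p * (\<phi> (fst p) * \<phi> (snd p))) \<partial>?M)"
    if a [measurable]: "a \<in> borel_measurable (borel \<Otimes>\<^sub>M borel)"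
      and ar: "AE p in ?M. a p = ennreal (r p)" for a r
  proof -
    have "(\<integral>\<^sup>+ s. (\<integral>\<^sup>+ t. a (s, t) \<partial>density \<mu> (\<lambda>t. ennreal (\<phi> t))) \<partial>density \<mu> (\<lambda>t. ennreal (\<phi> t))) =
        (\<integral>\<^sup>+ s. ennreal (\<phi> s) * (\<integral>\<^sup>+ t. ennreal (\<phi> t) * a (s, t) \<partial>\<mu>) \<partial>\<mu>)"
      by (simp add: nn_integral_density)
    also have "\<dots> = (\<integral>\<^sup>+ s. (\<integral>\<^sup>+ t. ennreal (\<phi> s) * (ennreal (\<phi> t) * a (s, t)) \<partial>\<mu>) \<partial>\<mu>)"
      by (simp add: nn_integral_cmult)
    also have "\<dots> = (\<integral>\<^sup>+ p. ennreal (\<phi> (fst p)) * (ennreal (\<phi> (snd p)) * a p) \<partial>?M)"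
      by (subst nn_integral_fst[symmetric]) auto
    also have "\<dots> = (\<integral>\<^sup>+ p. ennreal (r p * (\<phi> (fst p) * \<phi> (snd p))) \<partial>?M)"
    proof (rule nn_integral_cong_AE)
      show "AE p in ?M. ennreal (\<phi> (fst p)) * (ennreal (\<phi> (snd p)) * a p) = ennreal (r p * (\<phi> (fst p) * \<phi> (snd p)))"
        using ar by eventually_elim (simp add: \<phi> ennreal_mult' [symmetric] ennreal_mult''[symmetric] mult_ac)
    qed
    finally show ?thesis .
  qed
  have pos: "(\<integral>\<^sup>+ p. ennreal (?f p) \<partial>?M) < \<infinity>" and neg: "(\<integral>\<^sup>+ p. ennreal (- ?f p) \<partial>?M) < \<infinity>"
    using int by (auto simp: real_integrable_def less_top)
  have "log_energy (density \<mu> (\<lambda>t. ennreal (\<phi> t))) =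
      enn2ereal (\<integral>\<^sup>+ p. ennreal (?f p) \<partial>?M) - enn2ereal (\<integral>\<^sup>+ p. ennreal (- ?f p) \<partial>?M)"
    unfolding log_energy_def
    using iter[of "\<lambda>p. e2ennreal (log_kernel (fst p) (snd p))" kr]
      iter[of "\<lambda>p. e2ennreal (- log_kernel (fst p) (snd p))" "\<lambda>p. - kr p"] AE_kernel
    by simp
  also have "\<dots> = ereal (enn2real (\<integral>\<^sup>+ p. ennreal (?f p) \<partial>?M) - enn2real (\<integral>\<^sup>+ p. ennreal (- ?f p) \<partial>?M))"
    using pos neg
    by (cases "\<integral>\<^sup>+ p. ennreal (?f p) \<partial>?M"; cases "\<integral>\<^sup>+ p. ennreal (- ?f p) \<partial>?M") auto
  also have "\<dots> = ereal (\<integral>p. ?f p \<partial>?M)"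
    using int by (simp add: real_lebesgue_integral_def)
  finally show "log_energy (density \<mu> (\<lambda>t. ennreal (\<phi> t))) = ereal (\<integral>p. ?f p \<partial>?M)" .
qed

definition V where "V = (\<integral>p. kr p \<partial>(\<mu> \<Otimes>\<^sub>M \<mu>))"

lemma log_energy_eq: "log_energy \<mu> = ereal V"
  using log_energy_density(2)[of "\<lambda>_. 1" 1] by (simp add: V_def density_1)

text \<open>There are no atoms: a point \<open>x\<close> of positive mass lies outside the
  exceptional null set of the iterated statement "almost every t differs from s", so that statement
  holds at \<open>s = x\<close> itself.\<close>

lemma AE_neq: "AE t in \<mu>. t \<noteq> x"
proof (cases "emeasure \<mu> {x} = 0")
  case True
  then have "{x} \<in> null_sets \<mu>" by (auto simp: sets_eq)
  from AE_not_in[OF this] show ?thesis by simp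
next
  case False
  have AE2: "AE s in \<mu>. AE t in \<mu>. fst (s, t) \<noteq> snd (s, t)"
    using AE_off_diagonal by (rule P.AE_pair)
  obtain N where N: "{s \<in> space \<mu>. \<not> (AE t in \<mu>. fst (s, t) \<noteq> snd (s, t))} \<subseteq> N"
      "emeasure \<mu> N = 0" "N \<in> sets \<mu>"
    using AE_E[OF AE2] by blast
  have "x \<notin> N"
  proof
    assume "x \<in> N"
    then have "emeasure \<mu> {x} \<le> emeasure \<mu> N" using N(3) by (intro emeasure_mono) auto
    then show False using False N(2) by simp
  qed
  then have "AE t in \<mu>. x \<noteq> t" using N(1) sets_eq_imp_space_eq[OF sets_eq] by auto
  then show ?thesis by eventually_elim simp
qed

end

lemma quadratic_min_at_0:
  fixes L Q :: real
  assumes "\<And>r. \<bar>r\<bar> \<le> 1 \<Longrightarrow> 0 \<le> r * L + r\<^sup>2 * Q"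
  shows "L = 0"
proof (rule ccontr)
  assume L: "L \<noteq> 0"
  \<comment> \<open>The trial value is \<open>r = - L / c\<close>:
    \<open>\<bar>L\<bar> \<le> c\<close> makes it admissible, and \<open>Q < c\<close> makes the
    quadratic negative there.\<close>
  define c where "c = \<bar>L\<bar> + \<bar>Q\<bar>"
  have c: "0 < c" "\<bar>L\<bar> \<le> c" "Q < c" using L by (auto simp: c_def)
  have "\<bar>- L / c\<bar> \<le> 1" using c by simp
  from assms[OF this] have "0 \<le> - L / c * L + (- L / c)\<^sup>2 * Q" .
  also have "\<dots> = L\<^sup>2 / c\<^sup>2 * (Q - c)"
    using c by (simp add: power2_eq_square field_simps)
  finally have "0 \<le> L\<^sup>2 / c\<^sup>2 * (Q - c)" .
  moreover have "L\<^sup>2 / c\<^sup>2 * (Q - c) < 0" using L c by (intro mult_pos_neg) auto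
  ultimately show False by simp
qed

locale equilibrium_measure = finite_energy_measure +
  assumes minimal: "\<nu> \<in> prob_measures_on E \<Longrightarrow> log_energy \<mu> \<le> log_energy \<nu>"
begin

interpretation P: pair_prob_space \<mu> \<mu> ..

text \<open>For \<open>\<bar>r\<bar> \<le> 1\<close> the measure with density
  \<open>1 + r * \<psi>\<close> is again a probability measure on \<open>E\<close>, because
  \<open>\<psi>\<close> is bounded by 1 and has mean 0. Its energy is a quadratic polynomial in
  \<open>r\<close> with minimum at 0, so the linear coefficient vanishes.\<close>

lemma first_variation:
  fixes \<psi> :: "real \<Rightarrow> real"
  assumes m [measurable]: "\<psi> \<in> borel_measurable borel"
    and \<psi>: "\<And>t. \<bar>\<psi> t\<bar> \<le> 1" and mean: "(\<integral>t. \<psi> t \<partial>\<mu>) = 0"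
  shows "(\<integral>p. kr p * (\<psi> (fst p) + \<psi> (snd p)) \<partial>(\<mu> \<Otimes>\<^sub>M \<mu>)) = 0"
proof -
  let ?M = "\<mu> \<Otimes>\<^sub>M \<mu>"
  have int\<psi>: "integrable \<mu> \<psi>" using m \<psi> by (intro integrable_AE_bounded[of _ 1]) auto
  have intL: "integrable ?M (\<lambda>p. kr p * (\<psi> (fst p) + \<psi> (snd p)))"
  proof (rule Bochner_Integration.integrable_bound[of _ "\<lambda>p. 2 * kr p"])
    have "norm (kr p * (\<psi> (fst p) + \<psi> (snd p))) \<le> norm (2 * kr p)" for p
      using \<psi>[of "fst p"] \<psi>[of "snd p"]
      by (simp add: abs_mult mult.commute[of "\<bar>kr p\<bar>"]) (intro mult_right_mono, auto)
    then show "AE p in ?M. norm (kr p * (\<psi> (fst p) + \<psi> (snd p))) \<le> norm (2 * kr p)" by simp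
  qed (use kr_integrable in auto)
  have intQ: "integrable ?M (\<lambda>p. kr p * (\<psi> (fst p) * \<psi> (snd p)))"
  proof (rule Bochner_Integration.integrable_bound[of _ kr])
    have "norm (kr p * (\<psi> (fst p) * \<psi> (snd p))) \<le> norm (kr p)" for p
      using \<psi>[of "fst p"] \<psi>[of "snd p"] mult_mono[of "\<bar>\<psi> (fst p)\<bar>" 1 "\<bar>\<psi> (snd p)\<bar>" 1]
      by (simp add: abs_mult mult_left_le)
    then show "AE p in ?M. norm (kr p * (\<psi> (fst p) * \<psi> (snd p))) \<le> norm (kr p)" by simp
  qed (use kr_integrable in auto)
  show ?thesis
  proof (rule quadratic_min_at_0)
    fix r :: real assume r: "\<bar>r\<bar> \<le> 1"
    define \<phi> where "\<phi> = (\<lambda>t. 1 + r * \<psi> t)"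
    have [measurable]: "\<phi> \<in> borel_measurable borel" unfolding \<phi>_def by measurable
    have "\<bar>r * \<psi> t\<bar> \<le> 1" for t
      using mult_mono[OF r \<psi>[of t]] by (simp add: abs_mult)
    then have b: "- 1 \<le> r * \<psi> t" "r * \<psi> t \<le> 1" for t
      by (simp_all add: abs_le_iff minus_le_iff)
    have \<phi>: "0 \<le> \<phi> t" "\<phi> t \<le> 2" for t
      unfolding \<phi>_def using b[of t] by linarith+
    define \<nu> where "\<nu> = density \<mu> (\<lambda>t. ennreal (\<phi> t))"
    have "(\<integral>\<^sup>+ t. ennreal (\<phi> t) \<partial>\<mu>) = ennreal (\<integral>t. \<phi> t \<partial>\<mu>)"
      using int\<psi> \<phi> unfolding \<phi>_def by (intro nn_integral_eq_integral) auto
    also have "(\<integral>t. \<phi> t \<partial>\<mu>) = 1"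
      using int\<psi> mean unfolding \<phi>_def by (simp add: prob_space)
    finally have one: "(\<integral>\<^sup>+ t. ennreal (\<phi> t) \<partial>\<mu>) = 1" by simp
    have "emeasure \<nu> (space \<nu>) = 1"
      using one by (simp add: \<nu>_def emeasure_density cong: nn_integral_cong)
    moreover have "emeasure \<nu> E = 1"
    proof -
      have "emeasure \<nu> E = (\<integral>\<^sup>+ t. ennreal (\<phi> t) * indicator E t \<partial>\<mu>)"
        by (simp add: \<nu>_def emeasure_density)
      also have "\<dots> = (\<integral>\<^sup>+ t. ennreal (\<phi> t) \<partial>\<mu>)"
        using AE_support by (intro nn_integral_cong_AE) (auto elim!: eventually_mono)
      finally show ?thesis using one by simp
    qed
    ultimately have "\<nu> \<in> prob_measures_on E"
      unfolding prob_measures_on_def by (auto intro: prob_spaceI simp: \<nu>_def sets_eq)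
    from minimal[OF this] have "V \<le> (\<integral>p. kr p * (\<phi> (fst p) * \<phi> (snd p)) \<partial>?M)"
      using log_energy_density(2)[of \<phi> 2] \<phi> log_energy_eq by (simp add: \<nu>_def)
    also have "(\<lambda>p. kr p * (\<phi> (fst p) * \<phi> (snd p))) = (\<lambda>p. kr p + (r * (kr p * (\<psi> (fst p) + \<psi> (snd p)))
        + r\<^sup>2 * (kr p * (\<psi> (fst p) * \<psi> (snd p)))))"
      by (simp add: \<phi>_def fun_eq_iff algebra_simps power2_eq_square)
    also have "(\<integral>p. kr p + (r * (kr p * (\<psi> (fst p) + \<psi> (snd p)))
        + r\<^sup>2 * (kr p * (\<psi> (fst p) * \<psi> (snd p)))) \<partial>?M) = V +
        (r * (\<integral>p. kr p * (\<psi> (fst p) + \<psi> (snd p)) \<partial>?M)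
        + r\<^sup>2 * (\<integral>p. kr p * (\<psi> (fst p) * \<psi> (snd p)) \<partial>?M))"
      using kr_integrable intL intQ
      by (simp only: Bochner_Integration.integral_add Bochner_Integration.integrable_add
          integral_mult_right_zero integrable_mult_right V_def)
    finally show "0 \<le> r * (\<integral>p. kr p * (\<psi> (fst p) + \<psi> (snd p)) \<partial>?M)
        + r\<^sup>2 * (\<integral>p. kr p * (\<psi> (fst p) * \<psi> (snd p)) \<partial>?M)" by simp
  qed
qed

text \<open>The test function is the indicator of \<open>A = {s. V < U s}\<close> minus its mean,
  where \<open>U\<close> is the potential. By symmetry of the kernel the first variation reduces to
  a vanishing integral of \<open>U - V\<close> over \<open>A\<close>; the integrand is positive
  there, so \<open>A\<close> is null.\<close>

lemma potential_le_V:
  "AE s in \<mu>. integrable \<mu> (\<lambda>t. kr (s, t)) \<and> (\<integral>t. kr (s, t) \<partial>\<mu>) \<le> V"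
proof -
  let ?M = "\<mu> \<Otimes>\<^sub>M \<mu>"
  define U where "U s = (\<integral>t. kr (s, t) \<partial>\<mu>)" for s
  have AEint: "AE s in \<mu>. integrable \<mu> (\<lambda>t. kr (s, t))"
    using P.AE_integrable_fst'[OF kr_integrable] .
  have Uint: "integrable \<mu> U"
    unfolding U_def using P.integrable_fst'[OF kr_integrable] .
  have UV: "(\<integral>s. U s \<partial>\<mu>) = V"
    unfolding U_def V_def using P.integral_fst'[OF kr_integrable] .
  have [measurable]: "U \<in> borel_measurable borel"
    using Uint borel_measurable_integrable measurable_cong_sets[OF sets_eq refl] by blast
  define A where "A = {s. V < U s}"
  have A [measurable]: "A \<in> sets borel" unfolding A_def by measurable
  define \<psi> where "\<psi> = (\<lambda>t. indicator A t - prob A)"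
  have \<psi>m [measurable]: "\<psi> \<in> borel_measurable borel" unfolding \<psi>_def by measurable
  have \<psi>1: "\<bar>\<psi> t\<bar> \<le> 1" for t
    using prob_le_1[of A] measure_nonneg[of \<mu> A] unfolding \<psi>_def by (cases "t \<in> A") (simp_all del: measure_nonneg)
  have Aint: "integrable \<mu> (\<lambda>t. indicator A t :: real)"
    by (intro integrable_AE_bounded[of _ 1]) (auto simp: indicator_def)
  have mean: "(\<integral>t. \<psi> t \<partial>\<mu>) = 0"
    using Aint by (simp add: \<psi>_def prob_space sets_eq)
  have i1: "integrable ?M (\<lambda>p. kr p * \<psi> (fst p))" and i2: "integrable ?M (\<lambda>p. kr p * \<psi> (snd p))"
    using \<psi>1 by (auto intro!: Bochner_Integration.integrable_bound[OF kr_integrable] simp: abs_mult mult_left_le)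
  have e1: "(\<integral>p. kr p * \<psi> (fst p) \<partial>?M) = (\<integral>s. U s * \<psi> s \<partial>\<mu>)"
    unfolding P.integral_fst'[OF i1, symmetric] U_def by simp
  have e2: "(\<integral>p. kr p * \<psi> (snd p) \<partial>?M) = (\<integral>p. kr p * \<psi> (fst p) \<partial>?M)"
    by (subst P.integral_product_swap[symmetric, OF i2[THEN borel_measurable_integrable]])
       (auto simp: kr_def case_prod_unfold abs_minus_commute intro!: Bochner_Integration.integral_cong)
  have "(\<integral>p. kr p * (\<psi> (fst p) + \<psi> (snd p)) \<partial>?M) =
    (\<integral>p. kr p * \<psi> (fst p) \<partial>?M) + (\<integral>p. kr p * \<psi> (snd p) \<partial>?M)"
    using i1 i2 by (simp add: distrib_left)
  then have z: "(\<integral>s. U s * \<psi> s \<partial>\<mu>) = 0"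
    using first_variation[OF \<psi>m \<psi>1 mean] e1 e2 by simp
  have iUA: "integrable \<mu> (\<lambda>s. U s * indicator A s)"
    using Uint by (rule Bochner_Integration.integrable_bound) (auto simp: indicator_def)
  have "(\<integral>s. U s * \<psi> s \<partial>\<mu>) = (\<integral>s. U s * indicator A s \<partial>\<mu>) - V * prob A"
    unfolding \<psi>_def right_diff_distrib using iUA Uint UV by simp
  then have "(\<integral>s. (U s - V) * indicator A s \<partial>\<mu>) = 0"
    unfolding left_diff_distrib using iUA Aint z by (simp add: sets_eq)
  moreover have "integrable \<mu> (\<lambda>s. (U s - V) * indicator A s)"
    unfolding left_diff_distrib using iUA Aint by simp
  moreover have "AE s in \<mu>. 0 \<le> (U s - V) * indicator A s"
    by (auto simp: A_def indicator_def)
  ultimately have "AE s in \<mu>. (U s - V) * indicator A s = 0"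
    using integral_nonneg_eq_0_iff_AE by blast
  with AEint show ?thesis
    by eventually_elim (auto simp: A_def indicator_def U_def split: if_splits)
qed

end

context equilibrium_measure
begin

text \<open>Frostman's inequality. The potential is bounded by \<^term>\<open>V\<close> almost everywhere, hence by lower
  semicontinuity on the closure of a set of full measure. As this closure is a subset of the line,
  monotonicity and concavity of the logarithm extend the bound to the whole line.\<close>

lemma nn_integral_log_le:
  assumes D: "1 \<le> D" "\<And>s t. s \<in> E \<Longrightarrow> t \<in> E \<Longrightarrow> \<bar>s - t\<bar> \<le> D"
  shows "0 \<le> ln D + V" and "(\<integral>\<^sup>+ t. ennreal (ln D - ln \<bar>x - t\<bar>) \<partial>\<mu>) \<le> ennreal (ln D + V)"
proof -
  \<comment> \<open>The shift by \<open>ln D\<close> makes the kernel nonnegative on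
    \<open>E\<close>, so that extended integrals and Fatou's lemma apply. For \<open>x\<close> off
    \<open>E\<close> negative values are replaced by 0, which only enlarges the integral to be
    bounded.\<close>
  define N where "N x = (\<integral>\<^sup>+ t. ennreal (ln D - ln \<bar>x - t\<bar>) \<partial>\<mu>)" for x
  define c where "c = ennreal (ln D + V)"
  have good: "AE s in \<mu>. s \<in> E \<and> N s \<le> c \<and> 0 \<le> ln D + V"
    using potential_le_V AE_support
  proof eventually_elim
    case (elim s)
    then have sE: "s \<in> E" and int: "integrable \<mu> (\<lambda>t. ln \<bar>s - t\<bar>)" and le: "- (\<integral>t. ln \<bar>s - t\<bar> \<partial>\<mu>) \<le> V"
      by (simp_all add: kr_def)
    have nonneg: "AE t in \<mu>. 0 \<le> ln D - ln \<bar>s - t\<bar>"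
      using AE_support
    proof eventually_elim
      case (elim t)
      show ?case
      proof (cases "s = t")
        case False
        then show ?thesis using D(2)[OF sE elim] by simp
      qed (use D in simp)
    qed
    have "N s = ennreal (\<integral>t. ln D - ln \<bar>s - t\<bar> \<partial>\<mu>)"
      unfolding N_def using int nonneg by (intro nn_integral_eq_integral) auto
    also have "(\<integral>t. ln D - ln \<bar>s - t\<bar> \<partial>\<mu>) = ln D - (\<integral>t. ln \<bar>s - t\<bar> \<partial>\<mu>)"
      using int by (simp add: prob_space)
    finally have "N s \<le> c" unfolding c_def using le by (simp add: ennreal_leI)
    moreover have "0 \<le> (\<integral>t. ln D - ln \<bar>s - t\<bar> \<partial>\<mu>)"
      using nonneg by (rule integral_nonneg_AE)
    ultimately show ?case using elim le int by (simp add: prob_space)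
  qed
  then have "AE s in \<mu>. 0 \<le> ln D + V" by eventually_elim simp
  then show nn: "0 \<le> ln D + V" by simp
  define S where "S = closure {s \<in> E. N s \<le> c}"
  have "S \<subseteq> E" unfolding S_def using compact compact_imp_closed by (intro closure_minimal) auto
  then have S: "compact S" using compact by (metis S_def closed_closure compact_Int_closed inf.absorb_iff2)
  have AE_S: "AE s in \<mu>. s \<in> S"
    using good by eventually_elim (auto simp: S_def intro!: subsetD[OF closure_subset])
  have "S \<noteq> {}" using AE_S by auto
  \<comment> \<open>Lower semicontinuity by Fatou's lemma along a sequence of good points. The
    integrands converge for \<open>t\<close> different from \<open>x\<close>, which is almost every
    \<open>t\<close> because there are no atoms.\<close>
  have NS: "N x \<le> c" if xS: "x \<in> S" for x
  proof -
    obtain s where s: "\<And>n. s n \<in> {s \<in> E. N s \<le> c}" "s \<longlonglongrightarrow> x"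
      using xS unfolding S_def closure_sequential by blast
    have "N x \<le> (\<integral>\<^sup>+ t. liminf (\<lambda>n. ennreal (ln D - ln \<bar>s n - t\<bar>)) \<partial>\<mu>)"
      unfolding N_def
    proof (rule nn_integral_mono_AE)
      show "AE t in \<mu>. ennreal (ln D - ln \<bar>x - t\<bar>) \<le> liminf (\<lambda>n. ennreal (ln D - ln \<bar>s n - t\<bar>))"
        using AE_neq[of x]
      proof eventually_elim
        case (elim t)
        have "(\<lambda>n. ennreal (ln D - ln \<bar>s n - t\<bar>)) \<longlonglongrightarrow> ennreal (ln D - ln \<bar>x - t\<bar>)"
          using elim by (intro tendsto_ennrealI tendsto_intros s) auto
        then show ?case by (simp add: lim_imp_Liminf)
      qed
    qed
    also have "\<dots> \<le> liminf (\<lambda>n. N (s n))"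
      unfolding N_def by (rule nn_integral_liminf) measurable
    also have "\<dots> \<le> c"
    proof -
      have "liminf (\<lambda>n. N (s n)) \<le> liminf (\<lambda>n. c)"
        using s(1) by (intro Liminf_mono always_eventually) auto
      then show ?thesis by (simp add: Liminf_const)
    qed
    finally show ?thesis .
  qed
  \<comment> \<open>For \<open>x\<close> to the left or to the right of all of \<open>S\<close>: the
    nearest end point \<open>b\<close> of \<open>S\<close> is closer than \<open>x\<close> to every
    point of \<open>S\<close>.\<close>
  have edge: "N x \<le> c" if b: "b \<in> S" and far: "\<And>t. t \<in> S \<Longrightarrow> \<bar>b - t\<bar> \<le> \<bar>x - t\<bar>" for b
  proof -
    have "N x \<le> N b"
      unfolding N_def
    proof (rule nn_integral_mono_AE)
      show "AE t in \<mu>. ennreal (ln D - ln \<bar>x - t\<bar>) \<le> ennreal (ln D - ln \<bar>b - t\<bar>)"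
        using AE_S AE_neq[of b]
      proof eventually_elim
        case (elim t)
        then show ?case using far[of t] by (intro ennreal_leI diff_left_mono ln_mono) auto
      qed
    qed
    then show ?thesis using NS[OF b] by simp
  qed
  have "N x \<le> c"
  proof -
    consider "x \<in> S" | "S \<inter> {..x} = {}" | "S \<inter> {x..} = {}"
      | "x \<notin> S" "S \<inter> {..x} \<noteq> {}" "S \<inter> {x..} \<noteq> {}" by blast
    then show ?thesis
    proof cases
      case 1
      then show ?thesis by (rule NS)
    next
      case 2
      obtain b where b: "b \<in> S" "\<And>t. t \<in> S \<Longrightarrow> b \<le> t"
        using compact_attains_inf[OF S \<open>S \<noteq> {}\<close>] by blast
      have "x < b" using b(1) 2 by force
      then show ?thesis using b(2) by (intro edge[OF b(1)]) force
    next
      case 3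
      obtain b where b: "b \<in> S" "\<And>t. t \<in> S \<Longrightarrow> t \<le> b"
        using compact_attains_sup[OF S \<open>S \<noteq> {}\<close>] by blast
      have "b < x" using b(1) 3 by force
      then show ?thesis using b(2) by (intro edge[OF b(1)]) force
    next
      case 4
      have "compact (S \<inter> {..x})" "compact (S \<inter> {x..})" using S by (auto intro: compact_Int_closed)
      obtain a where a: "a \<in> S" "a \<le> x" "\<And>t. t \<in> S \<Longrightarrow> t \<le> x \<Longrightarrow> t \<le> a"
        using compact_attains_sup[OF \<open>compact (S \<inter> {..x})\<close> 4(2)] by auto
      obtain b where b: "b \<in> S" "x \<le> b" "\<And>t. t \<in> S \<Longrightarrow> x \<le> t \<Longrightarrow> b \<le> t"
        using compact_attains_inf[OF \<open>compact (S \<inter> {x..})\<close> 4(3)] by auto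
      have ab: "a < x" "x < b" using a b 4(1) by (auto simp: less_le)
      \<comment> \<open>No point of \<open>S\<close> lies strictly between its neighbours
        \<open>a\<close> and \<open>b\<close> of \<open>x\<close>. Each \<open>t\<close> in
        \<open>S\<close> therefore sees \<open>a\<close>, \<open>x\<close>, \<open>b\<close> on one
        side, and \<open>\<bar>x - t\<bar>\<close> is the convex combination of
        \<open>\<bar>a - t\<bar>\<close> and \<open>\<bar>b - t\<bar>\<close> with the weights of
        \<open>x\<close>.\<close>
      define u where "u = (x - a) / (b - a)"
      have u: "0 \<le> u" "u \<le> 1" using ab by (auto simp: u_def divide_simps)
      have xu: "x = (1 - u) * a + u * b"
      proof -
        have "u * (b - a) = x - a" using ab by (simp add: u_def)
        then show ?thesis by (simp add: algebra_simps)
      qed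
      have "N x \<le> (\<integral>\<^sup>+ t. ennreal (1 - u) * ennreal (ln D - ln \<bar>a - t\<bar>) + ennreal u * ennreal (ln D - ln \<bar>b - t\<bar>) \<partial>\<mu>)"
        unfolding N_def
      proof (rule nn_integral_mono_AE)
        show "AE t in \<mu>. ennreal (ln D - ln \<bar>x - t\<bar>) \<le>
            ennreal (1 - u) * ennreal (ln D - ln \<bar>a - t\<bar>) + ennreal u * ennreal (ln D - ln \<bar>b - t\<bar>)"
          using AE_S AE_neq[of a] AE_neq[of b]
        proof eventually_elim
          case (elim t)
          have "t < a \<or> b < t" using a(3)[of t] b(3)[of t] elim by fastforce
          then have pos: "0 < \<bar>a - t\<bar>" "0 < \<bar>b - t\<bar>"
            and x: "\<bar>x - t\<bar> = (1 - u) * \<bar>a - t\<bar> + u * \<bar>b - t\<bar>"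
            using ab by (auto simp: xu algebra_simps)
          have inS: "a \<in> E" "b \<in> E" "t \<in> E" using a b elim \<open>S \<subseteq> E\<close> by auto
          have "(1 - u) * ln \<bar>a - t\<bar> + u * ln \<bar>b - t\<bar> \<le> ln \<bar>x - t\<bar>"
            unfolding x using concave_onD[OF ln_concave u, of "\<bar>a - t\<bar>" "\<bar>b - t\<bar>"] pos by simp
          then have "ln D - ln \<bar>x - t\<bar> \<le> (1 - u) * (ln D - ln \<bar>a - t\<bar>) + u * (ln D - ln \<bar>b - t\<bar>)"
            by (simp add: algebra_simps)
          then have "ennreal (ln D - ln \<bar>x - t\<bar>) \<le> ennreal ((1 - u) * (ln D - ln \<bar>a - t\<bar>) + u * (ln D - ln \<bar>b - t\<bar>))"
            by (rule ennreal_leI)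
          also have "\<dots> = ennreal (1 - u) * ennreal (ln D - ln \<bar>a - t\<bar>) + ennreal u * ennreal (ln D - ln \<bar>b - t\<bar>)"
            using u pos D(2)[OF inS(1,3)] D(2)[OF inS(2,3)] D(1)
            by (subst ennreal_plus) (auto simp: ennreal_mult)
          finally show ?case .
        qed
      qed
      also have "\<dots> = ennreal (1 - u) * N a + ennreal u * N b"
        unfolding N_def by (subst nn_integral_add) (auto simp: nn_integral_cmult)
      also have "\<dots> \<le> ennreal (1 - u) * c + ennreal u * c"
        using NS[OF a(1)] NS[OF b(1)] by (intro add_mono mult_left_mono) auto
      also have "\<dots> = ennreal ((1 - u) + u) * c"
        using ennreal_plus[of "1 - u" u] u by (simp only: distrib_right)
      finally show ?thesis by simp
    qed
  qed
  then show "(\<integral>\<^sup>+ t. ennreal (ln D - ln \<bar>x - t\<bar>) \<partial>\<mu>) \<le> ennreal (ln D + V)"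
    by (simp add: N_def c_def)
qed

text \<open>Moving \<open>z\<close> down to \<open>Re z\<close> brings it closer to every real
  \<open>t\<close>, so the bound on the line implies the bound in the plane.\<close>

lemma pot_ge:
  assumes z: "z \<in> Omega"
  shows "0 \<le> pot z + V"
proof -
  obtain D where D: "1 \<le> D" "\<And>s t. s \<in> E \<Longrightarrow> t \<in> E \<Longrightarrow> \<bar>s - t\<bar> \<le> D" using diameter_E by blast
  have "(\<integral>\<^sup>+ t. ennreal (ln D - ln (norm (z - of_real t))) \<partial>\<mu>) \<le> (\<integral>\<^sup>+ t. ennreal (ln D - ln \<bar>Re z - t\<bar>) \<partial>\<mu>)"
  proof (rule nn_integral_mono_AE)
    show "AE t in \<mu>. ennreal (ln D - ln (norm (z - of_real t))) \<le> ennreal (ln D - ln \<bar>Re z - t\<bar>)"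
      using AE_neq[of "Re z"]
    proof eventually_elim
      case (elim t)
      have "\<bar>Re z - t\<bar> \<le> norm (z - of_real t)" using abs_Re_le_cmod[of "z - of_real t"] by simp
      then show ?case using elim by (intro ennreal_leI diff_left_mono ln_mono) auto
    qed
  qed
  also have "\<dots> \<le> ennreal (ln D + V)" by (rule nn_integral_log_le(2)[OF D])
  finally have le: "(\<integral>\<^sup>+ t. ennreal (ln D - ln (norm (z - of_real t))) \<partial>\<mu>) \<le> ennreal (ln D + V)" .
  have "0 \<le> ln D + V" by (rule nn_integral_log_le(1)[OF D])
  from integral_real_bounded[OF this le]
  have "(\<integral>t. ln D - ln (norm (z - of_real t)) \<partial>\<mu>) \<le> ln D + V"
    .
  also have "(\<integral>t. ln D - ln (norm (z - of_real t)) \<partial>\<mu>) = ln D - pot z"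
    unfolding pot_def using integrable_ln[OF z] by (simp add: prob_space)
  finally show ?thesis by simp
qed

end

section \<open>Green's function\<close>

locale green_equilibrium = equilibrium_measure +
  fixes g :: "complex \<Rightarrow> real"
  assumes green: "is_green_function E g" and vanish: "vanishes_at_boundary E g"
    and capacity: "log_capacity E = exp (- V)"
begin

text \<open>On \<open>E\<close> only the lower bound \<open>pot_ge\<close> is at hand for
  \<open>pot\<close>, while \<open>g\<close> vanishes there; comparison is therefore one-sided and
  gives \<open>h \<le> 0\<close>. Equality comes from infinity: \<open>capacity\<close> matches the
  constants so that \<open>h\<close> tends to 0, and the nonnegative function \<open>- h\<close>
  must then vanish.\<close>

lemma green_eq_pot:
  assumes z: "z \<in> Omega"
  shows "g z = pot z + V"
proof -
  define h where "h z = g z - (pot z + V)" for z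
  have h: "harmonic_on h Omega"
    unfolding h_def using green pot_harmonic
    by (intro harmonic_on_diff harmonic_on_add harmonic_on_const open_Omega) (auto simp: is_green_function_def)
  have "((\<lambda>z. (g z - (ln (norm z) - ln (log_capacity E))) - (pot z - ln (norm z))) \<longlongrightarrow> 0 - 0) at_infinity"
    using green by (intro tendsto_diff pot_at_infinity) (auto simp: is_green_function_def)
  then have lim: "(h \<longlongrightarrow> 0) at_infinity"
    by (simp add: h_def[abs_def] capacity algebra_simps)
  have le: "h z \<le> 0" if z: "z \<in> Omega" for z
  proof (rule harmonic_on_max_principle[OF h _ z])
    fix e :: real assume e: "0 < e"
    have "eventually (\<lambda>z. h z < e) at_infinity" using order_tendstoD(2)[OF lim e] .
    then obtain B where B: "\<And>z. B \<le> norm z \<Longrightarrow> h z < e" unfolding eventually_at_infinity by blast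
    have "norm z \<le> B" if "z \<in> {z \<in> Omega. e \<le> h z}" for z
      using B[of z] that by (cases "B \<le> norm z") auto
    then have "bounded {z \<in> Omega. e \<le> h z}" unfolding bounded_iff by blast
    moreover have "closed {z \<in> Omega. e \<le> h z}"
      unfolding closed_sequential_limits
    proof (intro allI impI)
      fix s l assume s: "(\<forall>n. s n \<in> {z \<in> Omega. e \<le> h z}) \<and> s \<longlonglongrightarrow> l"
      show "l \<in> {z \<in> Omega. e \<le> h z}"
      proof (cases "l \<in> Omega")
        case True
        have "isCont h l"
          using harmonic_on_continuous[OF h] open_Omega True by (simp add: continuous_on_eq_continuous_at)
        then have "(\<lambda>n. h (s n)) \<longlonglongrightarrow> h l" using s by (blast intro: isCont_tendsto_compose)
        then have "e \<le> h l" using s by (intro LIMSEQ_le_const) auto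
        then show ?thesis using True by simp
      next
        case False
        then obtain t where t: "t \<in> E" "l = of_real t" by auto
        have "filterlim s (at l within Omega) sequentially"
        proof -
          have "s n \<in> Omega \<and> s n \<noteq> l" for n using s False by (metis (mono_tags, lifting) mem_Collect_eq)
          then show ?thesis using s by (simp add: filterlim_at)
        qed
        moreover have "(g \<longlongrightarrow> 0) (at l within Omega)"
          using vanish t by (auto simp: vanishes_at_boundary_def)
        ultimately have "(\<lambda>n. g (s n)) \<longlonglongrightarrow> 0" by (rule filterlim_compose[rotated])
        then have "eventually (\<lambda>n. g (s n) < e) sequentially" using order_tendstoD(2) e by blast
        then obtain n where n: "g (s n) < e" by (auto simp: eventually_sequentially)
        have "s n \<in> Omega" "e \<le> h (s n)" using s by auto
        with n pot_ge[of "s n"] show ?thesis by (simp add: h_def)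
      qed
    qed
    ultimately show "compact {z \<in> Omega. e \<le> h z}" by (simp add: compact_eq_bounded_closed)
  qed
  have "- h z = 0"
  proof (rule harmonic_on_vanishing_at_infinity[OF compact_of_real connected_Compl_of_real[OF compact]])
    show "harmonic_on (\<lambda>z. - h z) Omega" using harmonic_on_cmult[OF h, of "-1"] by simp
    show "((\<lambda>z. - h z) \<longlongrightarrow> 0) at_infinity" using tendsto_minus[OF lim] by simp
  qed (use le z in auto)
  then show ?thesis by (simp add: h_def)
qed

text \<open>\<open>is_green_function\<close> leaves the values of \<open>g\<close> on
  \<open>E\<close> open. Setting them to 0 gives a function that is continuous on the whole plane,
  by regularity.\<close>

definition g0 :: "complex \<Rightarrow> real" where
  "g0 z = (if z \<in> Omega then g z else 0)"

lemma g0_nonneg: "0 \<le> g0 z"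
  using green by (auto simp: g0_def is_green_function_def less_imp_le)

lemma g0_continuous: "continuous_on UNIV g0"
proof (rule continuous_at_imp_continuous_on, rule ballI)
  fix z :: complex
  show "isCont g0 z"
  proof (cases "z \<in> Omega")
    case True
    have "harmonic_on g Omega" using green by (simp add: is_green_function_def)
    from harmonic_on_continuous[OF this] have "isCont g z"
      using open_Omega True by (simp add: continuous_on_eq_continuous_at)
    moreover have "eventually (\<lambda>w. g w = g0 w) (nhds z)"
      using eventually_nhds_in_open[OF open_Omega True] by eventually_elim (simp add: g0_def)
    ultimately show ?thesis using isCont_cong by blast
  next
    case False
    then have "(g \<longlongrightarrow> 0) (at z within Omega)"
      using vanish by (auto simp: vanishes_at_boundary_def)
    then have "(g0 \<longlongrightarrow> 0) (at z within Omega)"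
      by (rule Lim_transform_eventually) (auto simp: g0_def eventually_at_filter)
    moreover have "(g0 \<longlongrightarrow> 0) (at z within - Omega)"
      by (rule Lim_transform_eventually[OF tendsto_const]) (auto simp: g0_def eventually_at_filter)
    ultimately have "(g0 \<longlongrightarrow> 0) (at z within (Omega \<union> - Omega))"
      unfolding at_within_union by (rule filterlim_sup)
    then show ?thesis using False by (simp add: isCont_def g0_def)
  qed
qed

text \<open>\<open>g0\<close> itself grows like a logarithm, but the growth is the same for all
  translates. This makes increments admissible in the maximum principle on the unbounded half
  plane.\<close>

lemma g0_diff_at_infinity: "((\<lambda>z. g0 (z + a) - g0 (z + b)) \<longlongrightarrow> 0) at_infinity"
proof -
  have shift: "filterlim (\<lambda>z. z + c) at_infinity at_infinity" for c :: complex
    by (rule tendsto_add_filterlim_at_infinity'[OF filterlim_ident tendsto_const])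
  obtain b' where b': "0 < b'" "\<And>t. t \<in> E \<Longrightarrow> \<bar>t\<bar> < b'" using bounded_E by blast
  have "eventually (\<lambda>z. g z - (ln (norm z) - ln (log_capacity E)) = g0 z - ln (norm z) + ln (log_capacity E)) at_infinity"
    unfolding eventually_at_infinity
  proof (intro exI[of _ b'] allI impI)
    fix z :: complex assume z: "b' \<le> norm z"
    have "z \<in> Omega"
    proof
      assume "z \<in> complex_of_real ` E"
      then show False using b' z by force
    qed
    then show "g z - (ln (norm z) - ln (log_capacity E)) = g0 z - ln (norm z) + ln (log_capacity E)"
      by (simp add: g0_def)
  qed
  moreover have "((\<lambda>z. g z - (ln (norm z) - ln (log_capacity E))) \<longlongrightarrow> 0) at_infinity"
    using green by (simp add: is_green_function_def)
  ultimately have "((\<lambda>z. g0 z - ln (norm z) + ln (log_capacity E)) \<longlongrightarrow> 0) at_infinity"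
    by (rule Lim_transform_eventually[rotated])
  from filterlim_compose[OF this shift]
  have 1: "((\<lambda>z. g0 (z + c) - ln (norm (z + c)) + ln (log_capacity E)) \<longlongrightarrow> 0) at_infinity" for c .
  have 2: "((\<lambda>z. ln (norm (z + c)) - ln (norm z)) \<longlongrightarrow> 0) at_infinity" for c :: complex
  proof -
    have "((\<lambda>z. norm (1 + c / z)) \<longlongrightarrow> norm (1 + 0 :: complex)) at_infinity"
      by (intro tendsto_intros tendsto_divide_0[OF tendsto_const] filterlim_ident)
    then have "((\<lambda>z. ln (norm (1 + c / z))) \<longlongrightarrow> ln (norm (1 + 0 :: complex))) at_infinity"
      by (rule tendsto_ln) simp
    then have "((\<lambda>z. ln (norm (1 + c / z))) \<longlongrightarrow> 0) at_infinity" by simp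
    moreover have "eventually (\<lambda>z. ln (norm (1 + c / z)) = ln (norm (z + c)) - ln (norm z)) at_infinity"
      unfolding eventually_at_infinity
    proof (intro exI[of _ "norm c + 1"] allI impI)
      fix z :: complex assume z: "norm c + 1 \<le> norm z"
      then have z0: "z \<noteq> 0" using norm_ge_zero[of c] by (auto simp del: norm_ge_zero)
      have "z + c \<noteq> 0"
      proof
        assume "z + c = 0"
        then have "norm z = norm c" by (metis add_eq_0_iff2 norm_minus_cancel)
        then show False using z by simp
      qed
      moreover have "1 + c / z = (z + c) / z" using z0 by (simp add: field_simps)
      ultimately show "ln (norm (1 + c / z)) = ln (norm (z + c)) - ln (norm z)"
        using z0 by (simp add: norm_divide ln_div)
    qed
    ultimately show ?thesis by (rule Lim_transform_eventually)
  qed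
  have "((\<lambda>z. ((g0 (z + a) - ln (norm (z + a)) + ln (log_capacity E)) + (ln (norm (z + a)) - ln (norm z))) -
     ((g0 (z + b) - ln (norm (z + b)) + ln (log_capacity E)) + (ln (norm (z + b)) - ln (norm z)))) \<longlongrightarrow> (0 + 0) - (0 + 0)) at_infinity"
    by (intro tendsto_diff tendsto_add 1 2)
  then show ?thesis by simp
qed

end

section \<open>Variation on the real line\<close>

lemma sum_abs_diff_incseq:
  fixes \<phi> :: "real \<Rightarrow> real" and x :: "nat \<Rightarrow> real"
  assumes "mono \<phi>" "incseq x"
  shows "(\<Sum>i<n. \<bar>\<phi> (x (Suc i)) - \<phi> (x i)\<bar>) = \<phi> (x n) - \<phi> (x 0)"
proof -
  have "(\<Sum>i<n. \<bar>\<phi> (x (Suc i)) - \<phi> (x i)\<bar>) = (\<Sum>i<n. \<phi> (x (Suc i)) - \<phi> (x i))"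
    using assms by (intro sum.cong refl abs_of_nonneg) (simp add: monoD incseq_SucD)
  then show ?thesis using sum_lessThan_telescope[of "\<lambda>i. \<phi> (x i)" n] by simp
qed

text \<open>Splitting at the peak writes \<open>\<phi>\<close> as \<open>a - b - \<phi> c\<close>
  with \<open>a\<close> and \<open>b\<close> increasing. Since \<open>\<phi>\<close> is nonnegative,
  the rise and the fall each contribute at most \<open>\<phi> c\<close>.\<close>

lemma sum_abs_diff_unimodal:
  fixes \<phi> :: "real \<Rightarrow> real" and x :: "nat \<Rightarrow> real"
  assumes up: "\<And>x y. x \<le> y \<Longrightarrow> y \<le> c \<Longrightarrow> \<phi> x \<le> \<phi> y"
    and down: "\<And>x y. c \<le> x \<Longrightarrow> x \<le> y \<Longrightarrow> \<phi> y \<le> \<phi> x"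
    and nonneg: "\<And>x. 0 \<le> \<phi> x" and x: "incseq x"
  shows "(\<Sum>i<n. \<bar>\<phi> (x (Suc i)) - \<phi> (x i)\<bar>) \<le> 2 * \<phi> c"
proof -
  define a where "a y = \<phi> (min y c)" for y
  define b where "b y = - \<phi> (max y c)" for y
  have a: "mono a" unfolding a_def by (intro monoI up) auto
  have b: "mono b" unfolding b_def by (intro monoI) (auto intro!: down)
  have eq: "\<phi> y = a y - b y - \<phi> c" for y by (cases "y \<le> c") (auto simp: a_def b_def)
  have "(\<Sum>i<n. \<bar>\<phi> (x (Suc i)) - \<phi> (x i)\<bar>) \<le>
    (\<Sum>i<n. \<bar>a (x (Suc i)) - a (x i)\<bar> + \<bar>b (x (Suc i)) - b (x i)\<bar>)"
  proof (rule sum_mono)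
    fix i
    show "\<bar>\<phi> (x (Suc i)) - \<phi> (x i)\<bar> \<le> \<bar>a (x (Suc i)) - a (x i)\<bar> + \<bar>b (x (Suc i)) - b (x i)\<bar>"
      using eq[of "x (Suc i)"] eq[of "x i"] by linarith
  qed
  also have "\<dots> = (a (x n) - a (x 0)) + (b (x n) - b (x 0))"
    unfolding sum.distrib using sum_abs_diff_incseq[OF a x] sum_abs_diff_incseq[OF b x] by simp
  also have "\<dots> \<le> 2 * \<phi> c"
  proof -
    have "a (x n) \<le> \<phi> c" unfolding a_def by (intro up) auto
    moreover have "0 \<le> a (x 0)" "b (x n) \<le> 0" unfolding a_def b_def using nonneg by auto
    moreover have "- b (x 0) \<le> \<phi> c" unfolding b_def by (auto intro!: down)
    ultimately show ?thesis by linarith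
  qed
  finally show ?thesis .
qed

context green_equilibrium
begin

definition f :: "real \<Rightarrow> real" where "f x = g0 (of_real x)"

lemma of_real_in_Omega: "complex_of_real x \<in> Omega \<longleftrightarrow> x \<notin> E"
  by auto

lemma f_simps: "x \<in> E \<Longrightarrow> f x = 0" "x \<notin> E \<Longrightarrow> f x = pot (of_real x) + V"
  using green_eq_pot[of "of_real x"] by (auto simp: f_def g0_def)

lemma f_nonneg: "0 \<le> f x"
  by (simp add: f_def g0_nonneg)

lemma f_pos: "x \<notin> E \<Longrightarrow> 0 < f x"
  using green by (auto simp: f_def g0_def is_green_function_def)

lemma f_continuous: "continuous_on S f"
  unfolding f_def by (rule continuous_on_compose2[OF g0_continuous]) (auto intro!: continuous_intros)

lemma E_nonempty: "E \<noteq> {}"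
  using AE_support by auto

lemma Inf_Sup_E: "Inf E \<in> E" "Sup E \<in> E" "t \<in> E \<Longrightarrow> Inf E \<le> t" "t \<in> E \<Longrightarrow> t \<le> Sup E"
proof -
  have "bdd_below E" "bdd_above E"
    using compact_imp_bounded[OF compact] by (auto intro: bounded_imp_bdd_below bounded_imp_bdd_above)
  then show "Inf E \<in> E" "Sup E \<in> E" "t \<in> E \<Longrightarrow> Inf E \<le> t" "t \<in> E \<Longrightarrow> t \<le> Sup E"
    using E_nonempty compact_imp_closed[OF compact]
    by (auto intro: closed_contains_Inf closed_contains_Sup cInf_lower cSup_upper)
qed

text \<open>On an interval free of \<open>E\<close> every \<open>ln \<bar>w - t\<bar>\<close> with
  \<open>t\<close> in \<open>E\<close> is concave in \<open>w\<close>, hence so is their integral.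
  The weaker form with \<open>min\<close> is what unimodality on a gap rests on.\<close>

lemma f_quasiconcave:
  assumes E: "{x..y} \<inter> E = {}" and w: "x \<le> w" "w \<le> y"
  shows "min (f x) (f y) \<le> f w"
proof (cases "x = y")
  case True
  then show ?thesis using w by simp
next
  case False
  define u where "u = (w - x) / (y - x)"
  have xy: "x < y" using w False by simp
  have u: "0 \<le> u" "u \<le> 1" using w xy by (auto simp: u_def divide_simps)
  have wu: "w = (1 - u) * x + u * y"
  proof -
    have "u * (y - x) = w - x" using xy by (simp add: u_def)
    then show ?thesis by (simp add: algebra_simps)
  qed
  have nE: "x \<notin> E" "y \<notin> E" "w \<notin> E"
  proof -
    have "x \<in> {x..y}" "y \<in> {x..y}" "w \<in> {x..y}" using xy w by auto
    then show "x \<notin> E" "y \<notin> E" "w \<notin> E" using E by blast+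
  qed
  have int: "integrable \<mu> (\<lambda>t. ln \<bar>v - t\<bar>)" and pot: "pot (of_real v) = (\<integral>t. ln \<bar>v - t\<bar> \<partial>\<mu>)"
    if "v \<notin> E" for v
    using integrable_ln[OF of_real_in_Omega[THEN iffD2, OF that]] unfolding pot_def
    by (auto simp: of_real_diff[symmetric] simp del: of_real_diff)
  have "(\<integral>t. (1 - u) * ln \<bar>x - t\<bar> + u * ln \<bar>y - t\<bar> \<partial>\<mu>) \<le> (\<integral>t. ln \<bar>w - t\<bar> \<partial>\<mu>)"
  proof (rule integral_mono_AE)
    show "AE t in \<mu>. (1 - u) * ln \<bar>x - t\<bar> + u * ln \<bar>y - t\<bar> \<le> ln \<bar>w - t\<bar>"
      using AE_support
    proof eventually_elim
      case (elim t)
      then have "t < x \<or> y < t" using E by (metis IntI atLeastAtMost_iff empty_iff not_le)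
      then have pos: "0 < \<bar>x - t\<bar>" "0 < \<bar>y - t\<bar>"
        and eq: "\<bar>w - t\<bar> = (1 - u) * \<bar>x - t\<bar> + u * \<bar>y - t\<bar>"
        using xy w by (auto simp: wu algebra_simps)
      show ?case
        unfolding eq using concave_onD[OF ln_concave u, of "\<bar>x - t\<bar>" "\<bar>y - t\<bar>"] pos by simp
    qed
  qed (use int nE in auto)
  then have "(1 - u) * pot (of_real x) + u * pot (of_real y) \<le> pot (of_real w)"
    using int nE by (simp add: pot)
  then have "(1 - u) * f x + u * f y \<le> f w"
    using nE by (simp add: f_simps algebra_simps)
  moreover have "min (f x) (f y) \<le> (1 - u) * f x + u * f y"
  proof -
    have "(1 - u) * min (f x) (f y) + u * min (f x) (f y) \<le> (1 - u) * f x + u * f y"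
      using u by (intro add_mono mult_left_mono) auto
    then show ?thesis by (simp add: algebra_simps)
  qed
  ultimately show ?thesis by simp
qed

lemma pot_mono_norm:
  assumes "z \<in> Omega" "w \<in> Omega" "\<And>t. t \<in> E \<Longrightarrow> norm (z - of_real t) \<le> norm (w - of_real t)"
  shows "pot z \<le> pot w"
  unfolding pot_def
proof (rule integral_mono_AE)
  show "AE t in \<mu>. ln (norm (z - of_real t)) \<le> ln (norm (w - of_real t))"
    using AE_support
  proof eventually_elim
    case (elim t)
    then have "0 < norm (z - of_real t)" using assms(1) by auto
    then show ?case using assms(3)[OF elim] by (intro ln_mono)
  qed
qed (use assms integrable_ln in auto)

lemma pot_translate_le:
  assumes z: "z \<in> Omega" "z + of_real W \<in> Omega" "\<And>t. t \<in> E \<Longrightarrow> 1 \<le> norm (z - of_real t)"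
  shows "pot (z + of_real W) \<le> pot z + \<bar>W\<bar>"
proof -
  have "pot (z + of_real W) \<le> (\<integral>t. ln (norm (z - of_real t)) + \<bar>W\<bar> \<partial>\<mu>)"
    unfolding pot_def
  proof (rule integral_mono_AE)
    show "AE t in \<mu>. ln (norm (z + of_real W - of_real t)) \<le> ln (norm (z - of_real t)) + \<bar>W\<bar>"
      using AE_support
    proof eventually_elim
      case (elim t)
      let ?n = "norm (z - of_real t)"
      have n: "1 \<le> ?n" using z(3)[OF elim] .
      have pos: "0 < norm (z + of_real W - of_real t)" using z(2) elim by auto
      have "norm (z + of_real W - of_real t) \<le> ?n + \<bar>W\<bar>"
        using norm_triangle_ineq[of "z - of_real t" "of_real W"] by (simp add: algebra_simps)
      also have "\<dots> \<le> ?n * (1 + \<bar>W\<bar>)" using mult_right_mono[OF n, of "\<bar>W\<bar>"] by (simp add: algebra_simps)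
      finally have "ln (norm (z + of_real W - of_real t)) \<le> ln (?n * (1 + \<bar>W\<bar>))"
        using pos by (intro ln_mono)
      also have "\<dots> = ln ?n + ln (1 + \<bar>W\<bar>)" using n by (subst ln_mult) auto
      also have "\<dots> \<le> ln ?n + \<bar>W\<bar>" by (simp add: ln_add_one_self_le_self)
      finally show ?case .
    qed
  qed (use z integrable_ln in auto)
  also have "\<dots> = pot z + \<bar>W\<bar>"
    unfolding pot_def using z integrable_ln by (simp add: prob_space)
  finally show ?thesis .
qed

text \<open>\<open>critical_point\<close> is a choice by \<open>arg_max\<close>, so a maximiser
  inside the gap has to be exhibited first. One exists on the closure of \<open>G\<close>; its value
  is positive, which keeps it off \<open>E\<close>, and a component is closed in the set it belongs
  to, which puts it back into \<open>G\<close>.\<close>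

lemma gap_properties:
  assumes G: "G \<in> gaps E"
  shows "G \<inter> E = {}" and "G \<subseteq> {Inf E..Sup E}" and "critical_point g G \<in> G"
    and "\<And>x. x \<in> G \<Longrightarrow> f x \<le> f (critical_point g G)"
    and "\<And>x y. x \<in> G \<Longrightarrow> y \<in> G \<Longrightarrow> {x..y} \<subseteq> G"
proof -
  let ?A = "{Inf E..Sup E} - E"
  have sub: "G \<subseteq> ?A" using G unfolding gaps_def by (rule in_components_subset)
  then show GE: "G \<inter> E = {}" and G2: "G \<subseteq> {Inf E..Sup E}" by auto
  have fg: "f x = g (of_real x)" if "x \<in> G" for x using that GE by (auto simp: f_def g0_def)
  show ivl: "{x..y} \<subseteq> G" if "x \<in> G" "y \<in> G" for x y
    using in_components_connected[of G ?A] G that connected_contains_Icc unfolding gaps_def by blast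
  have "compact (closure G)" using G2 by (meson bounded_closed_interval bounded_subset compact_closure)
  obtain x0 where x0: "x0 \<in> G" using in_components_nonempty[of G ?A] G unfolding gaps_def by auto
  obtain c where c: "c \<in> closure G" "\<And>x. x \<in> closure G \<Longrightarrow> f x \<le> f c"
    using continuous_attains_sup[OF \<open>compact (closure G)\<close> _ f_continuous] x0 closure_subset by blast
  have "0 < f x0" using x0 GE by (intro f_pos) auto
  also have "f x0 \<le> f c" using x0 by (intro c(2) subsetD[OF closure_subset])
  finally have "c \<notin> E" using f_simps(1)[of c] by auto
  moreover have "c \<in> {Inf E..Sup E}" using c(1) closure_minimal[OF G2] by auto
  ultimately have "c \<in> ?A" by simp
  moreover have "closedin (top_of_set ?A) G" using G unfolding gaps_def by (rule closedin_component)
  then obtain T where T: "closed T" "G = ?A \<inter> T" unfolding closedin_closed by blast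
  then have "closure G \<subseteq> T" by (intro closure_minimal) auto
  ultimately have "c \<in> G" using c(1) T(2) by blast
  then have "is_arg_max (\<lambda>x. g (of_real x)) (\<lambda>x. x \<in> G) c"
    using c(2) closure_subset[of G] by (auto simp: is_arg_max_def fg[symmetric] not_less)
  then have "is_arg_max (\<lambda>x. g (of_real x)) (\<lambda>x. x \<in> G) (critical_point g G)"
    unfolding critical_point_def arg_max_on_def arg_max_def by (rule someI)
  then show cG: "critical_point g G \<in> G" and "\<And>x. x \<in> G \<Longrightarrow> f x \<le> f (critical_point g G)"
    using fg by (auto simp: is_arg_max_def not_less)
qed

text \<open>Cut off by 0 outside the gap, \<open>f\<close> increases up to the critical point and
  decreases after it, by quasiconcavity between the critical point and any other point of the
  gap.\<close>

lemma gap_variation: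
  assumes G: "G \<in> gaps E" and x: "incseq x"
  defines "\<phi> \<equiv> \<lambda>x. if x \<in> G then f x else 0"
  shows "(\<Sum>i<n. \<bar>\<phi> (x (Suc i)) - \<phi> (x i)\<bar>) \<le> 2 * g (of_real (critical_point g G))"
proof -
  let ?c = "critical_point g G"
  note gp = gap_properties[OF G]
  have "(\<Sum>i<n. \<bar>\<phi> (x (Suc i)) - \<phi> (x i)\<bar>) \<le> 2 * \<phi> ?c"
  proof (rule sum_abs_diff_unimodal[OF _ _ _ x])
    show "\<phi> x \<le> \<phi> y" if xy: "x \<le> y" "y \<le> ?c" for x y
    proof (cases "x \<in> G")
      case True
      have sub: "{x..?c} \<subseteq> G" using gp(5)[OF True gp(3)] .
      then have "min (f x) (f ?c) \<le> f y" using xy gp(1) by (intro f_quasiconcave) auto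
      moreover have "f x \<le> f ?c" by (rule gp(4)[OF True])
      moreover have "y \<in> G" using sub xy by auto
      ultimately show ?thesis using True by (simp add: \<phi>_def)
    qed (auto simp: \<phi>_def f_nonneg)
    show "\<phi> y \<le> \<phi> x" if xy: "?c \<le> x" "x \<le> y" for x y
    proof (cases "y \<in> G")
      case True
      have sub: "{?c..y} \<subseteq> G" using gp(5)[OF gp(3) True] .
      then have "min (f ?c) (f y) \<le> f x" using xy gp(1) by (intro f_quasiconcave) auto
      moreover have "f y \<le> f ?c" by (rule gp(4)[OF True])
      moreover have "x \<in> G" using sub xy by auto
      ultimately show ?thesis using True by (simp add: \<phi>_def)
    qed (auto simp: \<phi>_def f_nonneg)
  qed (auto simp: \<phi>_def f_nonneg)
  also have "\<phi> ?c = g (of_real ?c)"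
    using gp(1,3) by (auto simp: \<phi>_def f_def g0_def)
  finally show ?thesis .
qed

text \<open>The parts of \<open>f\<close> on the two unbounded complementary intervals. They are
  monotone but unbounded, and the sum over the gaps does not see them.\<close>

definition f_right :: "real \<Rightarrow> real" where "f_right x = (if Sup E \<le> x then f x else 0)"
definition f_left :: "real \<Rightarrow> real" where "f_left x = (if x \<le> Inf E then f x else 0)"

lemma f_right_mono: "mono f_right"
proof (rule monoI)
  fix x y :: real assume xy: "x \<le> y"
  show "f_right x \<le> f_right y"
  proof (cases "Sup E < x")
    case True
    have nE: "x \<notin> E" "y \<notin> E" using True xy Inf_Sup_E(4) by fastforce+
    have "pot (of_real x) \<le> pot (of_real y)"
      using nE True xy Inf_Sup_E(4)
      by (intro pot_mono_norm) (auto simp: of_real_diff[symmetric] simp del: of_real_diff, force)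
    then show ?thesis using True xy nE by (simp add: f_right_def f_simps)
  next
    case False
    then have "f_right x = 0" using f_simps(1)[OF Inf_Sup_E(2)] by (auto simp: f_right_def)
    then show ?thesis by (simp add: f_right_def f_nonneg)
  qed
qed

lemma f_left_antimono: "mono (\<lambda>x. - f_left x)"
proof (rule monoI)
  fix x y :: real assume xy: "x \<le> y"
  show "- f_left x \<le> - f_left y"
  proof (cases "y < Inf E")
    case True
    have nE: "x \<notin> E" "y \<notin> E" using True xy Inf_Sup_E(3) by fastforce+
    have "pot (of_real y) \<le> pot (of_real x)"
      using nE True xy Inf_Sup_E(3)
      by (intro pot_mono_norm) (auto simp: of_real_diff[symmetric] simp del: of_real_diff, force)
    then show ?thesis using True xy nE by (simp add: f_left_def f_simps)
  next
    case False
    then have "f_left y = 0" using f_simps(1)[OF Inf_Sup_E(1)] by (auto simp: f_left_def)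
    then show ?thesis by (simp add: f_left_def f_nonneg)
  qed
qed

text \<open>Within distance 1 of the hull of \<open>E\<close> monotonicity bounds the increment by a
  fixed value; further out a shift by \<open>W\<close> costs at most \<open>W\<close>. The bound
  must not depend on the position of the window, because \<open>variation_upper\<close> slides the
  window along the whole line.\<close>

lemma f_outer_increment:
  assumes W: "0 \<le> W"
  obtains C where "0 \<le> C" "\<And>x y. y \<le> x + W \<Longrightarrow> f_right y - f_right x \<le> C"
    "\<And>x y. y \<le> x + W \<Longrightarrow> f_left x - f_left y \<le> C"
proof -
  have nonneg: "0 \<le> f_right x" "0 \<le> f_left x" for x
    by (auto simp: f_right_def f_left_def f_nonneg)
  have r: "f_right y - f_right x \<le> f_right (Sup E + 1 + W) + W" if y: "y \<le> x + W" for x y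
  proof -
    have y': "f_right y \<le> f_right (x + W)" using monoD[OF f_right_mono y] .
    show ?thesis
    proof (cases "x \<le> Sup E + 1")
      case True
      then have "f_right (x + W) \<le> f_right (Sup E + 1 + W)" by (intro monoD[OF f_right_mono]) simp
      then show ?thesis using y' nonneg(1)[of x] W by simp
    next
      case False
      have nE: "x \<notin> E" "x + W \<notin> E" using False W Inf_Sup_E(4) by fastforce+
      have "pot (of_real x + of_real W) \<le> pot (of_real x) + \<bar>W\<bar>"
      proof (rule pot_translate_le)
        show "1 \<le> norm (complex_of_real x - of_real t)" if "t \<in> E" for t
          using Inf_Sup_E(4)[OF that] False unfolding of_real_diff[symmetric] norm_of_real by simp
      qed (use nE in \<open>auto simp: of_real_add[symmetric] simp del: of_real_add\<close>)
      then have "f_right (x + W) \<le> f_right x + W"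
        using nE False W by (simp add: f_right_def f_simps)
      then show ?thesis using y' nonneg(1)[of "Sup E + 1 + W"] by simp
    qed
  qed
  have l: "f_left x - f_left y \<le> f_left (Inf E - 1 - W) + W" if y: "y \<le> x + W" for x y
  proof -
    have y': "f_left x \<le> f_left (y - W)" using monoD[OF f_left_antimono, of "y - W" x] y by simp
    show ?thesis
    proof (cases "Inf E - 1 \<le> y")
      case True
      then have "f_left (y - W) \<le> f_left (Inf E - 1 - W)"
        using monoD[OF f_left_antimono, of "Inf E - 1 - W" "y - W"] by simp
      then show ?thesis using y' nonneg(2)[of y] W by simp
    next
      case False
      have nE: "y \<notin> E" "y - W \<notin> E" using False W Inf_Sup_E(3) by fastforce+
      have "pot (of_real y + of_real (- W)) \<le> pot (of_real y) + \<bar>- W\<bar>"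
      proof (rule pot_translate_le)
        show "1 \<le> norm (complex_of_real y - of_real t)" if "t \<in> E" for t
          using Inf_Sup_E(3)[OF that] False unfolding of_real_diff[symmetric] norm_of_real by simp
      qed (use nE in \<open>auto simp: of_real_diff[symmetric] simp del: of_real_diff\<close>)
      then have "f_left (y - W) \<le> f_left y + W"
        using nE False W by (simp add: f_left_def f_simps)
      then show ?thesis using y' nonneg(2)[of "Inf E - 1 - W"] by simp
    qed
  qed
  define C where "C = max (f_right (Sup E + 1 + W) + W) (f_left (Inf E - 1 - W) + W)"
  show ?thesis
  proof (rule that[of C])
    show "0 \<le> C" unfolding C_def using nonneg W by (simp add: le_max_iff_disj add_nonneg_nonneg)
    show "f_right y - f_right x \<le> C" if "y \<le> x + W" for x y
      using r[OF that] by (simp add: C_def)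
    show "f_left x - f_left y \<le> C" if "y \<le> x + W" for x y
      using l[OF that] by (simp add: C_def)
  qed
qed

end

context green_equilibrium begin

text \<open>Distinct gaps are disjoint, so a point meets at most one of them and any finite family
  containing its gap suffices. \<open>f_left\<close> is written as \<open>- (- f_left y)\<close>
  because \<open>- f_left\<close> is the increasing function.\<close>

lemma f_decomposition:
  assumes J: "finite J" "J \<subseteq> gaps E" and y: "y \<in> {Inf E..Sup E} - E \<Longrightarrow> connected_component_set ({Inf E..Sup E} - E) y \<in> J"
  shows "f y = f_right y - (- f_left y) + (\<Sum>G\<in>J. if y \<in> G then f y else 0)"
proof (cases "y \<in> {Inf E..Sup E} - E")
  case False
  have "y \<notin> G" if "G \<in> J" for G
  proof
    assume "y \<in> G"
    have "G \<in> gaps E" using that J(2) by (rule subsetD[rotated])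
    from gap_properties(1,2)[OF this] have "y \<in> {Inf E..Sup E} - E"
      using \<open>y \<in> G\<close> by auto
    then show False using False by simp
  qed
  then have s: "(\<Sum>G\<in>J. if y \<in> G then f y else 0) = 0" by (intro sum.neutral) simp
  show ?thesis
  proof (cases "y \<in> E")
    case True
    then show ?thesis using s f_simps(1) by (simp add: f_right_def f_left_def)
  next
    case nE: False
    then have "y < Inf E \<or> Sup E < y" using False by auto
    moreover have "Inf E \<le> Sup E" using Inf_Sup_E by blast
    ultimately show ?thesis using s by (auto simp: f_right_def f_left_def)
  qed
next
  case True
  let ?G = "connected_component_set ({Inf E..Sup E} - E) y"
  have yG: "y \<in> ?G" using True by simp
  have "y \<notin> G" if "G \<in> J - {?G}" for G
  proof
    assume "y \<in> G"
    have "G \<in> components ({Inf E..Sup E} - E)" "?G \<in> components ({Inf E..Sup E} - E)"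
      using that J(2) y[OF True] by (auto simp: gaps_def)
    from components_nonoverlap[OF this] show False using that \<open>y \<in> G\<close> yG by blast
  qed
  then have "(\<Sum>G\<in>J - {?G}. if y \<in> G then f y else 0) = 0" by (intro sum.neutral) auto
  then have "(\<Sum>G\<in>J. if y \<in> G then f y else 0) = f y"
    unfolding sum.remove[OF J(1) y[OF True]] using yG by (simp only: if_True add_0_right)
  moreover have "y \<noteq> Inf E" "y \<noteq> Sup E" using True Inf_Sup_E by auto
  ultimately show ?thesis using True by (simp add: f_right_def f_left_def)
qed

text \<open>Finitely many sample points meet only finitely many gaps. Each gap contributes at most
  twice its maximum and each outer interval at most \<open>C\<close>, so the total depends on
  \<open>W\<close> alone and not on the sample or its location.\<close>

lemma f_variation:
  assumes W: "0 \<le> W"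
    and summ: "(\<lambda>G. g (of_real (critical_point g G))) summable_on gaps E"
  obtains C where "0 \<le> C"
    "\<And>x n. incseq x \<Longrightarrow> x n \<le> x 0 + W \<Longrightarrow> (\<Sum>i<n. \<bar>f (x (Suc i)) - f (x i)\<bar>) \<le> C"
proof -
  obtain C where C: "0 \<le> C" "\<And>x y. y \<le> x + W \<Longrightarrow> f_right y - f_right x \<le> C"
    "\<And>x y. y \<le> x + W \<Longrightarrow> f_left x - f_left y \<le> C"
    using f_outer_increment[OF W] by blast
  let ?m = "\<lambda>G. g (of_real (critical_point g G))"
  let ?A = "{Inf E..Sup E} - E"
  have m_nonneg: "0 \<le> ?m G" if "G \<in> gaps E" for G
  proof -
    have "critical_point g G \<notin> E" using gap_properties(1,3)[OF that] by blast
    then have "f (critical_point g G) = g (of_real (critical_point g G))" by (auto simp: f_def g0_def)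
    then show ?thesis by (metis f_nonneg)
  qed
  show ?thesis
  proof (rule that[of "2 * C + 2 * infsum ?m (gaps E)"])
    have "0 \<le> infsum ?m (gaps E)" using m_nonneg by (rule infsum_nonneg)
    then show "0 \<le> 2 * C + 2 * infsum ?m (gaps E)" using C(1) by simp
    fix x :: "nat \<Rightarrow> real" and n assume x: "incseq x" "x n \<le> x 0 + W"
    define J where "J = connected_component_set ?A ` (x ` {..n} \<inter> ?A)"
    have J: "finite J" "J \<subseteq> gaps E"
      unfolding J_def gaps_def components_def by auto
    define \<phi> where "\<phi> G y = (if y \<in> G then f y else 0)" for G y
    have dec: "f (x i) = f_right (x i) - (- f_left (x i)) + (\<Sum>G\<in>J. \<phi> G (x i))" if "i \<le> n" for i
      unfolding \<phi>_def using that by (intro f_decomposition J) (auto simp: J_def)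
    have "(\<Sum>i<n. \<bar>f (x (Suc i)) - f (x i)\<bar>) \<le>
      (\<Sum>i<n. \<bar>f_right (x (Suc i)) - f_right (x i)\<bar> + \<bar>(- f_left (x (Suc i))) - (- f_left (x i))\<bar>
         + (\<Sum>G\<in>J. \<bar>\<phi> G (x (Suc i)) - \<phi> G (x i)\<bar>))"
    proof (rule sum_mono)
      fix i assume i: "i \<in> {..<n}"
      have "f (x (Suc i)) - f (x i) = (f_right (x (Suc i)) - f_right (x i)) - ((- f_left (x (Suc i))) - (- f_left (x i)))
         + (\<Sum>G\<in>J. \<phi> G (x (Suc i)) - \<phi> G (x i))"
        using dec[of i] dec[of "Suc i"] i by (simp add: sum_subtractf)
      moreover have "\<bar>\<Sum>G\<in>J. \<phi> G (x (Suc i)) - \<phi> G (x i)\<bar> \<le> (\<Sum>G\<in>J. \<bar>\<phi> G (x (Suc i)) - \<phi> G (x i)\<bar>)"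
        by (rule sum_abs)
      ultimately show "\<bar>f (x (Suc i)) - f (x i)\<bar> \<le> \<bar>f_right (x (Suc i)) - f_right (x i)\<bar> + \<bar>(- f_left (x (Suc i))) - (- f_left (x i))\<bar>
         + (\<Sum>G\<in>J. \<bar>\<phi> G (x (Suc i)) - \<phi> G (x i)\<bar>)" by linarith
    qed
    also have "\<dots> = (f_right (x n) - f_right (x 0)) + ((- f_left (x n)) - (- f_left (x 0)))
        + (\<Sum>G\<in>J. \<Sum>i<n. \<bar>\<phi> G (x (Suc i)) - \<phi> G (x i)\<bar>)"
      unfolding sum.distrib sum_abs_diff_incseq[OF f_right_mono x(1)] sum_abs_diff_incseq[OF f_left_antimono x(1)]
      by (subst sum.swap) (rule refl)
    also have "\<dots> \<le> C + C + (\<Sum>G\<in>J. 2 * ?m G)"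
    proof (intro add_mono sum_mono)
      show "f_right (x n) - f_right (x 0) \<le> C" using C(2) x(2) by blast
      show "(- f_left (x n)) - (- f_left (x 0)) \<le> C" using C(3) x(2) by simp
      show "(\<Sum>i<n. \<bar>\<phi> G (x (Suc i)) - \<phi> G (x i)\<bar>) \<le> 2 * ?m G" if "G \<in> J" for G
        unfolding \<phi>_def using that J(2) by (intro gap_variation x) auto
    qed
    also have "\<dots> = 2 * C + 2 * (\<Sum>G\<in>J. ?m G)" by (simp add: sum_distrib_left)
    also have "\<dots> \<le> 2 * C + 2 * infsum ?m (gaps E)"
      using finite_sum_le_infsum[OF summ J] m_nonneg by auto
    finally show "(\<Sum>i<n. \<bar>f (x (Suc i)) - f (x i)\<bar>) \<le> 2 * C + 2 * infsum ?m (gaps E)" .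
  qed
qed

end

section \<open>The integral of G Ln G on horizontal lines\<close>

text \<open>On a partition finer than the modulus of continuity of \<open>v\<close> for
  \<open>e\<close>, the mean value theorem turns each increment into \<open>v w\<close> times the
  length of the piece, and \<open>\<bar>v\<bar>\<close> stays below
  \<open>\<bar>v w\<bar> + e\<close> there. The errors add up to
  \<open>e' = e * (b - a)\<close>.\<close>

lemma integral_abs_deriv_le_variation:
  fixes \<phi> v :: "real \<Rightarrow> real"
  assumes ab: "a < b" and v: "continuous_on {a..b} v"
    and \<phi>: "\<And>x. x \<in> {a..b} \<Longrightarrow> (\<phi> has_real_derivative v x) (at x)"
    and var: "\<And>x n. incseq x \<Longrightarrow> x 0 = a \<Longrightarrow> x n = b \<Longrightarrow> (\<Sum>i<n. \<bar>\<phi> (x (Suc i)) - \<phi> (x i)\<bar>) \<le> C"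
  shows "integral {a..b} (\<lambda>x. \<bar>v x\<bar>) \<le> C"
proof (rule field_le_epsilon)
  fix e' :: real assume "0 < e'"
  define e where "e = e' / (b - a)"
  have e: "0 < e" "e * (b - a) = e'" using \<open>0 < e'\<close> ab by (auto simp: e_def)
  have "uniformly_continuous_on {a..b} v" using v by (intro compact_uniformly_continuous) auto
  then obtain d where d: "0 < d" "\<And>x y. x \<in> {a..b} \<Longrightarrow> y \<in> {a..b} \<Longrightarrow> dist y x < d \<Longrightarrow> dist (v y) (v x) < e"
    unfolding uniformly_continuous_on_def using e(1) by metis
  obtain n where n: "(b - a) / d < real n" using reals_Archimedean2 by blast
  have "0 < (b - a) / d" using ab d by simp
  then have n0: "0 < real n" using n by linarith
  define x where "x i = a + real i * ((b - a) / n)" for i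
  have step: "0 < (b - a) / n" "(b - a) / n < d"
    using ab d n n0 by (auto simp: field_simps)
  have xs: "x (Suc i) = x i + (b - a) / n" for i by (simp add: x_def distrib_right add_divide_distrib)
  have x: "incseq x" "x 0 = a" "x n = b"
  proof -
    show "incseq x" using step(1) xs by (intro incseq_SucI) simp
    show "x 0 = a" "x n = b" using n0 by (simp_all add: x_def)
  qed
  have int: "(\<lambda>x. \<bar>v x\<bar>) integrable_on {c..d}" if "{c..d} \<subseteq> {a..b}" for c d
    using that by (intro integrable_continuous_interval continuous_intros continuous_on_subset[OF v])
  have piece: "integral {x i..x (Suc i)} (\<lambda>x. \<bar>v x\<bar>) \<le> \<bar>\<phi> (x (Suc i)) - \<phi> (x i)\<bar> + e * (x (Suc i) - x i)"
    if i: "i < n" for i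
  proof -
    have xx: "x i < x (Suc i)" "x (Suc i) - x i < d" using step unfolding xs by simp_all
    have "x 0 \<le> x i" "x (Suc i) \<le> x n" using x(1) i by (auto intro: incseqD)
    then have sub: "{x i..x (Suc i)} \<subseteq> {a..b}" using x by auto
    obtain w where w: "x i < w" "w < x (Suc i)" "\<phi> (x (Suc i)) - \<phi> (x i) = (x (Suc i) - x i) * v w"
      using MVT2[OF xx(1), of \<phi> v] \<phi> sub by (metis atLeastAtMost_iff subsetD)
    have "integral {x i..x (Suc i)} (\<lambda>x. \<bar>v x\<bar>) \<le> integral {x i..x (Suc i)} (\<lambda>x. \<bar>v w\<bar> + e)"
    proof (rule integral_le)
      show "(\<lambda>x. \<bar>v x\<bar>) integrable_on {x i..x (Suc i)}" using sub by (rule int)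
      fix y assume y: "y \<in> {x i..x (Suc i)}"
      then have "dist y w < d" using w xx by (auto simp: dist_real_def)
      then have "dist (v y) (v w) < e" using y w sub by (intro d(2)) auto
      then show "\<bar>v y\<bar> \<le> \<bar>v w\<bar> + e" by (simp add: dist_real_def)
    qed auto
    also have "\<dots> = (x (Suc i) - x i) * (\<bar>v w\<bar> + e)" using xx by simp
    also have "\<dots> = \<bar>\<phi> (x (Suc i)) - \<phi> (x i)\<bar> + e * (x (Suc i) - x i)"
    proof -
      have "\<bar>x (Suc i) - x i\<bar> = x (Suc i) - x i" using xx by simp
      then show ?thesis unfolding w(3) abs_mult by (simp only: distrib_right mult.commute)
    qed
    finally show ?thesis .
  qed
  have "integral {x 0..x m} (\<lambda>x. \<bar>v x\<bar>) \<le> (\<Sum>i<m. \<bar>\<phi> (x (Suc i)) - \<phi> (x i)\<bar>) + e * (x m - x 0)"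
    if "m \<le> n" for m
    using that
  proof (induction m)
    case 0
    then show ?case by simp
  next
    case (Suc m)
    have le: "x 0 \<le> x m" "x m \<le> x (Suc m)" "x (Suc m) \<le> x n" using x(1) Suc.prems by (auto intro: incseqD)
    then have "integral {x 0..x (Suc m)} (\<lambda>x. \<bar>v x\<bar>) =
        integral {x 0..x m} (\<lambda>x. \<bar>v x\<bar>) + integral {x m..x (Suc m)} (\<lambda>x. \<bar>v x\<bar>)"
      using x by (intro Henstock_Kurzweil_Integration.integral_combine[symmetric] int) auto
    also have "\<dots> \<le> ((\<Sum>i<m. \<bar>\<phi> (x (Suc i)) - \<phi> (x i)\<bar>) + e * (x m - x 0)) +
        (\<bar>\<phi> (x (Suc m)) - \<phi> (x m)\<bar> + e * (x (Suc m) - x m))"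
      using Suc.IH Suc.prems piece[of m] by (intro add_mono) auto
    finally show ?case by (simp add: algebra_simps)
  qed
  from this[of n] have "integral {a..b} (\<lambda>x. \<bar>v x\<bar>) \<le> (\<Sum>i<n. \<bar>\<phi> (x (Suc i)) - \<phi> (x i)\<bar>) + e'"
    using x e by simp
  also have "\<dots> \<le> C + e'" using var[OF x] by simp
  finally show "integral {a..b} (\<lambda>x. \<bar>v x\<bar>) \<le> C + e'" .
qed

lemma has_vector_derivative_Complex_line:
  "((\<lambda>x. Complex x d) has_vector_derivative 1) (at x within S)"
proof -
  have "((\<lambda>x. complex_of_real x + Complex 0 d) has_vector_derivative 1) (at x within S)"
    unfolding has_vector_derivative_def
    by (rule has_derivative_eq_rhs[OF has_derivative_add[OF has_derivative_of_real[OF has_derivative_ident] has_derivative_const]])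
       (simp add: fun_eq_iff scaleR_conv_of_real)
  also have "(\<lambda>x. complex_of_real x + Complex 0 d) = (\<lambda>x. Complex x d)"
    by (simp add: fun_eq_iff complex_eq_iff)
  finally show ?thesis .
qed

lemma continuous_on_Complex_line: "continuous_on S (\<lambda>x. Complex x d)"
  by (intro continuous_at_imp_continuous_on ballI
      has_vector_derivative_continuous[OF has_vector_derivative_Complex_line])

context compact_prob_space
begin

lemma upper_half_plane_subset: "{z. 0 < Im z} \<subseteq> Omega"
  by auto

text \<open>\<open>Re (\<i> * cau z) = - Im (cau z)\<close> is positive, so the values stay away
  from the branch cut of \<open>Ln\<close>.\<close>

lemma Ln_cau_holomorphic: "(\<lambda>z. \<i> * cau z * Ln (\<i> * cau z)) holomorphic_on {z. 0 < Im z}"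
proof -
  have c: "cau holomorphic_on {z. 0 < Im z}"
    using cau_holomorphic upper_half_plane_subset by (rule holomorphic_on_subset)
  have "\<i> * cau z \<notin> \<real>\<^sub>\<le>\<^sub>0" if "0 < Im z" for z
    using Im_cau_neg[OF that] by (auto simp: complex_nonpos_Reals_iff)
  then show ?thesis using c by (auto intro!: holomorphic_intros)
qed

text \<open>For \<open>norm w\<close> at most 1, \<open>norm w * \<bar>ln (norm w)\<bar>\<close> is
  at most 1; the argument of \<open>w\<close> is at most \<open>pi / 2\<close> in size because
  \<open>w\<close> lies in the right half plane.\<close>

lemma norm_Ln_cau_le:
  assumes z: "0 < Im z" and c: "norm (cau z) \<le> 1"
  shows "norm (\<i> * cau z * Ln (\<i> * cau z)) \<le> 1 + pi / 2"
proof -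
  define w where "w = \<i> * cau z"
  have w: "w \<noteq> 0" "0 < Re w" "0 < norm w" "norm w \<le> 1"
    using Im_cau_neg[OF z] c by (auto simp: w_def norm_mult)
  have "norm (Ln w) \<le> \<bar>Re (Ln w)\<bar> + \<bar>Im (Ln w)\<bar>" by (rule cmod_le)
  also have "\<dots> \<le> \<bar>ln (norm w)\<bar> + pi / 2"
    using Re_Ln_pos_lt[OF w(1)] w by simp
  finally have "norm w * norm (Ln w) \<le> norm w * (\<bar>ln (norm w)\<bar> + pi / 2)"
    by (intro mult_left_mono) auto
  also have "\<dots> = norm w * - ln (norm w) + norm w * (pi / 2)"
    using w by (simp add: algebra_simps)
  also have "norm w * - ln (norm w) \<le> norm w * (1 / norm w - 1)"
    using ln_le_minus_one[of "1 / norm w"] w by (intro mult_left_mono) (auto simp: ln_div)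
  also have "\<dots> \<le> 1" using w by (simp add: algebra_simps)
  also have "norm w * (pi / 2) \<le> 1 * (pi / 2)" using w by (intro mult_right_mono) auto
  finally show ?thesis by (simp add: norm_mult w_def)
qed

end

context compact_prob_space begin

text \<open>Cauchy's theorem moves the integral of \<open>G Ln G\<close>, where \<open>G = \<i> cau\<close> has positive real part, to the
  other three sides of a rectangle, which stay away from \<open>E\<close>.\<close>

lemma integral_Re_Ln_cau:
  assumes R: "1 \<le> R" "\<And>t. t \<in> E \<Longrightarrow> \<bar>t\<bar> \<le> R - 1" and d: "0 < d" "d \<le> 1"
  shows "(\<lambda>x. Re (\<i> * cau (Complex x d) * Ln (\<i> * cau (Complex x d)))) integrable_on {-R..R}"
    and "integral {-R..R} (\<lambda>x. Re (\<i> * cau (Complex x d) * Ln (\<i> * cau (Complex x d)))) \<le> (2 + 2 * R) * (1 + pi / 2)"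
proof -
  define H where "H = {z. 0 < Im z}"
  define F where "F z = \<i> * cau z * Ln (\<i> * cau z)" for z
  have H: "convex H" "open H" by (simp_all add: H_def convex_halfspace_Im_gt open_halfspace_Im_gt)
  \<comment> \<open>A primitive on the convex half plane takes the place of contour integrals: the
    integral along a side is a difference of values of \<open>P\<close>.\<close>
  obtain P where P: "\<And>z. z \<in> H \<Longrightarrow> (P has_field_derivative F z) (at z within H)"
    using holomorphic_convex_primitive'[OF H, of F] Ln_cau_holomorphic unfolding H_def F_def by blast
  then have P: "(P has_field_derivative F z) (at z)" if "z \<in> H" for z
    using that H(2) by (metis at_within_open)
  \<comment> \<open>On the top and on the vertical sides the distance to \<open>E\<close> is at
    least 1, by the margin in \<open>\<bar>t\<bar> \<le> R - 1\<close>; this gives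
    \<open>norm (cau z) \<le> 1\<close>.\<close>
  have far: "norm (F z) \<le> 1 + pi / 2" if "z \<in> H" "1 \<le> Im z \<or> \<bar>Re z\<bar> = R" for z
  proof -
    have "1 \<le> norm (z - of_real t)" if t: "t \<in> E" for t
      using \<open>1 \<le> Im z \<or> \<bar>Re z\<bar> = R\<close>
    proof
      assume "1 \<le> Im z"
      then show ?thesis using abs_Im_le_cmod[of "z - of_real t"] by simp
    next
      assume "\<bar>Re z\<bar> = R"
      then show ?thesis using abs_Re_le_cmod[of "z - of_real t"] R(2)[OF t] by simp
    qed
    then have "norm (cau z) \<le> 1" using norm_cau_le[of 1 z] by simp
    then show ?thesis using that(1) norm_Ln_cau_le by (simp add: F_def H_def)
  qed
  have seg: "norm (P a - P b) \<le> (1 + pi / 2) * norm (a - b)"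
    if "closed_segment a b \<subseteq> {z. z \<in> H \<and> (1 \<le> Im z \<or> \<bar>Re z\<bar> = R)}" for a b
  proof (rule field_differentiable_bound[OF convex_closed_segment[of a b]])
    fix z assume "z \<in> closed_segment a b"
    then have z: "z \<in> H" "1 \<le> Im z \<or> \<bar>Re z\<bar> = R" using that by auto
    show "(P has_field_derivative F z) (at z within closed_segment a b)"
      using P[OF z(1)] by (rule has_field_derivative_at_within)
    show "norm (F z) \<le> 1 + pi / 2" using far z by blast
  qed auto
  have side: "norm (P (Complex x d) - P (Complex x 1)) \<le> (1 + pi / 2) * (1 - d)" if x: "\<bar>x\<bar> = R" for x
  proof -
    have "Re z = x \<and> d \<le> Im z" if "z \<in> closed_segment (Complex x d) (Complex x 1)" for z
    proof -
      obtain u where u: "0 \<le> u" "u \<le> 1" "z = (1 - u) *\<^sub>R Complex x d + u *\<^sub>R Complex x 1"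
        using \<open>z \<in> closed_segment (Complex x d) (Complex x 1)\<close> by (auto simp: in_segment)
      have "Im z = d + u * (1 - d)" "Re z = x" unfolding u(3) by (simp_all add: algebra_simps)
      moreover have "0 \<le> u * (1 - d)" using u d by simp
      ultimately show ?thesis by simp
    qed
    then have "closed_segment (Complex x d) (Complex x 1) \<subseteq> {z. z \<in> H \<and> (1 \<le> Im z \<or> \<bar>Re z\<bar> = R)}"
      using x d by (fastforce simp: H_def)
    from seg[OF this] show ?thesis using d by (simp add: cmod_def)
  qed
  have top: "norm (P (Complex R 1) - P (Complex (-R) 1)) \<le> (1 + pi / 2) * (2 * R)"
  proof -
    have "Im z = 1" if "z \<in> closed_segment (Complex R 1) (Complex (-R) 1)" for z
      using that by (auto simp: in_segment)
    then have "closed_segment (Complex R 1) (Complex (-R) 1) \<subseteq> {z. z \<in> H \<and> (1 \<le> Im z \<or> \<bar>Re z\<bar> = R)}"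
      by (fastforce simp: H_def)
    from seg[OF this] have "norm (P (Complex R 1) - P (Complex (-R) 1)) \<le> (1 + pi / 2) * norm (Complex R 1 - Complex (-R) 1)" .
    also have "Complex R 1 - Complex (-R) 1 = of_real (2 * R)" by (simp add: complex_eq_iff)
    finally show ?thesis using R(1) by (simp only: norm_of_real)
  qed
  have "((\<lambda>x. F (Complex x d)) has_integral (P (Complex R d) - P (Complex (-R) d))) {-R..R}"
  proof (rule fundamental_theorem_of_calculus)
    show "- R \<le> R" using R(1) by simp
    fix x assume "x \<in> {-R..R}"
    have "Complex x d \<in> H" using d(1) by (simp add: H_def)
    from field_vector_diff_chain_at[OF has_vector_derivative_Complex_line P[OF this]]
    have "((\<lambda>x. P (Complex x d)) has_vector_derivative F (Complex x d)) (at x)"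
      by (simp only: o_def mult_1)
    then show "((\<lambda>x. P (Complex x d)) has_vector_derivative F (Complex x d)) (at x within {-R..R})"
      by (rule has_vector_derivative_at_within)
  qed
  from has_integral_Re[OF this]
  have int: "((\<lambda>x. Re (F (Complex x d))) has_integral Re (P (Complex R d) - P (Complex (-R) d))) {-R..R}" .
  show "(\<lambda>x. Re (\<i> * cau (Complex x d) * Ln (\<i> * cau (Complex x d)))) integrable_on {-R..R}"
    using int unfolding F_def by blast
  have "integral {-R..R} (\<lambda>x. Re (F (Complex x d))) = Re (P (Complex R d) - P (Complex (-R) d))"
    using int by (rule integral_unique)
  also have "\<dots> \<le> norm (P (Complex R d) - P (Complex (-R) d))" by (rule complex_Re_le_cmod)
  also have "\<dots> = norm ((P (Complex R d) - P (Complex R 1)) + (P (Complex R 1) - P (Complex (-R) 1))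
      - (P (Complex (-R) d) - P (Complex (-R) 1)))" by simp
  \<comment> \<open>The vertical sides have length \<open>1 - d\<close> and the top has length
    \<open>2 * R\<close>.\<close>
  also have "\<dots> \<le> (1 + pi / 2) * (1 - d) + (1 + pi / 2) * (2 * R) + (1 + pi / 2) * (1 - d)"
    using R(1) by (intro norm_triangle_le_diff norm_triangle_le add_mono side top) auto
  also have "\<dots> \<le> (1 + pi / 2) * 1 + (1 + pi / 2) * (2 * R) + (1 + pi / 2) * 1"
    using d by (intro add_mono mult_left_mono) auto
  also have "\<dots> = (2 + 2 * R) * (1 + pi / 2)" by (simp add: algebra_simps)
  finally show "integral {-R..R} (\<lambda>x. Re (\<i> * cau (Complex x d) * Ln (\<i> * cau (Complex x d)))) \<le> (2 + 2 * R) * (1 + pi / 2)"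
    unfolding F_def .
qed

lemma cau_line_continuous: "0 < d \<Longrightarrow> continuous_on S (\<lambda>x. cau (Complex x d))"
  by (rule continuous_on_compose2[OF holomorphic_on_imp_continuous_on[OF cau_holomorphic]])
     (auto intro!: continuous_on_Complex_line simp: complex_eq_iff)

text \<open>For \<open>w = \<i> * cau (Complex x d)\<close> one has \<open>Re w * ln (Re w) \<le> Re
  w * ln (norm w) = Re (w * Ln w) + Im w * Im (Ln w)\<close>. The last product is at most
  \<open>pi / 2 * \<bar>Im w\<bar>\<close>, and \<open>Im w\<close> is the horizontal derivative;
  this is the origin of \<open>pi / 2 * C\<close>.\<close>

lemma integral_entropy_le:
  assumes R: "1 \<le> R" "\<And>t. t \<in> E \<Longrightarrow> \<bar>t\<bar> \<le> R - 1" and d: "0 < d" "d \<le> 1"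
    and var: "integral {-R..R} (\<lambda>x. \<bar>Re (cau (Complex x d))\<bar>) \<le> C"
  shows "integral {-R..R} (\<lambda>x. - Im (cau (Complex x d)) * ln (- Im (cau (Complex x d))))
     \<le> (2 + 2 * R) * (1 + pi / 2) + pi / 2 * C"
proof -
  let ?F = "\<lambda>x. Re (\<i> * cau (Complex x d) * Ln (\<i> * cau (Complex x d)))"
  let ?v = "\<lambda>x. \<bar>Re (cau (Complex x d))\<bar>"
  have neg: "Im (cau (Complex x d)) < 0" for x using d by (intro Im_cau_neg) simp
  note cont = cau_line_continuous[OF d(1)]
  have int_v: "?v integrable_on {-R..R}"
    by (intro integrable_continuous_interval continuous_intros cont)
  have int_pv: "(\<lambda>x. pi / 2 * ?v x) integrable_on {-R..R}"
    by (intro integrable_continuous_interval continuous_intros cont)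
  note int_F = integral_Re_Ln_cau(1)[OF R d]
  have int_u: "(\<lambda>x. - Im (cau (Complex x d)) * ln (- Im (cau (Complex x d)))) integrable_on {-R..R}"
    using neg by (intro integrable_continuous_interval continuous_intros cont) (auto simp: less_imp_neq)
  have "integral {-R..R} (\<lambda>x. - Im (cau (Complex x d)) * ln (- Im (cau (Complex x d))))
      \<le> integral {-R..R} (\<lambda>x. ?F x + pi / 2 * ?v x)"
  proof (rule integral_le[OF int_u])
    show "(\<lambda>x. ?F x + pi / 2 * ?v x) integrable_on {-R..R}"
      by (rule integrable_add[OF int_F int_pv])
    fix x
    define w where "w = \<i> * cau (Complex x d)"
    have w: "0 < Re w" "w \<noteq> 0" using neg[of x] by (auto simp: w_def)
    have "Re w * ln (Re w) \<le> Re w * ln (norm w)"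
      using w complex_Re_le_cmod[of w] by (intro mult_left_mono ln_mono) auto
    also have "\<dots> = Re (w * Ln w) + Im w * Im (Ln w)" using w by simp
    also have "Im w * Im (Ln w) \<le> \<bar>Im w\<bar> * \<bar>Im (Ln w)\<bar>" by (metis abs_ge_self abs_mult)
    also have "\<dots> \<le> \<bar>Im w\<bar> * (pi / 2)"
      using Re_Ln_pos_lt[OF w(2)] w(1) by (intro mult_left_mono) auto
    finally show "- Im (cau (Complex x d)) * ln (- Im (cau (Complex x d))) \<le> ?F x + pi / 2 * ?v x"
      by (simp add: w_def mult.commute)
  qed
  also have "\<dots> = integral {-R..R} ?F + pi / 2 * integral {-R..R} ?v"
  proof -
    have "integral {-R..R} (\<lambda>x. pi / 2 * ?v x) = pi / 2 * integral {-R..R} ?v"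
      by (rule integral_mult[OF int_v, symmetric])
    with Henstock_Kurzweil_Integration.integral_add[OF int_F int_pv] show ?thesis by (rule trans[OF _ arg_cong])
  qed
  also have "\<dots> \<le> (2 + 2 * R) * (1 + pi / 2) + pi / 2 * C"
    using integral_Re_Ln_cau(2)[OF R d] var by (intro add_mono mult_left_mono) auto
  finally show ?thesis .
qed

end

section \<open>Variation of the potential along horizontal lines of the upper half plane\<close>

context green_equilibrium
begin

text \<open>With the signs of the increments frozen, the sum of absolute values becomes the value at
  \<open>Complex 0 d\<close> of a harmonic function. On the real line that function is at most the
  variation of \<open>f\<close> on a translated sample, hence at most \<open>C\<close>, and at
  infinity it tends to 0.\<close>

lemma variation_upper:
  assumes C: "0 \<le> C" "\<And>x n. incseq x \<Longrightarrow> x n \<le> x 0 + W \<Longrightarrow> (\<Sum>i<n. \<bar>f (x (Suc i)) - f (x i)\<bar>) \<le> C"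
    and x: "incseq x" "x n \<le> x 0 + W" and d: "0 < d"
  shows "(\<Sum>i<n. \<bar>pot (Complex (x (Suc i)) d) - pot (Complex (x i) d)\<bar>) \<le> C"
proof -
  define s where "s i = sgn (pot (Complex (x (Suc i)) d) - pot (Complex (x i) d))" for i
  define h where "h z = (\<Sum>i<n. s i * (g0 (z + of_real (x (Suc i))) - g0 (z + of_real (x i))))" for z
  \<comment> \<open>\<open>k\<close> is visibly harmonic, while \<open>h\<close> is continuous up to
    the line and so controls the superlevel sets. The constant \<open>V\<close> cancels in
    increments, so both differ by \<open>C\<close> on the open half plane.\<close>
  define k where "k z = (\<Sum>i<n. s i * (pot (z + of_real (x (Suc i))) - pot (z + of_real (x i)))) - C" for z
  let ?H = "{z. 0 < Im z}"
  have oH: "open ?H" by (rule open_halfspace_Im_gt)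
  have hk: "h z = k z + C" if "z \<in> ?H" for z
  proof -
    have "g0 (z + of_real r) = pot (z + of_real r) + V" for r
    proof -
      have "z + of_real r \<in> Omega" using that by (auto simp: complex_eq_iff)
      then show ?thesis using green_eq_pot by (simp add: g0_def)
    qed
    then show ?thesis by (simp add: h_def k_def)
  qed
  have tr: "harmonic_on (\<lambda>z. pot (z + of_real r)) ?H" for r
    by (rule harmonic_on_subset[OF harmonic_on_translate[OF pot_harmonic] oH]) (auto simp: complex_eq_iff)
  have "harmonic_on k ?H"
    unfolding k_def by (intro harmonic_on_diff harmonic_on_sum harmonic_on_cmult harmonic_on_const tr oH) auto
  moreover have "compact {z \<in> ?H. e \<le> k z}" if e: "0 < e" for e
  proof -
    have "Im z \<noteq> 0" if "C + e \<le> h z" for z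
    proof
      assume "Im z = 0"
      then have z: "z = of_real (Re z)" by (simp add: complex_eq_iff)
      have "h z = (\<Sum>i<n. s i * (f (Re z + x (Suc i)) - f (Re z + x i)))"
        by (subst z) (simp add: h_def f_def)
      also have "\<dots> \<le> (\<Sum>i<n. \<bar>f (Re z + x (Suc i)) - f (Re z + x i)\<bar>)"
      proof (rule sum_mono)
        fix i
        have "\<bar>s i\<bar> \<le> 1" by (simp add: s_def sgn_if)
        then have le: "\<bar>s i * (f (Re z + x (Suc i)) - f (Re z + x i))\<bar> \<le> 1 * \<bar>f (Re z + x (Suc i)) - f (Re z + x i)\<bar>"
          unfolding abs_mult by (intro mult_right_mono) auto
        show "s i * (f (Re z + x (Suc i)) - f (Re z + x i)) \<le> \<bar>f (Re z + x (Suc i)) - f (Re z + x i)\<bar>"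
          using order.trans[OF abs_ge_self le] by (simp only: mult_1)
      qed
      also have "\<dots> \<le> C"
        using x C(2)[of "\<lambda>i. Re z + x i" n] by (simp add: incseq_def)
      finally show False using that e by simp
    qed
    then have eq: "{z \<in> ?H. e \<le> k z} = {z. 0 \<le> Im z} \<inter> h -` {C + e..}"
    proof (intro set_eqI iffI)
      fix z assume "z \<in> {z \<in> ?H. e \<le> k z}"
      then show "z \<in> {z. 0 \<le> Im z} \<inter> h -` {C + e..}" using hk[of z] by simp
    next
      fix z assume z: "z \<in> {z. 0 \<le> Im z} \<inter> h -` {C + e..}"
      then have "Im z \<noteq> 0" using \<open>\<And>z. C + e \<le> h z \<Longrightarrow> Im z \<noteq> 0\<close> by simp
      then show "z \<in> {z \<in> ?H. e \<le> k z}" using z hk[of z] by simp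
    qed
    have ch: "continuous_on UNIV h"
      unfolding h_def by (intro continuous_intros continuous_on_compose2[OF g0_continuous]) auto
    have "closed ({z. 0 \<le> Im z} \<inter> h -` {C + e..})"
      by (intro closed_Int closed_halfspace_Im_ge closed_vimage closed_atLeast ch)
    moreover have "bounded ({z. 0 \<le> Im z} \<inter> h -` {C + e..})"
    proof -
      have "(h \<longlongrightarrow> (\<Sum>i<n. s i * 0)) at_infinity"
        unfolding h_def by (intro tendsto_intros g0_diff_at_infinity)
      then have "(h \<longlongrightarrow> 0) at_infinity" by simp
      then have "eventually (\<lambda>z. h z < C + e) at_infinity"
        using order_tendstoD(2)[of h 0 at_infinity "C + e"] C(1) e by simp
      then obtain B where B: "\<And>z. B \<le> norm z \<Longrightarrow> h z < C + e" unfolding eventually_at_infinity by blast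
      have "norm z \<le> B" if "z \<in> {z. 0 \<le> Im z} \<inter> h -` {C + e..}" for z
        using B[of z] that by (cases "B \<le> norm z") auto
      then show ?thesis unfolding bounded_iff by blast
    qed
    ultimately show ?thesis unfolding eq by (simp add: compact_eq_bounded_closed)
  qed
  moreover have "Complex 0 d \<in> ?H" using d by simp
  ultimately have "k (Complex 0 d) \<le> 0" by (rule harmonic_on_max_principle)
  moreover have "Complex 0 d + of_real r = Complex r d" for r by (simp add: complex_eq_iff)
  ultimately show ?thesis by (simp add: k_def s_def abs_sgn mult.commute)
qed

lemma integral_Re_cau_le:
  assumes R: "0 < R" and summ: "(\<lambda>G. g (of_real (critical_point g G))) summable_on gaps E"
  obtains C where "\<And>d. 0 < d \<Longrightarrow> integral {-R..R} (\<lambda>x. \<bar>Re (cau (Complex x d))\<bar>) \<le> C"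
proof -
  obtain C where C: "0 \<le> C"
    "\<And>x n. incseq x \<Longrightarrow> x n \<le> x 0 + 2 * R \<Longrightarrow> (\<Sum>i<n. \<bar>f (x (Suc i)) - f (x i)\<bar>) \<le> C"
    using f_variation[of "2 * R"] R summ by auto
  have "integral {-R..R} (\<lambda>x. \<bar>Re (cau (Complex x d))\<bar>) \<le> C" if d: "0 < d" for d
  proof (rule integral_abs_deriv_le_variation[where \<phi> = "\<lambda>x. pot (Complex x d)"])
    show "- R < R" using R by simp
    show "continuous_on {-R..R} (\<lambda>x. Re (cau (Complex x d)))"
      by (intro continuous_intros cau_line_continuous d)
    show "((\<lambda>x. pot (Complex x d)) has_real_derivative Re (cau (Complex x d))) (at x)" for x
    proof -
      have O: "Complex x d \<in> Omega" using d by (auto simp: complex_eq_iff)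
      have "((\<lambda>x. pot (Complex x d)) has_derivative (\<lambda>h. Re (cau (Complex x d) * (h *\<^sub>R 1)))) (at x)"
        by (rule has_derivative_compose[OF has_vector_derivative_Complex_line[unfolded has_vector_derivative_def] pot_has_derivative[OF O]])
      then show ?thesis unfolding has_field_derivative_def
        by (rule has_derivative_eq_rhs) (simp add: fun_eq_iff)
    qed
    show "(\<Sum>i<n. \<bar>pot (Complex (x (Suc i)) d) - pot (Complex (x i) d)\<bar>) \<le> C"
      if "incseq x" "x 0 = - R" "x n = R" for x n
      using that by (intro variation_upper[where W = "2 * R"] C d) auto
  qed
  then show ?thesis by (rule that)
qed

end

section \<open>Absolute continuity\<close>

lemma entropy_ge:
  assumes "0 < (u::real)"
  shows "0 \<le> u * ln u + 1"
proof -
  have "u * - ln u \<le> u * (1 / u - 1)"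
    using ln_le_minus_one[of "1 / u"] assms by (intro mult_left_mono) (auto simp: ln_div)
  also have "\<dots> \<le> 1" using assms by (simp add: algebra_simps)
  finally show ?thesis by simp
qed

text \<open>Above the level \<open>T\<close> the factor \<open>ln u\<close> is at least
  \<open>ln T\<close>, which trades size for entropy. The summand 1 makes the second term
  nonnegative, so it may be integrated over all of \<open>{-R..R}\<close> rather than over a small
  set.\<close>

lemma le_entropy:
  assumes "1 < T" "0 < (u::real)"
  shows "u \<le> T + (u * ln u + 1) / ln T"
proof (cases "T \<le> u")
  case True
  have "u * ln T \<le> u * ln u" using True assms by (intro mult_left_mono ln_mono) auto
  then have "u * ln T \<le> u * ln u + 1" by linarith
  then have "u \<le> (u * ln u + 1) / ln T" using assms by (simp add: pos_le_divide_eq)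
  then show ?thesis using assms by simp
next
  case False
  have "0 \<le> (u * ln u + 1) / ln T" using entropy_ge[OF assms(2)] assms(1) by simp
  then show ?thesis using False by simp
qed

context compact_prob_space
begin

text \<open>\<open>- Im (cau (Complex x d))\<close> integrates the Poisson kernel without its factor
  \<open>1 / pi\<close>. This kernel is at least \<open>1 / (2 * d)\<close> on the interval of
  length \<open>2 * d\<close> about \<open>t\<close>, so each \<open>t\<close> in \<open>K\<close>
  contributes at least 1 over \<open>Q\<close>, and Tonelli's theorem finishes. One fixed
  \<open>d\<close> thus replaces a weak limit.\<close>

lemma emeasure_le_cau:
  assumes K: "K \<in> sets borel" and Q [measurable]: "Q \<in> sets borel" and d: "0 < d"
    and near: "\<And>t. t \<in> K \<Longrightarrow> {t - d..t + d} \<subseteq> Q"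
  shows "emeasure \<mu> K \<le> (\<integral>\<^sup>+ x. ennreal (- Im (cau (Complex x d))) * indicator Q x \<partial>lborel)"
proof -
  interpret P: pair_sigma_finite lborel \<mu> ..
  define k where "k x t = d / ((x - t)\<^sup>2 + d\<^sup>2)" for x t :: real
  have k: "0 \<le> k x t" for x t using d by (simp add: k_def)
  have [measurable]: "(\<lambda>p. k (fst p) (snd p)) \<in> borel_measurable (borel \<Otimes>\<^sub>M borel)"
    unfolding k_def by measurable
  have [measurable]: "k x \<in> borel_measurable borel" for x unfolding k_def by measurable
  have cau: "ennreal (- Im (cau (Complex x d))) = (\<integral>\<^sup>+ t. ennreal (k x t) \<partial>\<mu>)" for x
  proof -
    have xO: "Complex x d \<in> Omega" using d by (auto simp: complex_eq_iff)
    have k_eq: "k x t = - Im (inverse (Complex x d - of_real t))" for t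
      by (simp add: k_def)
    have int: "integrable \<mu> (\<lambda>t. Im (inverse (Complex x d - of_real t)))"
      by (rule integrable_Im[OF integrable_inverse[OF xO]])
    have "- Im (cau (Complex x d)) = (\<integral>t. k x t \<partial>\<mu>)"
      unfolding cau_def k_eq using integral_Im[OF integrable_inverse[OF xO]]
      by (simp del: inverse_complex.sel)
    also have "ennreal \<dots> = (\<integral>\<^sup>+ t. ennreal (k x t) \<partial>\<mu>)"
    proof (rule nn_integral_eq_integral[symmetric])
      show "integrable \<mu> (k x)" using int unfolding k_eq by (simp del: inverse_complex.sel)
      show "AE t in \<mu>. 0 \<le> k x t" using k by simp
    qed
    finally show ?thesis .
  qed
  have one: "1 \<le> (\<integral>\<^sup>+ x. ennreal (k x t) * indicator Q x \<partial>lborel)" if t: "t \<in> K" for t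
  proof -
    have "(1::ennreal) = ennreal (1 / (2 * d)) * ennreal (2 * d)"
      using d by (simp add: ennreal_mult[symmetric])
    also have "\<dots> = (\<integral>\<^sup>+ x. ennreal (1 / (2 * d)) * indicator {t - d..t + d} x \<partial>lborel)"
      using d by (subst nn_integral_cmult_indicator) auto
    also have "\<dots> \<le> (\<integral>\<^sup>+ x. ennreal (k x t) * indicator Q x \<partial>lborel)"
    proof (rule nn_integral_mono)
      fix x
      show "ennreal (1 / (2 * d)) * indicator {t - d..t + d} x \<le> ennreal (k x t) * indicator Q x"
      proof (cases "x \<in> {t - d..t + d}")
        case True
        have "(x - t)\<^sup>2 \<le> d\<^sup>2" using True by (intro abs_le_square_iff[THEN iffD1]) auto
        then have "d / (2 * d\<^sup>2) \<le> k x t"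
          unfolding k_def using d by (intro divide_left_mono) (auto simp: add_nonneg_pos)
        also have "d / (2 * d\<^sup>2) = 1 / (2 * d)" using d by (simp add: power2_eq_square)
        finally show ?thesis using True near[OF t] by (auto simp: ennreal_leI)
      qed auto
    qed
    finally show ?thesis .
  qed
  have "emeasure \<mu> K = (\<integral>\<^sup>+ t. indicator K t \<partial>\<mu>)" using K by (simp add: sets_eq)
  also have "\<dots> \<le> (\<integral>\<^sup>+ t. (\<integral>\<^sup>+ x. ennreal (k x t) * indicator Q x \<partial>lborel) \<partial>\<mu>)"
    using one by (intro nn_integral_mono) (auto simp: indicator_def)
  also have "\<dots> = (\<integral>\<^sup>+ x. (\<integral>\<^sup>+ t. ennreal (k x t) * indicator Q x \<partial>\<mu>) \<partial>lborel)"
    by (rule P.Fubini') (simp add: case_prod_unfold)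
  also have "\<dots> = (\<integral>\<^sup>+ x. ennreal (- Im (cau (Complex x d))) * indicator Q x \<partial>lborel)"
    by (simp add: cau nn_integral_multc)
  finally show ?thesis .
qed

text \<open>A uniform \<open>L log L\<close> bound on the Poisson smoothings makes them uniformly integrable.\<close>

lemma absolutely_continuous_entropy:
  assumes R: "\<And>t. t \<in> E \<Longrightarrow> \<bar>t\<bar> < R"
    and M: "\<And>d. 0 < d \<Longrightarrow> d \<le> 1 \<Longrightarrow>
      integral {-R..R} (\<lambda>x. - Im (cau (Complex x d)) * ln (- Im (cau (Complex x d)))) \<le> M"
  shows "absolutely_continuous lborel \<mu>"
proof -
  have R0: "0 < R" using AE_support R by (metis AE_False abs_ge_zero eventually_mono le_less_trans)
  \<comment> \<open>A compact null set has an open neighbourhood \<open>Q\<close> inside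
    \<open>{-R<..<R}\<close> of length at most \<open>e\<close>; \<open>le_entropy\<close> then
    gives \<open>T * e\<close> over \<open>Q\<close> plus an entropy term. The height
    \<open>d\<close> is chosen after \<open>Q\<close>, hence \<open>M\<close> must serve all
    heights. The \<open>2 * R\<close> integrates the summand 1.\<close>
  have small: "emeasure \<mu> K \<le> ennreal (T * e + (M + 2 * R) / ln T)"
    if K: "compact K" "K \<subseteq> E" "emeasure lborel K = 0" and T: "1 < T" and e: "0 < e" for K T e
  proof -
    have Kb: "K \<in> sets borel" using K(1) by (simp add: borel_compact)
    obtain U where U: "open U" "K \<subseteq> U" "emeasure lborel (U - K) < ennreal e"
      using outer_regular_lborel[OF Kb e] by blast
    define Q where "Q = U \<inter> {-R<..<R}"
    have Q: "open Q" "K \<subseteq> Q" "Q \<subseteq> {-R..R}" 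
    proof -
      have "- R < t \<and> t < R" if "t \<in> K" for t using R[of t] K(2) that by auto
      then show "open Q" "K \<subseteq> Q" "Q \<subseteq> {-R..R}" using U by (auto simp: Q_def)
    qed
    have Ob [measurable]: "Q \<in> sets borel" using Q(1) by simp
    have "emeasure lborel Q \<le> emeasure lborel ((U - K) \<union> K)"
      using U Kb by (intro emeasure_mono) (auto simp: Q_def)
    also have "\<dots> \<le> emeasure lborel (U - K) + emeasure lborel K"
      using U Kb by (intro emeasure_subadditive) auto
    finally have "emeasure lborel Q \<le> emeasure lborel (U - K)" unfolding K(3) add_0_right .
    then have Qe: "emeasure lborel Q \<le> ennreal e"
      by (rule order.trans[OF _ less_imp_le[OF U(3)]])
    obtain d where d: "0 < d" "d \<le> 1" "\<And>t. t \<in> K \<Longrightarrow> {t - d..t + d} \<subseteq> Q"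
    proof -
      obtain r where r: "0 < r" "\<And>t. t \<in> K \<Longrightarrow> ball t r \<subseteq> Q"
      proof -
        obtain r where "0 < r" "(\<Union>t\<in>K. ball t r) \<subseteq> Q"
          using compact_subset_open_imp_ball_epsilon_subset[OF K(1) Q(1,2)] by metis
        then show ?thesis by (intro that[of r]) auto
      qed
      show ?thesis
      proof (rule that[of "min 1 (r / 2)"])
        fix t assume "t \<in> K"
        have "{t - min 1 (r / 2)..t + min 1 (r / 2)} \<subseteq> ball t r"
          using r(1) by (auto simp: dist_real_def)
        then show "{t - min 1 (r / 2)..t + min 1 (r / 2)} \<subseteq> Q" using r(2)[OF \<open>t \<in> K\<close>] by blast
      qed (use r in auto)
    qed
    define u where "u x = - Im (cau (Complex x d))" for x
    have u: "0 < u x" for x unfolding u_def using Im_cau_neg[of "Complex x d"] d by simp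
    have uc: "continuous_on S u" for S
      unfolding u_def by (intro continuous_intros cau_line_continuous d)
    have [measurable]: "u \<in> borel_measurable borel"
      using uc by (rule borel_measurable_continuous_onI)
    let ?h = "\<lambda>x. (u x * ln (u x) + 1) / ln T"
    have h: "0 \<le> ?h x" for x using entropy_ge[OF u] T by simp
    have int: "(\<lambda>x. u x * ln (u x)) integrable_on {-R..R}"
      using u by (intro integrable_continuous_interval continuous_intros uc) (auto simp: less_imp_neq[symmetric])
    then have "((\<lambda>x. u x * ln (u x) + 1) has_integral (integral {-R..R} (\<lambda>x. u x * ln (u x)) + 2 * R)) {-R..R}"
      using has_integral_const_real[of "1::real" "-R" R] R0
      by (intro has_integral_add integrable_integral) (auto simp: max_def)
    from has_integral_divide[OF this, of "ln T"]
    have hI: "(?h has_integral ((integral {-R..R} (\<lambda>x. u x * ln (u x)) + 2 * R) / ln T)) {-R..R}" .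
    have "emeasure \<mu> K \<le> (\<integral>\<^sup>+ x. ennreal (u x) * indicator Q x \<partial>lborel)"
      unfolding u_def using d by (intro emeasure_le_cau Kb Ob)
    also have "\<dots> \<le> (\<integral>\<^sup>+ x. ennreal T * indicator Q x + ennreal (?h x) * indicator {-R..R} x \<partial>lborel)"
    proof (rule nn_integral_mono)
      fix x
      show "ennreal (u x) * indicator Q x \<le> ennreal T * indicator Q x + ennreal (?h x) * indicator {-R..R} x"
      proof (cases "x \<in> Q")
        case True
        have "ennreal (u x) \<le> ennreal (T + ?h x)" using le_entropy[OF T u] by (rule ennreal_leI)
        also have "\<dots> = ennreal T + ennreal (?h x)" using T h by (intro ennreal_plus) auto
        finally show ?thesis using True Q(3) by auto
      qed simp
    qed
    also have "\<dots> = ennreal T * emeasure lborel Q + ennreal ((integral {-R..R} (\<lambda>x. u x * ln (u x)) + 2 * R) / ln T)"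
      using nn_integral_has_integral_lebesgue'[OF h hI]
      by (subst nn_integral_add) (auto simp: nn_integral_cmult_indicator)
    also have "\<dots> \<le> ennreal T * ennreal e + ennreal ((M + 2 * R) / ln T)"
      using Qe M[OF d(1,2)] T by (intro add_mono mult_left_mono ennreal_leI divide_right_mono) (auto simp: u_def)
    also have "\<dots> = ennreal (T * e + (M + 2 * R) / ln T)"
    proof -
      have "0 \<le> (integral {-R..R} (\<lambda>x. u x * ln (u x)) + 2 * R) / ln T"
        using hI h by (rule has_integral_nonneg)
      also have "\<dots> \<le> (M + 2 * R) / ln T"
        using M[OF d(1,2)] T by (intro divide_right_mono) (auto simp: u_def)
      finally show ?thesis using T e by (simp add: ennreal_plus ennreal_mult)
    qed
    finally show ?thesis .
  qed
  have null: "emeasure \<mu> K = 0" if K: "compact K" "K \<subseteq> E" "emeasure lborel K = 0" for K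
  proof -
    have "emeasure \<mu> K \<le> ennreal e" if e: "0 < e" for e
    proof -
      \<comment> \<open>This makes the entropy term at most \<open>e / 2\<close>; the length bound
        \<open>e / (2 * T)\<close> supplies the other half. The \<open>+ 1\<close> keeps
        \<open>T > 1\<close> when \<open>M + 2 * R\<close> is 0.\<close>
      define T where "T = exp (2 * \<bar>M + 2 * R\<bar> / e + 1)"
      have T: "1 < T" "2 * \<bar>M + 2 * R\<bar> / e < ln T" using e by (auto simp: T_def add_nonneg_pos)
      have "(M + 2 * R) / ln T \<le> e / 2"
      proof -
        have "2 * (M + 2 * R) \<le> 2 * \<bar>M + 2 * R\<bar>" by (intro mult_left_mono abs_ge_self) simp
        also have "\<dots> < ln T * e" using T(2) e by (simp add: pos_divide_less_eq)
        finally have "M + 2 * R \<le> e / 2 * ln T" by (simp add: mult.commute)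
        then show ?thesis using T(1) by (simp add: pos_divide_le_eq)
      qed
      moreover have "T * (e / (2 * T)) = e / 2" using T(1) by simp
      ultimately have "T * (e / (2 * T)) + (M + 2 * R) / ln T \<le> e" by linarith
      moreover have "emeasure \<mu> K \<le> ennreal (T * (e / (2 * T)) + (M + 2 * R) / ln T)"
        using e T(1) by (intro small[OF K]) auto
      ultimately show ?thesis using order.trans ennreal_leI by blast
    qed
    then show ?thesis by (metis ennreal_le_epsilon add_0 le_zero_eq zero_le)
  qed
  show ?thesis
    unfolding absolutely_continuous_def
  proof
    fix N :: "real set" assume N: "N \<in> null_sets lborel"
    then have Nb: "N \<in> sets borel" by auto
    \<comment> \<open>Inner regularity of \<open>\<mu>\<close> reduces a null set to its compact
      subsets, which are what the thickening by \<open>d\<close> requires.\<close>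
    have "emeasure \<mu> (N \<inter> E) = (SUP K\<in>{K. K \<subseteq> N \<inter> E \<and> compact K}. emeasure \<mu> K)"
      using Nb by (intro inner_regular) (auto simp: sets_eq compact borel_compact)
    also have "\<dots> \<le> 0"
    proof (rule SUP_least)
      fix K assume K: "K \<in> {K. K \<subseteq> N \<inter> E \<and> compact K}"
      then have "emeasure lborel K \<le> emeasure lborel N" using Nb by (intro emeasure_mono) auto
      then have "emeasure lborel K = 0" using N by (auto simp: null_sets_def)
      then show "emeasure \<mu> K \<le> 0" using null K by auto
    qed
    finally have "emeasure \<mu> (N \<inter> E) = 0" by simp
    moreover have "emeasure \<mu> N = emeasure \<mu> (N \<inter> E)"
      using AE_support Nb compact by (intro emeasure_eq_AE) (auto simp: sets_eq borel_compact)
    ultimately show "N \<in> null_sets \<mu>" using Nb by (auto simp: null_sets_def sets_eq)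
  qed
qed

end

theorem proposition2:
  fixes E :: "real set" and \<mu> :: "real measure"
  assumes "parreau_widom E"
    and "0 < emeasure lborel E"
    and "is_equilibrium_measure E \<mu>"
  shows "absolutely_continuous lborel \<mu>"
proof -
  have E: "compact E" and cap: "0 < log_capacity E"
    using assms(1) by (auto simp: parreau_widom_def)
  obtain g where g: "is_green_function E g" "vanishes_at_boundary E g"
      "(\<lambda>G. g (complex_of_real (critical_point g G))) summable_on gaps E"
    using assms(1) unfolding parreau_widom_def by blast
  have \<mu>: "prob_space \<mu>" "sets \<mu> = sets borel" "emeasure \<mu> E = 1"
    and minimal: "\<And>\<nu>. \<nu> \<in> prob_measures_on E \<Longrightarrow> log_energy \<mu> \<le> log_energy \<nu>"
    using assms(3) by (auto simp: is_equilibrium_measure_def prob_measures_on_def)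
  interpret prob_space \<mu> by (rule \<mu>(1))
  have "AE t in \<mu>. t \<in> E"
    using \<mu> E by (intro AE_prob_1) (simp add: measure_def)
  then interpret compact_prob_space \<mu> E
    by unfold_locales (use \<mu> E in auto)
  have robin: "robin_constant E = log_energy \<mu>"
    unfolding robin_constant_def using assms(3)
    by (intro antisym INF_lower INF_greatest) (auto simp: is_equilibrium_measure_def)
  \<comment> \<open>An infinite Robin constant would mean capacity 0 by definition. Since
    \<open>E\<close> is bounded, the negative part of the energy is finite, so the positive part is
    finite too.\<close>
  have "log_energy \<mu> \<noteq> \<infinity>"
    using cap robin by (auto simp: log_capacity_def)
  moreover have "(\<integral>\<^sup>+ s. (\<integral>\<^sup>+ t. e2ennreal (- log_kernel s t) \<partial>\<mu>) \<partial>\<mu>) < \<infinity>"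
  proof -
    obtain D where D: "1 \<le> D" "\<And>s t. s \<in> E \<Longrightarrow> t \<in> E \<Longrightarrow> \<bar>s - t\<bar> \<le> D" using diameter_E by blast
    have "(\<integral>\<^sup>+ s. (\<integral>\<^sup>+ t. e2ennreal (- log_kernel s t) \<partial>\<mu>) \<partial>\<mu>) \<le> (\<integral>\<^sup>+ s. (\<integral>\<^sup>+ t. ennreal (ln D) \<partial>\<mu>) \<partial>\<mu>)"
    proof (rule nn_integral_mono_AE)
      show "AE s in \<mu>. (\<integral>\<^sup>+ t. e2ennreal (- log_kernel s t) \<partial>\<mu>) \<le> (\<integral>\<^sup>+ t. ennreal (ln D) \<partial>\<mu>)"
        using AE_support
      proof eventually_elim
        case s: (elim s)
        show ?case
        proof (rule nn_integral_mono_AE)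
          show "AE t in \<mu>. e2ennreal (- log_kernel s t) \<le> ennreal (ln D)"
            using AE_support
          proof eventually_elim
            case (elim t)
            show ?case
            proof (cases "s = t")
              case False
              then have "- ln (1 / \<bar>s - t\<bar>) \<le> ln D" using D(2)[OF s elim] by (simp add: ln_div)
              then show ?thesis using False by (simp add: log_kernel_def ennreal_leI)
            qed (simp add: log_kernel_def e2ennreal_neg)
          qed
        qed
      qed
    qed
    also have "\<dots> < \<infinity>" by (simp add: emeasure_space_1)
    finally show ?thesis .
  qed
  ultimately have fin: "(\<integral>\<^sup>+ s. (\<integral>\<^sup>+ t. e2ennreal (log_kernel s t) \<partial>\<mu>) \<partial>\<mu>) < \<infinity>"
    unfolding log_energy_def
    by (cases "\<integral>\<^sup>+ s. (\<integral>\<^sup>+ t. e2ennreal (log_kernel s t) \<partial>\<mu>) \<partial>\<mu>";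
        cases "\<integral>\<^sup>+ s. (\<integral>\<^sup>+ t. e2ennreal (- log_kernel s t) \<partial>\<mu>) \<partial>\<mu>") auto
  interpret equilibrium_measure \<mu> E
    by unfold_locales (use fin minimal in auto)
  interpret green_equilibrium \<mu> E g
  proof
    show "log_capacity E = exp (- V)"
      by (simp add: log_capacity_def robin log_energy_eq)
  qed (use g in auto)
  obtain b where b: "0 < b" "\<And>t. t \<in> E \<Longrightarrow> \<bar>t\<bar> < b" using bounded_E by blast
  \<comment> \<open>The added 1 is the distance kept between \<open>E\<close> and the vertical sides
    of the rectangle in Cauchy's theorem.\<close>
  define R where "R = b + 1"
  have R: "1 \<le> R" "0 < R" "\<And>t. t \<in> E \<Longrightarrow> \<bar>t\<bar> \<le> R - 1" "\<And>t. t \<in> E \<Longrightarrow> \<bar>t\<bar> < R"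
    using b by (auto simp: R_def) (use b(2) in fastforce)+
  obtain C where C: "\<And>d. 0 < d \<Longrightarrow> integral {-R..R} (\<lambda>x. \<bar>Re (cau (Complex x d))\<bar>) \<le> C"
    using integral_Re_cau_le[OF R(2) g(3)] by blast
  show ?thesis
    using R(4) integral_entropy_le[OF R(1,3) _ _ C] by (rule absolutely_continuous_entropy)
qed

end
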